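(* For every $n\in\omega$, the set $\{a\in A\mid\exists f\in G,\ \exists k\in n,\ f(a)(k)=0\}$ is a countable set in the ground model $\mathcal{B}$.
   Context: Let $V$ be a model of $\mathrm{ZFA}$ plus the axiom of choice, with set of atoms $A$, $|A|>\aleph_0$. Let $\mathcal{S}$ be the group of all permutations of $A$, acting on $V$ by $\pi(x)=\{\pi(t)\mid t\in x\}$; $sym(x)=\{\pi\in\mathcal{S}\mid\pi(x)=x\}$; for at most countable $C\subseteq A$, $\mathcal{S}_C$ is the pointwise stabilizer of $C$; $F$ is the filter of subgroups of $\mathcal{S}$ containing some such $\mathcal{S}_C$; $x$ is symmetric iff $sym(x)\in F$; $\mathcal{B}$ is the permutation model of all $x$ whose transitive closure consists of symmetric elements. Working in $\mathcal{B}$: $Q$ is the set of functions $h\colon D\to\{0,1\}$ with $D\subseteq\omega$ finite, $h_0\le_Q h_1$ iff $h_0$ extends $h_1$; $I=\{h\in Q\mid\exists n,\ h(n)=0\}$. For $n\in\omega$ (identified with $\{0,\dots,n-1\}$), $P_n$ is the set of functions $f\colon A\to Q$ in $\mathcal{B}$ with (1) $\mathrm{dom}\,f(a)=n$ for all $a$; (2) $f^{-1}(I)$ at most countable; (3) for each $t\colon n\to\{0,1\}$ infinitely many $a\in A$ satisfy $f(a)=t$. $P=\bigcup_n P_n$, with $f_0\le f_1$ ($f_0$ stronger) iff $f_0(a)\le_Q f_1(a)$ for all $a\in A$. $G$ is a $P$-generic filter over $\mathcal{B}$ (the ground model). *)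

theory Defs
  imports "HOL-Algebra.Group"
begin

text \<open>
  Models of set theory with atoms are arbitrary (possibly ill-founded) first-order structures for
  the language with membership and a constant for the set of atoms. Set-theoretic notions are
  relativised to a structure, so that the same definitions can be read in the given model and in
  its permutation submodel. A generic filter is an external subset of the domain, which is why the
  axiom schemes must be the first-order ones: over a model of second-order Replacement there would
  be no generic filter.
\<close>

record 'v struct =
  Dom :: "'v set"
  Mem :: "'v \<Rightarrow> 'v \<Rightarrow> bool"
  AtomSet :: 'v

definition ext :: "'v struct \<Rightarrow> 'v \<Rightarrow> 'v set" where
  "ext M x = {t \<in> Dom M. Mem M t x}"

definition atoms :: "'v struct \<Rightarrow> 'v set" where
  "atoms M = ext M (AtomSet M)"

text \<open>Atoms have no elements, so a set has to be told apart from an atom explicitly.\<close>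

definition is_set :: "'v struct \<Rightarrow> 'v \<Rightarrow> bool" where
  "is_set M x \<longleftrightarrow> x \<in> Dom M \<and> x \<notin> atoms M"


subsection \<open>First-order formulas\<close>

datatype fm = FMem nat nat | FEq nat nat | FNeg fm | FConj fm fm | FAll nat fm

primrec sat :: "'v struct \<Rightarrow> (nat \<Rightarrow> 'v) \<Rightarrow> fm \<Rightarrow> bool" where
  "sat M e (FMem i j) \<longleftrightarrow> Mem M (e i) (e j)"
| "sat M e (FEq i j) \<longleftrightarrow> e i = e j"
| "sat M e (FNeg \<phi>) \<longleftrightarrow> \<not> sat M e \<phi>"
| "sat M e (FConj \<phi> \<psi>) \<longleftrightarrow> sat M e \<phi> \<and> sat M e \<psi>"
| "sat M e (FAll i \<phi>) \<longleftrightarrow> (\<forall>x\<in>Dom M. sat M (e(i := x)) \<phi>)"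


subsection \<open>Pairs, functions, natural numbers, cardinality inside a structure\<close>

definition opair :: "'v struct \<Rightarrow> 'v \<Rightarrow> 'v \<Rightarrow> 'v \<Rightarrow> bool" where
  "opair M a b p \<longleftrightarrow> p \<in> Dom M \<and>
     (\<exists>u\<in>Dom M. \<exists>v\<in>Dom M. ext M u = {a} \<and> ext M v = {a, b} \<and> ext M p = {u, v})"

definition rel :: "'v struct \<Rightarrow> 'v \<Rightarrow> 'v \<Rightarrow> 'v \<Rightarrow> bool" where
  "rel M r a b \<longleftrightarrow> (\<exists>p\<in>ext M r. opair M a b p)"

text \<open>\<open>f\<close> is an element of the structure that is a function from \<open>K\<close> to \<open>L\<close>; only the function
  itself is required to lie in the structure.\<close>

definition fun_on :: "'v struct \<Rightarrow> 'v \<Rightarrow> 'v set \<Rightarrow> 'v set \<Rightarrow> bool" where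
  "fun_on M f K L \<longleftrightarrow> is_set M f \<and> K \<subseteq> Dom M \<and> L \<subseteq> Dom M \<and>
     (\<forall>p\<in>ext M f. \<exists>a\<in>K. \<exists>b\<in>L. opair M a b p) \<and>
     (\<forall>a\<in>K. \<exists>!b. b \<in> L \<and> rel M f a b)"

definition app :: "'v struct \<Rightarrow> 'v \<Rightarrow> 'v \<Rightarrow> 'v" where
  "app M f a = (THE b. b \<in> Dom M \<and> rel M f a b)"

definition domain_of :: "'v struct \<Rightarrow> 'v \<Rightarrow> 'v set" where
  "domain_of M h = {k \<in> Dom M. \<exists>v\<in>Dom M. rel M h k v}"

definition zero_in :: "'v struct \<Rightarrow> 'v" where
  "zero_in M = (THE z. is_set M z \<and> ext M z = {})"

definition one_in :: "'v struct \<Rightarrow> 'v" where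
  "one_in M = (THE z. is_set M z \<and> ext M z = {zero_in M})"

definition inductive_set_in :: "'v struct \<Rightarrow> 'v \<Rightarrow> bool" where
  "inductive_set_in M I \<longleftrightarrow> is_set M I \<and>
     (\<exists>z\<in>ext M I. is_set M z \<and> ext M z = {}) \<and>
     (\<forall>x\<in>ext M I. \<exists>y\<in>ext M I. is_set M y \<and> ext M y = insert x (ext M x))"

text \<open>The (von Neumann) natural numbers of the structure, so \<open>ext M n\<close> is the set of the numbers
  below \<open>n\<close>. They may be nonstandard.\<close>

definition omega :: "'v struct \<Rightarrow> 'v set" where
  "omega M = {n \<in> Dom M. \<forall>I. inductive_set_in M I \<longrightarrow> n \<in> ext M I}"

definition finite_in :: "'v struct \<Rightarrow> 'v set \<Rightarrow> bool" where
  "finite_in M K \<longleftrightarrow>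
     (\<exists>n\<in>omega M. \<exists>g. fun_on M g (ext M n) K \<and> bij_betw (app M g) (ext M n) K)"

text \<open>At most countable.\<close>

definition countable_in :: "'v struct \<Rightarrow> 'v set \<Rightarrow> bool" where
  "countable_in M K \<longleftrightarrow> (\<exists>g. fun_on M g K (omega M) \<and> inj_on (app M g) K)"


subsection \<open>The theory ZFA and the axiom of choice\<close>

definition ax_separation :: "'v struct \<Rightarrow> bool" where
  "ax_separation M \<longleftrightarrow>
     (\<forall>\<phi> e. range e \<subseteq> Dom M \<longrightarrow>
        (\<forall>x\<in>Dom M. \<exists>y. is_set M y \<and> ext M y = {t \<in> ext M x. sat M (e(0 := t)) \<phi>}))"

definition ax_replacement :: "'v struct \<Rightarrow> bool" where
  "ax_replacement M \<longleftrightarrow>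
     (\<forall>\<phi> e. range e \<subseteq> Dom M \<longrightarrow>
        (\<forall>x\<in>Dom M.
           (\<forall>t\<in>ext M x. \<forall>u\<in>Dom M. \<forall>v\<in>Dom M.
              sat M (e(0 := t, 1 := u)) \<phi> \<longrightarrow> sat M (e(0 := t, 1 := v)) \<phi> \<longrightarrow> u = v) \<longrightarrow>
           (\<exists>y. is_set M y \<and>
              ext M y = {u \<in> Dom M. \<exists>t\<in>ext M x. sat M (e(0 := t, 1 := u)) \<phi>})))"

definition zfa :: "'v struct \<Rightarrow> bool" where
  "zfa M \<longleftrightarrow>
     AtomSet M \<in> Dom M \<and>
     (\<forall>a\<in>atoms M. ext M a = {}) \<and>
     (\<exists>z. is_set M z \<and> ext M z = {}) \<and>
     (\<forall>x y. is_set M x \<longrightarrow> is_set M y \<longrightarrow> ext M x = ext M y \<longrightarrow> x = y) \<and>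
     (\<forall>x\<in>Dom M. \<forall>y\<in>Dom M. \<exists>z. is_set M z \<and> ext M z = {x, y}) \<and>
     (\<forall>x\<in>Dom M. \<exists>u. is_set M u \<and> ext M u = (\<Union>y\<in>ext M x. ext M y)) \<and>
     (\<forall>x\<in>Dom M. \<exists>p. is_set M p \<and> ext M p = {y. is_set M y \<and> ext M y \<subseteq> ext M x}) \<and>
     (\<exists>I. inductive_set_in M I) \<and>
     (\<forall>x\<in>Dom M. ext M x \<noteq> {} \<longrightarrow> (\<exists>y\<in>ext M x. ext M y \<inter> ext M x = {})) \<and>
     ax_separation M \<and>
     ax_replacement M"

definition axiom_of_choice :: "'v struct \<Rightarrow> bool" where
  "axiom_of_choice M \<longleftrightarrow>
     (\<forall>x\<in>Dom M. (\<forall>y\<in>ext M x. ext M y \<noteq> {}) \<longrightarrow>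
        (\<exists>f. fun_on M f (ext M x) (\<Union>y\<in>ext M x. ext M y) \<and>
             (\<forall>y\<in>ext M x. app M f y \<in> ext M y)))"


subsection \<open>The permutation model\<close>

definition perms :: "'v struct \<Rightarrow> 'v set" where
  "perms M = {\<pi>. fun_on M \<pi> (atoms M) (atoms M) \<and> bij_betw (app M \<pi>) (atoms M) (atoms M)}"

definition sym_grp :: "'v struct \<Rightarrow> 'v monoid" where
  "sym_grp M = \<lparr>
     carrier = perms M,
     mult = (\<lambda>\<pi> \<rho>. THE \<tau>. \<tau> \<in> perms M \<and> (\<forall>a\<in>atoms M. app M \<tau> a = app M \<pi> (app M \<rho> a))),
     one = (THE \<tau>. \<tau> \<in> perms M \<and> (\<forall>a\<in>atoms M. app M \<tau> a = a))\<rparr>"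

definition trans_set :: "'v struct \<Rightarrow> 'v \<Rightarrow> bool" where
  "trans_set M T \<longleftrightarrow> is_set M T \<and> (\<forall>x\<in>ext M T. ext M x \<subseteq> ext M T)"

text \<open>The recursion \<open>\<pi>(x) = {\<pi>(t) | t \<in> x}\<close> is carried out inside the structure: \<open>g\<close> is a
  partial solution on a transitive set containing \<open>x\<close>.\<close>

definition act :: "'v struct \<Rightarrow> 'v \<Rightarrow> 'v \<Rightarrow> 'v" where
  "act M \<pi> x = (THE y. \<exists>T g. trans_set M T \<and> x \<in> ext M T \<and> fun_on M g (ext M T) (Dom M) \<and>
     (\<forall>z\<in>ext M T. if z \<in> atoms M then app M g z = app M \<pi> z
        else is_set M (app M g z) \<and> ext M (app M g z) = app M g ` ext M z) \<and>
     y = app M g x)"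

definition sym_of :: "'v struct \<Rightarrow> 'v \<Rightarrow> 'v set" where
  "sym_of M x = {\<pi> \<in> perms M. act M \<pi> x = x}"

definition pointwise_stab :: "'v struct \<Rightarrow> 'v \<Rightarrow> 'v set" where
  "pointwise_stab M C = {\<pi> \<in> perms M. \<forall>a\<in>ext M C. app M \<pi> a = a}"

definition supp_filter :: "'v struct \<Rightarrow> 'v set" where
  "supp_filter M = {H. is_set M H \<and> subgroup (ext M H) (sym_grp M) \<and>
     (\<exists>C. is_set M C \<and> ext M C \<subseteq> atoms M \<and> countable_in M (ext M C) \<and>
          pointwise_stab M C \<subseteq> ext M H)}"

definition symmetric :: "'v struct \<Rightarrow> 'v \<Rightarrow> bool" where
  "symmetric M x \<longleftrightarrow> (\<exists>H\<in>supp_filter M. ext M H = sym_of M x)"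

text \<open>The transitive closure of \<open>x\<close> is taken to contain \<open>x\<close> itself; otherwise every set of
  atoms would belong to the permutation model.\<close>

definition is_trans_closure :: "'v struct \<Rightarrow> 'v \<Rightarrow> 'v \<Rightarrow> bool" where
  "is_trans_closure M x T \<longleftrightarrow> trans_set M T \<and> x \<in> ext M T \<and>
     (\<forall>T'. trans_set M T' \<longrightarrow> x \<in> ext M T' \<longrightarrow> ext M T \<subseteq> ext M T')"

definition perm_model :: "'v struct \<Rightarrow> 'v struct" where
  "perm_model M = M\<lparr>Dom := {x \<in> Dom M.
     \<exists>T. is_trans_closure M x T \<and> (\<forall>y\<in>ext M T. symmetric M y)}\<rparr>"


subsection \<open>The forcing notion\<close>

definition Q_set :: "'v struct \<Rightarrow> 'v set" where
  "Q_set M = {h. \<exists>D. is_set M D \<and> ext M D \<subseteq> omega M \<and> finite_in M (ext M D) \<and>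
     fun_on M h (ext M D) {zero_in M, one_in M}}"

definition le_Q :: "'v struct \<Rightarrow> 'v \<Rightarrow> 'v \<Rightarrow> bool" where
  "le_Q M h0 h1 \<longleftrightarrow> ext M h1 \<subseteq> ext M h0"

text \<open>Here and below, \<open>h(k) = 0\<close> for a partial function \<open>h\<close> means that \<open>k\<close> is in the domain of
  \<open>h\<close> and is mapped to \<open>0\<close>; it is therefore written with \<open>rel\<close> instead of \<open>app\<close>.\<close>

definition I_set :: "'v struct \<Rightarrow> 'v set" where
  "I_set M = {h \<in> Q_set M. \<exists>n\<in>omega M. rel M h n (zero_in M)}"

definition P_level :: "'v struct \<Rightarrow> 'v \<Rightarrow> 'v set" where
  "P_level M n = {f. fun_on M f (atoms M) (Q_set M) \<and>
     (\<forall>a\<in>atoms M. domain_of M (app M f a) = ext M n) \<and>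
     countable_in M {a \<in> atoms M. app M f a \<in> I_set M} \<and>
     (\<forall>t. fun_on M t (ext M n) {zero_in M, one_in M} \<longrightarrow>
          \<not> finite_in M {a \<in> atoms M. app M f a = t})}"

definition P_set :: "'v struct \<Rightarrow> 'v set" where
  "P_set M = (\<Union>n\<in>omega M. P_level M n)"

definition le_P :: "'v struct \<Rightarrow> 'v \<Rightarrow> 'v \<Rightarrow> bool" where
  "le_P M f0 f1 \<longleftrightarrow> (\<forall>a\<in>atoms M. le_Q M (app M f0 a) (app M f1 a))"

text \<open>Filters that meet every dense subset of \<open>P\<close> lying in the structure; smaller conditions are
  stronger.\<close>

definition generic_filter ::
    "'v struct \<Rightarrow> 'v set \<Rightarrow> ('v \<Rightarrow> 'v \<Rightarrow> bool) \<Rightarrow> 'v set \<Rightarrow> bool" where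
  "generic_filter M P leq G \<longleftrightarrow>
     G \<subseteq> P \<and> G \<noteq> {} \<and>
     (\<forall>p\<in>G. \<forall>q\<in>P. leq p q \<longrightarrow> q \<in> G) \<and>
     (\<forall>p\<in>G. \<forall>q\<in>G. \<exists>r\<in>G. leq r p \<and> leq r q) \<and>
     (\<forall>D. is_set M D \<longrightarrow> ext M D \<subseteq> P \<longrightarrow> (\<forall>p\<in>P. \<exists>d\<in>ext M D. leq d p) \<longrightarrow>
          G \<inter> ext M D \<noteq> {})"

end

theory Submission
  imports Defs
begin

text \<open>
  The conditions of level at least \<open>n\<close> are dense: given \<open>f\<close> of level \<open>m\<close>, choose (in \<open>V\<close>) a
  countable set \<open>C\<close> of atoms which splits every fibre \<open>{a. f(a) = s}\<close> into two infinite pieces, and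
  let the new bit be \<open>0\<close> exactly on \<open>C\<close>. Only the fibre of the constant sequence \<open>1\<close> lies outside
  the countable set \<open>f\<^sup>-\<^sup>1(I)\<close>, so \<open>C\<close> can be kept countable, and a countable set of atoms
  belongs to \<open>\<B>\<close> together with its enumerations, being supported by itself. Hence \<open>G\<close> contains
  some \<open>f\<close> of level at least \<open>n\<close>. As any two members of \<open>G\<close> are compatible, the set in question
  can be read off from this single \<open>f\<close>, and it is a subset of \<open>f\<^sup>-\<^sup>1(I)\<close>.

  The models may be ill-founded, so induction and separation are only available for predicates
  that are first-order definable with parameters. A predicate definable in \<open>\<B>\<close> is invariant under
  the permutations fixing its parameters, which gives Separation and Replacement in \<open>\<B>\<close>. All
  elements of \<open>\<B>\<close> belong to transitive sets, and on such elements the action of the permutations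
  can be constructed without proving that every set has a transitive closure.
\<close>

subsection \<open>Definable predicates\<close>

text \<open>Choice holds in \<open>V\<close> but not in the permutation model, while the extended
  condition has to be an element of the latter. So what ZFA alone proves about pairs, numbers and
  conditions is done in the locale \<open>zfa_model\<close>, which is instantiated to
  \<open>V\<close> and to \<open>perm_model V\<close>; choice enters only through
  \<open>infinite_split\<close> and \<open>halve_family\<close>, in \<open>V\<close>. The one new
  object carried over is the countable set of atoms \<open>C\<close>: from \<open>C\<close> and
  \<open>f\<close> the extension is defined by Replacement inside the permutation model, so its
  symmetry needs no separate check. Finiteness and countability of sets of atoms can be compared in
  the two structures because a witnessing function is fixed by every permutation that fixes these
  atoms. The second obstacle is that each induction and each use of a scheme needs a first-order
  formula. Formulas are hardly ever written out: predicates of HOL are shown definable by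
  syntax-directed rules, after definite descriptions such as \<open>app\<close> and
  \<open>act\<close> have been traded for relations such as \<open>rel\<close> and
  \<open>act_rel\<close>.\<close>

primrec fm_bound :: "fm \<Rightarrow> nat" where
  "fm_bound (FMem i j) = Suc (max i j)"
| "fm_bound (FEq i j) = Suc (max i j)"
| "fm_bound (FNeg \<phi>) = fm_bound \<phi>"
| "fm_bound (FConj \<phi> \<psi>) = max (fm_bound \<phi>) (fm_bound \<psi>)"
| "fm_bound (FAll i \<phi>) = max (Suc i) (fm_bound \<phi>)"

lemma sat_agree:
  assumes "\<And>k. k < fm_bound \<phi> \<Longrightarrow> e k = e' k"
  shows "sat M e \<phi> \<longleftrightarrow> sat M e' \<phi>"
  using assms
proof (induction \<phi> arbitrary: e e')
  case (FAll i \<phi>)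
  have "sat M (e(i := x)) \<phi> \<longleftrightarrow> sat M (e'(i := x)) \<phi>" for x
    by (rule FAll.IH) (use FAll.prems in auto)
  then show ?case by simp
next
  case (FConj \<phi> \<psi>)
  have "sat M e \<phi> \<longleftrightarrow> sat M e' \<phi>" by (rule FConj.IH(1)) (use FConj.prems in auto)
  moreover have "sat M e \<psi> \<longleftrightarrow> sat M e' \<psi>" by (rule FConj.IH(2)) (use FConj.prems in auto)
  ultimately show ?case by simp
next
  case (FNeg \<phi>)
  have "sat M e \<phi> \<longleftrightarrow> sat M e' \<phi>" by (rule FNeg.IH) (use FNeg.prems in auto)
  then show ?case by simp
qed auto

text \<open>The bound variable is renamed to a fresh one, so that \<open>\<sigma>\<close> need not be injective.\<close>

primrec rename_fm :: "(nat \<Rightarrow> nat) \<Rightarrow> fm \<Rightarrow> fm" where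
  "rename_fm \<sigma> (FMem i j) = FMem (\<sigma> i) (\<sigma> j)"
| "rename_fm \<sigma> (FEq i j) = FEq (\<sigma> i) (\<sigma> j)"
| "rename_fm \<sigma> (FNeg \<phi>) = FNeg (rename_fm \<sigma> \<phi>)"
| "rename_fm \<sigma> (FConj \<phi> \<psi>) = FConj (rename_fm \<sigma> \<phi>) (rename_fm \<sigma> \<psi>)"
| "rename_fm \<sigma> (FAll i \<phi>) = (let j = Suc (\<Sum>k<fm_bound \<phi>. \<sigma> k) in FAll j (rename_fm (\<sigma>(i := j)) \<phi>))"

lemma sat_rename: "sat M e (rename_fm \<sigma> \<phi>) \<longleftrightarrow> sat M (e \<circ> \<sigma>) \<phi>"
proof (induction \<phi> arbitrary: e \<sigma>)
  case (FAll i \<phi>)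
  define j where "j = Suc (\<Sum>k<fm_bound \<phi>. \<sigma> k)"
  \<comment> \<open>A summand is at most the sum, so \<open>j\<close> differs from every
    \<open>\<sigma> k\<close> with \<open>k\<close> below the bound, and binding \<open>j\<close>
    captures nothing.\<close>
  have "\<sigma> k < j" if "k < fm_bound \<phi>" for k
    unfolding j_def using that member_le_sum[of k "{..<fm_bound \<phi>}" \<sigma>] by simp
  then have "sat M (e(j := x) \<circ> \<sigma>(i := j)) \<phi> \<longleftrightarrow> sat M ((e \<circ> \<sigma>)(i := x)) \<phi>" for x
    by (intro sat_agree) force
  then show ?case by (simp only: rename_fm.simps sat.simps FAll.IH Let_def j_def[symmetric])
qed auto

definition with_params :: "'v struct \<Rightarrow> 'v list \<Rightarrow> (nat \<Rightarrow> 'v) \<Rightarrow> nat \<Rightarrow> 'v" where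
  "with_params M ps e k = (let qs = AtomSet M # ps in
     if k < length qs then qs ! k else e (k - length qs))"

lemma range_with_params:
  assumes "AtomSet M \<in> D" "set ps \<subseteq> D" "range e \<subseteq> D"
  shows "range (with_params M ps e) \<subseteq> D"
proof -
  have "(AtomSet M # ps) ! k \<in> D" if "k < length (AtomSet M # ps)" for k
    using nth_mem[OF that] assms(1,2) by auto
  then show ?thesis using assms(3) by (auto simp: with_params_def Let_def)
qed

text \<open>With \<open>h\<close> the action of a permutation fixing the parameters, only the free
  variables move. This is what turns definability from parameters into invariance.\<close>

lemma comp_with_params:
  assumes "h (AtomSet M) = AtomSet M" "\<And>x. x \<in> set ps \<Longrightarrow> h x = x"
  shows "h \<circ> with_params M ps e = with_params M ps (h \<circ> e)"
proof
  fix k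
  show "(h \<circ> with_params M ps e) k = with_params M ps (h \<circ> e) k"
    using assms by (auto simp: with_params_def Let_def nth_Cons split: nat.splits)
qed

text \<open>Variables are de Bruijn indices: the environment holds the free variables, preceded by the
  constant for the set of atoms (which the language \<^typ>\<open>fm\<close> lacks) and by the parameters.\<close>

definition dfn :: "'v struct \<Rightarrow> 'v list \<Rightarrow> ((nat \<Rightarrow> 'v) \<Rightarrow> bool) \<Rightarrow> bool" where
  "dfn M ps P \<longleftrightarrow> (\<exists>\<phi>. \<forall>e. range e \<subseteq> Dom M \<longrightarrow> (P e \<longleftrightarrow> sat M (with_params M ps e) \<phi>))"

text \<open>A formula evaluated in another environment stays definable when each entry of that
  environment is a fixed coordinate of \<open>with_params M ps e\<close>: the variables are renamed
  accordingly. Only the entries below \<open>fm_bound \<phi>\<close> matter.\<close>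

lemma dfn_of_sat:
  assumes "\<And>k. k < fm_bound \<phi> \<Longrightarrow> \<exists>j. \<forall>e. range e \<subseteq> Dom M \<longrightarrow> with_params M ps e j = f e k"
  shows "dfn M ps (\<lambda>e. sat M (f e) \<phi>)"
proof -
  obtain \<sigma> where \<sigma>: "\<And>k e. k < fm_bound \<phi> \<Longrightarrow> range e \<subseteq> Dom M \<Longrightarrow> with_params M ps e (\<sigma> k) = f e k"
    using assms by metis
  have "sat M (f e) \<phi> \<longleftrightarrow> sat M (with_params M ps e) (rename_fm \<sigma> \<phi>)" if "range e \<subseteq> Dom M" for e
    unfolding sat_rename by (intro sat_agree) (simp add: \<sigma> that)
  then show ?thesis unfolding dfn_def by blast
qed

lemma dfn_cong:
  assumes "dfn M ps Q" "\<And>e. range e \<subseteq> Dom M \<Longrightarrow> P e \<longleftrightarrow> Q e"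
  shows "dfn M ps P"
proof -
  obtain \<phi> where "\<forall>e. range e \<subseteq> Dom M \<longrightarrow> (Q e \<longleftrightarrow> sat M (with_params M ps e) \<phi>)"
    using assms(1) unfolding dfn_def by blast
  then show ?thesis unfolding dfn_def by (intro exI[of _ \<phi>]) (simp add: assms(2))
qed

lemma dfn_not:
  assumes "dfn M ps P"
  shows "dfn M ps (\<lambda>e. \<not> P e)"
proof -
  obtain \<phi> where "\<forall>e. range e \<subseteq> Dom M \<longrightarrow> (P e \<longleftrightarrow> sat M (with_params M ps e) \<phi>)"
    using assms unfolding dfn_def by blast
  then show ?thesis unfolding dfn_def by (intro exI[of _ "FNeg \<phi>"]) simp
qed

lemma dfn_conj:
  assumes "dfn M ps P" "dfn M ps Q"
  shows "dfn M ps (\<lambda>e. P e \<and> Q e)"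
proof -
  obtain \<phi> \<psi> where "\<forall>e. range e \<subseteq> Dom M \<longrightarrow> (P e \<longleftrightarrow> sat M (with_params M ps e) \<phi>)"
    "\<forall>e. range e \<subseteq> Dom M \<longrightarrow> (Q e \<longleftrightarrow> sat M (with_params M ps e) \<psi>)"
    using assms unfolding dfn_def by blast
  then show ?thesis unfolding dfn_def by (intro exI[of _ "FConj \<phi> \<psi>"]) auto
qed

lemma dfn_disj:
  assumes "dfn M ps P" "dfn M ps Q"
  shows "dfn M ps (\<lambda>e. P e \<or> Q e)"
proof -
  have "dfn M ps (\<lambda>e. \<not> (\<not> P e \<and> \<not> Q e))"
    by (intro dfn_conj dfn_not assms)
  then show ?thesis by (rule dfn_cong) blast
qed

lemma dfn_imp:
  assumes "dfn M ps P" "dfn M ps Q"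
  shows "dfn M ps (\<lambda>e. P e \<longrightarrow> Q e)"
proof -
  have "dfn M ps (\<lambda>e. \<not> P e \<or> Q e)"
    by (intro dfn_disj dfn_not assms)
  then show ?thesis by (rule dfn_cong) blast
qed

lemma dfn_iff:
  assumes "dfn M ps P" "dfn M ps Q"
  shows "dfn M ps (\<lambda>e. P e \<longleftrightarrow> Q e)"
proof -
  have "dfn M ps (\<lambda>e. (P e \<longrightarrow> Q e) \<and> (Q e \<longrightarrow> P e))"
    by (intro dfn_conj dfn_imp assms)
  then show ?thesis by (rule dfn_cong) blast
qed

lemma dfn_if:
  assumes "dfn M ps P" "dfn M ps Q" "dfn M ps R"
  shows "dfn M ps (\<lambda>e. if P e then Q e else R e)"
proof -
  have "dfn M ps (\<lambda>e. (P e \<longrightarrow> Q e) \<and> (\<not> P e \<longrightarrow> R e))"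
    by (intro dfn_conj dfn_imp dfn_not assms)
  then show ?thesis by (rule dfn_cong) auto
qed

lemma dfn_all:
  assumes "dfn M ps (\<lambda>e. P (e 0) (\<lambda>k. e (Suc k)))"
  shows "dfn M ps (\<lambda>e. \<forall>x\<in>Dom M. P x e)"
proof -
  obtain \<phi> where \<phi>: "\<And>e. range e \<subseteq> Dom M \<Longrightarrow>
      P (e 0) (\<lambda>k. e (Suc k)) \<longleftrightarrow> sat M (with_params M ps e) \<phi>"
    using assms unfolding dfn_def by blast
  define L where "L = Suc (length ps)"
  define N where "N = max L (fm_bound \<phi>)"
  \<comment> \<open>In the environment with \<open>x\<close> in front, \<open>x\<close> sits at
    index \<open>L\<close> and the older free variables are one place further on.
    \<open>\<sigma>\<close> undoes this shift and sends \<open>L\<close> to \<open>N\<close>, an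
    index to which no other variable of \<open>\<phi>\<close> is sent, so that \<open>FAll N\<close>
    quantifies over \<open>x\<close> alone.\<close>
  define \<sigma> where "\<sigma> k = (if k < L then k else if k = L then N else k - 1)" for k
  have LN: "L \<le> N" "fm_bound \<phi> \<le> N" by (auto simp: N_def)
  have "P x e \<longleftrightarrow> sat M ((with_params M ps e)(N := x)) (rename_fm \<sigma> \<phi>)"
    if e: "range e \<subseteq> Dom M" and x: "x \<in> Dom M" for e x
  proof -
    define e' where "e' = case_nat x e"
    have "range e' \<subseteq> Dom M" using e x by (force simp: e'_def split: nat.splits)
    from \<phi>[OF this] have "P x e \<longleftrightarrow> sat M (with_params M ps e') \<phi>" by (simp add: e'_def)
    also have "\<dots> \<longleftrightarrow> sat M ((with_params M ps e)(N := x) \<circ> \<sigma>) \<phi>"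
    proof (rule sat_agree)
      fix k assume "k < fm_bound \<phi>"
      then have "k < N" using LN by linarith
      consider "k < L" | "k = L" | j where "k = Suc (L + j)"
        by (cases k L rule: linorder_cases) (auto simp: less_iff_Suc_add)
      then show "with_params M ps e' k = ((with_params M ps e)(N := x) \<circ> \<sigma>) k"
      proof cases
        case 1
        then show ?thesis using LN(1) by (simp add: \<sigma>_def with_params_def L_def Let_def)
      next
        case 2
        then show ?thesis by (simp add: \<sigma>_def e'_def with_params_def L_def)
      next
        case 3
        then have "\<sigma> k = L + j" "L + j \<noteq> N" using \<open>k < N\<close> by (auto simp: \<sigma>_def)
        then show ?thesis using 3 by (simp add: e'_def with_params_def L_def)
      qed
    qed
    finally show ?thesis by (simp only: sat_rename)
  qed
  then show ?thesis unfolding dfn_def by (intro exI[of _ "FAll N (rename_fm \<sigma> \<phi>)"]) simp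
qed

lemma dfn_ex:
  assumes "dfn M ps (\<lambda>e. P (e 0) (\<lambda>k. e (Suc k)))"
  shows "dfn M ps (\<lambda>e. \<exists>x\<in>Dom M. P x e)"
proof -
  have "dfn M ps (\<lambda>e. \<not> (\<forall>x\<in>Dom M. \<not> P x e))"
    by (rule dfn_not, rule dfn_all, rule dfn_not, rule assms)
  then show ?thesis by (rule dfn_cong) blast
qed

text \<open>There are no function symbols, so a term is a variable or a constant. Intersecting with
  \<open>Dom M\<close> makes every term take values in the domain, whatever the list
  \<open>ps\<close> contains.\<close>

definition trm :: "'v struct \<Rightarrow> 'v list \<Rightarrow> ((nat \<Rightarrow> 'v) \<Rightarrow> 'v) \<Rightarrow> bool" where
  "trm M ps t \<longleftrightarrow> (\<exists>i. t = (\<lambda>e. e i)) \<or> (\<exists>c\<in>insert (AtomSet M) (set ps) \<inter> Dom M. t = (\<lambda>e. c))"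

lemma trm_var: "trm M ps (\<lambda>e. e i)"
  by (auto simp: trm_def)

lemma trm_const: "c \<in> insert (AtomSet M) (set ps) \<inter> Dom M \<Longrightarrow> trm M ps (\<lambda>e. c)"
  unfolding trm_def by blast

lemma trm_shift: "trm M ps t \<Longrightarrow> trm M ps (\<lambda>e. t (\<lambda>k. e (f k)))"
  by (auto simp: trm_def)

lemma trm_in: "trm M ps t \<Longrightarrow> range e \<subseteq> Dom M \<Longrightarrow> t e \<in> Dom M"
  by (auto simp: trm_def)

lemma trm_index:
  assumes "trm M ps t"
  shows "\<exists>i. t = (\<lambda>e. with_params M ps e i)"
proof -
  consider (var) i where "t = (\<lambda>e. e i)" | (const) c where "c \<in> set (AtomSet M # ps)" "t = (\<lambda>e. c)"
    using assms by (auto simp: trm_def)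
  then show ?thesis
  proof cases
    case var
    then show ?thesis by (intro exI[of _ "i + Suc (length ps)"]) (simp add: with_params_def)
  next
    case const
    then obtain k where "k < length (AtomSet M # ps)" "(AtomSet M # ps) ! k = c"
      by (metis in_set_conv_nth)
    then show ?thesis using const by (intro exI[of _ k]) (simp add: with_params_def Let_def)
  qed
qed

text \<open>Every coordinate of \<open>with_params M ps (f e)\<close>, whether parameter or term, is
  a coordinate of \<open>with_params M qs e\<close>, so substituting terms and enlarging the
  parameter list are both a renaming.\<close>

lemma dfn_subst:
  assumes P: "dfn M ps P" and ps: "set ps \<subseteq> set qs" and f: "\<And>k. trm M qs (\<lambda>e. f e k)"
  shows "dfn M qs (\<lambda>e. P (f e))"
proof -
  obtain \<phi> where \<phi>: "\<And>e. range e \<subseteq> Dom M \<Longrightarrow> P e \<longleftrightarrow> sat M (with_params M ps e) \<phi>"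
    using P unfolding dfn_def by blast
  have index: "\<exists>j. \<forall>e. with_params M qs e j = with_params M ps (f e) k" for k
  proof (cases "k < length (AtomSet M # ps)")
    case True
    then have "(AtomSet M # ps) ! k \<in> set (AtomSet M # qs)" using ps nth_mem[OF True] by auto
    then obtain j where "j < length (AtomSet M # qs)" "(AtomSet M # qs) ! j = (AtomSet M # ps) ! k"
      by (metis in_set_conv_nth)
    then show ?thesis using True by (intro exI[of _ j]) (simp add: with_params_def Let_def)
  next
    case False
    obtain j where "(\<lambda>e. f e (k - length (AtomSet M # ps))) = (\<lambda>e. with_params M qs e j)"
      using trm_index[OF f] by blast
    then have "with_params M qs e j = with_params M ps (f e) k" for e
      using False by (simp add: with_params_def Let_def fun_eq_iff)
    then show ?thesis by blast
  qed
  have "dfn M qs (\<lambda>e. sat M (with_params M ps (f e)) \<phi>)"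
    by (rule dfn_of_sat) (use index in fast)
  then show ?thesis
  proof (rule dfn_cong)
    fix e :: "nat \<Rightarrow> 'a"
    assume "range e \<subseteq> Dom M"
    then have "range (f e) \<subseteq> Dom M" using trm_in[OF f] by blast
    then show "P (f e) \<longleftrightarrow> sat M (with_params M ps (f e)) \<phi>" by (rule \<phi>)
  qed
qed

text \<open>The rules for concrete predicates cannot see inside a relation variable
  \<open>R\<close>. This one supplies its instances in the constructions that take a definable
  \<open>R\<close> as an argument.\<close>

lemma dfn_subst2:
  assumes "dfn M ps (\<lambda>e. R (e 0) (e (Suc 0)))" "trm M ps s" "trm M ps t"
  shows "dfn M ps (\<lambda>e. R (s e) (t e))"
proof -
  have "trm M ps (\<lambda>e. case_nat (s e) (case_nat (t e) e) k)" for k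
    using assms(2,3) trm_var by (cases k; cases "k - 1") auto
  from dfn_subst[OF assms(1) subset_refl, of "\<lambda>e. case_nat (s e) (case_nat (t e) e)", OF this]
  show ?thesis by simp
qed

lemma dfn_Cons: "dfn M ps P \<Longrightarrow> dfn M (x # ps) P"
  by (drule dfn_subst[where f="\<lambda>e. e" and qs="x # ps"]) (auto intro: trm_var)

lemma dfn_mem:
  assumes "trm M ps s" "trm M ps t"
  shows "dfn M ps (\<lambda>e. Mem M (s e) (t e))"
proof -
  obtain i where i: "s = (\<lambda>e. with_params M ps e i)"
    using trm_index[OF assms(1)] by blast
  obtain j where j: "t = (\<lambda>e. with_params M ps e j)"
    using trm_index[OF assms(2)] by blast
  show ?thesis unfolding dfn_def by (intro exI[of _ "FMem i j"]) (simp add: i j)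
qed

lemma dfn_eq:
  assumes "trm M ps s" "trm M ps t"
  shows "dfn M ps (\<lambda>e. s e = t e)"
proof -
  obtain i where i: "s = (\<lambda>e. with_params M ps e i)"
    using trm_index[OF assms(1)] by blast
  obtain j where j: "t = (\<lambda>e. with_params M ps e j)"
    using trm_index[OF assms(2)] by blast
  show ?thesis unfolding dfn_def by (intro exI[of _ "FEq i j"]) (simp add: i j)
qed

lemma dfn_True: "dfn M ps (\<lambda>e. True)"
  by (rule dfn_cong[OF dfn_eq[OF trm_var[of _ _ 0] trm_var[of _ _ 0]]]) simp

lemma dfn_False: "dfn M ps (\<lambda>e. False)"
  using dfn_not[OF dfn_True] by simp

text \<open>Classes that may depend on the environment. The inclusion in the domain lets a
  quantifier over \<open>K e\<close> be read as a quantifier over \<open>Dom M\<close> guarded by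
  membership, which is all that the formulas can express.\<close>

definition dcl :: "'v struct \<Rightarrow> 'v list \<Rightarrow> ((nat \<Rightarrow> 'v) \<Rightarrow> 'v set) \<Rightarrow> bool" where
  "dcl M ps K \<longleftrightarrow> (\<forall>e. range e \<subseteq> Dom M \<longrightarrow> K e \<subseteq> Dom M) \<and>
     dfn M ps (\<lambda>e. e 0 \<in> K (\<lambda>k. e (Suc k)))"

lemma dclI:
  assumes "\<And>e. range e \<subseteq> Dom M \<Longrightarrow> K e \<subseteq> Dom M" "dfn M ps (\<lambda>e. e 0 \<in> K (\<lambda>k. e (Suc k)))"
  shows "dcl M ps K"
  using assms by (simp add: dcl_def)

lemma dcl_subset: "dcl M ps K \<Longrightarrow> range e \<subseteq> Dom M \<Longrightarrow> K e \<subseteq> Dom M"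
  by (simp add: dcl_def)

lemma dcl_dfn: "dcl M ps K \<Longrightarrow> dfn M ps (\<lambda>e. e 0 \<in> K (\<lambda>k. e (Suc k)))"
  by (simp add: dcl_def)

lemma dfn_ball:
  assumes "dcl M ps K" "dfn M ps (\<lambda>e. P (e 0) (\<lambda>k. e (Suc k)))"
  shows "dfn M ps (\<lambda>e. \<forall>x\<in>K e. P x e)"
proof -
  have "dfn M ps (\<lambda>e. \<forall>x\<in>Dom M. x \<in> K e \<longrightarrow> P x e)"
    by (rule dfn_all, rule dfn_imp, rule dcl_dfn[OF assms(1)], rule assms(2))
  then show ?thesis by (rule dfn_cong) (use dcl_subset[OF assms(1)] in blast)
qed

lemma dfn_bex:
  assumes "dcl M ps K" "dfn M ps (\<lambda>e. P (e 0) (\<lambda>k. e (Suc k)))"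
  shows "dfn M ps (\<lambda>e. \<exists>x\<in>K e. P x e)"
proof -
  have "dfn M ps (\<lambda>e. \<exists>x\<in>Dom M. x \<in> K e \<and> P x e)"
    by (rule dfn_ex, rule dfn_conj, rule dcl_dfn[OF assms(1)], rule assms(2))
  then show ?thesis by (rule dfn_cong) (use dcl_subset[OF assms(1)] in blast)
qed

lemma dfn_in:
  assumes "trm M ps t" "dcl M ps K"
  shows "dfn M ps (\<lambda>e. t e \<in> K e)"
proof -
  have "dfn M ps (\<lambda>e. \<exists>x\<in>K e. x = t e)"
    by (rule dfn_bex[OF assms(2)], rule dfn_eq[OF trm_var trm_shift[OF assms(1)]])
  then show ?thesis by (rule dfn_cong) blast
qed

lemma dcl_shift:
  assumes "dcl M ps K"
  shows "dcl M ps (\<lambda>e. K (\<lambda>k. e (f k)))"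
proof (rule dclI)
  show "K (\<lambda>k. e (f k)) \<subseteq> Dom M" if "range e \<subseteq> Dom M" for e
    using that by (intro dcl_subset[OF assms]) auto
  have "trm M ps (\<lambda>e. case_nat (e 0) (\<lambda>k. e (Suc (f k))) k)" for k
    by (cases k) (simp_all add: trm_var)
  from dfn_subst[OF dcl_dfn[OF assms] subset_refl, of
    "\<lambda>e. case_nat (e 0) (\<lambda>k. e (Suc (f k)))", OF this]
  show "dfn M ps (\<lambda>e. e 0 \<in> K (\<lambda>k. e (Suc (f k))))" by simp
qed

lemma dcl_ext:
  assumes "trm M ps t"
  shows "dcl M ps (\<lambda>e. ext M (t e))"
proof (rule dclI)
  have "dfn M ps (\<lambda>e. Mem M (e 0) (t (\<lambda>k. e (Suc k))))"
    by (rule dfn_mem[OF trm_var trm_shift[OF assms]])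
  then show "dfn M ps (\<lambda>e. e 0 \<in> ext M (t (\<lambda>k. e (Suc k))))"
    by (rule dfn_cong) (auto simp: ext_def)
qed (auto simp: ext_def)

lemma dcl_Dom: "dcl M ps (\<lambda>e. Dom M)"
  by (rule dclI, simp, rule dfn_cong[OF dfn_True]) auto

lemma dcl_empty: "dcl M ps (\<lambda>e. {})"
  by (rule dclI, simp, rule dfn_cong[OF dfn_False]) auto

lemma dcl_insert:
  assumes "trm M ps t" "dcl M ps K"
  shows "dcl M ps (\<lambda>e. insert (t e) (K e))"
proof (rule dclI)
  show "dfn M ps (\<lambda>e. e 0 \<in> insert (t (\<lambda>k. e (Suc k))) (K (\<lambda>k. e (Suc k))))"
    unfolding insert_iff
    by (rule dfn_disj[OF dfn_eq[OF trm_var trm_shift[OF assms(1)]] dcl_dfn[OF assms(2)]])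
qed (use trm_in[OF assms(1)] dcl_subset[OF assms(2)] in blast)

lemma dcl_Diff:
  assumes "dcl M ps J" "dcl M ps K"
  shows "dcl M ps (\<lambda>e. J e - K e)"
proof (rule dclI)
  show "dfn M ps (\<lambda>e. e 0 \<in> J (\<lambda>k. e (Suc k)) - K (\<lambda>k. e (Suc k)))"
    unfolding Diff_iff by (rule dfn_conj[OF dcl_dfn[OF assms(1)] dfn_not[OF dcl_dfn[OF assms(2)]]])
qed (use assms[THEN dcl_subset] in blast)

lemma dcl_collect:
  assumes "dcl M ps K" "dfn M ps (\<lambda>e. P (e 0) (\<lambda>k. e (Suc k)))"
  shows "dcl M ps (\<lambda>e. {x \<in> K e. P x e})"
proof (rule dclI)
  show "dfn M ps (\<lambda>e. e 0 \<in> {x \<in> K (\<lambda>k. e (Suc k)). P x (\<lambda>k. e (Suc k))})"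
    unfolding mem_Collect_eq by (rule dfn_conj[OF dcl_dfn[OF assms(1)] assms(2)])
qed (use dcl_subset[OF assms(1)] in blast)

lemma dfn_subset:
  assumes "dcl M ps J" "dcl M ps K"
  shows "dfn M ps (\<lambda>e. J e \<subseteq> K e)"
proof -
  have "dfn M ps (\<lambda>e. \<forall>x\<in>J e. x \<in> K e)"
    by (rule dfn_ball[OF assms(1)], rule dcl_dfn[OF assms(2)])
  then show ?thesis by (rule dfn_cong) blast
qed

lemma dfn_set_eq:
  assumes "dcl M ps J" "dcl M ps K"
  shows "dfn M ps (\<lambda>e. J e = K e)"
  unfolding set_eq_subset by (intro dfn_conj dfn_subset assms)

lemma dfn_ex1:
  assumes "dcl M ps K" "dfn M ps (\<lambda>e. P (e 0) (\<lambda>k. e (Suc k)))"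
  shows "dfn M ps (\<lambda>e. \<exists>!x. x \<in> K e \<and> P x e)"
proof -
  have K: "dcl M ps (\<lambda>e. {y \<in> K e. P y e})"
    by (rule dcl_collect[OF assms])
  \<comment> \<open>Existence and uniqueness together say that the class is a singleton, which the
    rules for equality of classes can handle.\<close>
  have "dfn M ps (\<lambda>e. \<exists>x\<in>Dom M. {y \<in> K e. P y e} = {x})"
    by (rule dfn_ex, rule dfn_set_eq, rule dcl_shift[OF K], rule dcl_insert, rule trm_var, rule dcl_empty)
  then show ?thesis
  proof (rule dfn_cong)
    fix e :: "nat \<Rightarrow> 'a"
    assume "range e \<subseteq> Dom M"
    from dcl_subset[OF assms(1) this] show
      "(\<exists>!x. x \<in> K e \<and> P x e) \<longleftrightarrow> (\<exists>x\<in>Dom M. {y \<in> K e. P y e} = {x})"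
      unfolding Ex1_def set_eq_iff mem_Collect_eq singleton_iff by fast
  qed
qed

text \<open>The schemes quantify over an infinite environment \<open>e\<close>, whereas
  \<open>dfn\<close> takes a finite list. A formula looks at finitely many entries, so these become
  the parameters, with entries 0 and 1 left free. Keeping \<open>e 1\<close> in the list allows
  entry 1 to be restored when only entry 0 is to vary.\<close>

lemma dfn_fix_params:
  assumes "dfn M [] P" "range e \<subseteq> Dom M"
  obtains ps where "set ps \<subseteq> range e" "e 1 \<in> set ps"
    "dfn M ps (\<lambda>e'. P (e(0 := e' 0, 1 := e' (Suc 0))))"
proof -
  obtain \<phi> where \<phi>: "\<And>e. range e \<subseteq> Dom M \<Longrightarrow> P e \<longleftrightarrow> sat M (with_params M [] e) \<phi>"
    using assms(1) unfolding dfn_def by blast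
  define N where "N = fm_bound \<phi> + 2"
  define ps where "ps = map e [0..<N]"
  define f where "f e' = with_params M [] (e(0 := e' 0, 1 := e' (Suc 0)))" for e' :: "nat \<Rightarrow> 'a"
  have "dfn M ps (\<lambda>e'. sat M (f e') \<phi>)"
  proof (rule dfn_of_sat)
    fix k assume k: "k < fm_bound \<phi>"
    \<comment> \<open>Index 0 of \<open>with_params M []\<close> is the set of atoms, so 1 and 2 are
      the two free entries and \<open>j + 3\<close> is entry \<open>j + 2\<close> of
      \<open>e\<close>, which has index \<open>Suc (j + 2)\<close> once \<open>ps\<close> is in
      place.\<close>
    consider "k = 0" | "k = 1" | "k = 2" | j where "k = j + 3"
    proof -
      have "k = 0 \<or> k = 1 \<or> k = 2 \<or> k = (k - 3) + 3" by linarith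
      then show thesis using that by blast
    qed
    then show "\<exists>j. \<forall>e'. range e' \<subseteq> Dom M \<longrightarrow> with_params M ps e' j = f e' k"
    proof cases
      case 1
      then show ?thesis by (intro exI[of _ 0]) (simp add: f_def with_params_def)
    next
      case 2
      then show ?thesis by (intro exI[of _ "Suc N"]) (simp add: f_def with_params_def ps_def)
    next
      case 3
      then show ?thesis by (intro exI[of _ "Suc (Suc N)"]) (simp add: f_def with_params_def ps_def)
    next
      case (4 j)
      then have "j + 2 < N" using k by (simp add: N_def)
      then show ?thesis using 4
        by (intro exI[of _ "Suc (j + 2)"]) (simp add: f_def with_params_def ps_def numeral_3_eq_3)
    qed
  qed
  then have "dfn M ps (\<lambda>e'. P (e(0 := e' 0, 1 := e' (Suc 0))))"
  proof (rule dfn_cong)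
    fix e' :: "nat \<Rightarrow> 'a"
    assume "range e' \<subseteq> Dom M"
    then have "range (e(0 := e' 0, 1 := e' (Suc 0))) \<subseteq> Dom M" using assms(2) by auto
    from \<phi>[OF this] show "P (e(0 := e' 0, 1 := e' (Suc 0))) \<longleftrightarrow> sat M (f e') \<phi>"
      by (simp add: f_def)
  qed
  moreover have "e 1 \<in> set ps" unfolding ps_def set_map by (rule imageI)
    (simp only: N_def set_upt atLeastLessThan_iff, linarith)
  moreover have "set ps \<subseteq> range e" by (auto simp: ps_def)
  ultimately show thesis by (intro that)
qed

section \<open>Syntax-directed rules for definability\<close>

named_theorems dfn_intro

lemmas [dfn_intro] = trm_var trm_const
lemmas [dfn_intro] = dcl_collect dcl_Diff dcl_insert dcl_empty dcl_Dom dcl_ext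
lemmas [dfn_intro] = dfn_eq dfn_mem dfn_in dfn_set_eq dfn_subset dfn_ex1
  dfn_bex dfn_ball dfn_ex dfn_all dfn_if dfn_iff dfn_imp dfn_disj dfn_conj dfn_not
  dfn_True dfn_False

section \<open>Consequences of ZFA in a first-order structure\<close>

locale zfa_model =
  fixes M :: "'v struct"
  assumes zfa: "zfa M"
begin

lemma AtomSet_in [simp, intro]: "AtomSet M \<in> Dom M"
  using zfa by (simp add: zfa_def)

lemma dcl_atoms [dfn_intro]: "dcl M ps (\<lambda>e. atoms M)"
  unfolding atoms_def by (intro dfn_intro) simp

lemma dfn_is_set [dfn_intro]:
  assumes "trm M ps x"
  shows "dfn M ps (\<lambda>e. is_set M (x e))"
  unfolding is_set_def by (intro dfn_intro trm_shift[OF assms])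

lemma dfn_opair [dfn_intro]:
  assumes "trm M ps a" "trm M ps b" "trm M ps p"
  shows "dfn M ps (\<lambda>e. opair M (a e) (b e) (p e))"
  unfolding opair_def by (intro dfn_intro trm_shift[OF assms(1)] trm_shift[OF assms(2)] trm_shift[OF assms(3)])

lemma dfn_rel [dfn_intro]:
  assumes "trm M ps r" "trm M ps a" "trm M ps b"
  shows "dfn M ps (\<lambda>e. rel M (r e) (a e) (b e))"
  unfolding rel_def
  by (intro dfn_intro trm_shift[OF assms(1)] trm_shift[OF assms(2)] trm_shift[OF assms(3)])

lemma dfn_fun_on [dfn_intro]:
  assumes "trm M ps f" "dcl M ps K" "dcl M ps L"
  shows "dfn M ps (\<lambda>e. fun_on M (f e) (K e) (L e))"
  unfolding fun_on_def
  by (intro dfn_intro trm_shift[OF assms(1)] dcl_shift[OF assms(2)] dcl_shift[OF assms(3)])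

lemma dfn_inductive_set [dfn_intro]:
  assumes "trm M ps f"
  shows "dfn M ps (\<lambda>e. inductive_set_in M (f e))"
  unfolding inductive_set_in_def
  by (intro dfn_intro trm_shift[OF assms])

lemma dcl_omega [dfn_intro]: "dcl M ps (\<lambda>e. omega M)"
proof -
  have "omega M = {n \<in> Dom M. \<forall>I\<in>Dom M. inductive_set_in M I \<longrightarrow> n \<in> ext M I}"
    unfolding omega_def inductive_set_in_def is_set_def by blast
  then show ?thesis by (simp only:) (intro dfn_intro)
qed


lemma in_extD [dest]: "x \<in> ext M y \<Longrightarrow> x \<in> Dom M"
  by (simp add: ext_def)

lemma atomsD [dest]: "a \<in> atoms M \<Longrightarrow> a \<in> Dom M"
  unfolding atoms_def by blast

lemma is_setD [dest]: "is_set M x \<Longrightarrow> x \<in> Dom M"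
  by (simp add: is_set_def)

lemmas zfa_rest = zfa[unfolded zfa_def, THEN conjunct2]
lemmas ax_atoms = zfa_rest[THEN conjunct1]
lemmas ax_empty = zfa_rest[THEN conjunct2, THEN conjunct1]
lemmas ax_ext = zfa_rest[THEN conjunct2, THEN conjunct2, THEN conjunct1]
lemmas ax_pair = zfa_rest[THEN conjunct2, THEN conjunct2, THEN conjunct2, THEN conjunct1]
lemmas zfa_rest' = zfa_rest[THEN conjunct2, THEN conjunct2, THEN conjunct2, THEN conjunct2]
lemmas ax_union = zfa_rest'[THEN conjunct1]
lemmas ax_power = zfa_rest'[THEN conjunct2, THEN conjunct1]
lemmas ax_infinity = zfa_rest'[THEN conjunct2, THEN conjunct2, THEN conjunct1]
lemmas ax_found = zfa_rest'[THEN conjunct2, THEN conjunct2, THEN conjunct2, THEN conjunct1]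
lemmas zfa_rest'' = zfa_rest'[THEN conjunct2, THEN conjunct2, THEN conjunct2, THEN conjunct2]
lemmas ax_sep = zfa_rest''[THEN conjunct1]
lemmas ax_repl = zfa_rest''[THEN conjunct2]

lemma ext_atom: "a \<in> atoms M \<Longrightarrow> ext M a = {}"
  using ax_atoms by blast

lemma is_setI: "x \<in> Dom M \<Longrightarrow> y \<in> ext M x \<Longrightarrow> is_set M x"
  using ext_atom unfolding is_set_def by blast

lemma is_set_eqI: "is_set M x \<Longrightarrow> is_set M y \<Longrightarrow> ext M x = ext M y \<Longrightarrow> x = y"
  using ax_ext by blast

lemma is_set_AtomSet: "is_set M (AtomSet M)"
  using ext_atom[of "AtomSet M"] unfolding is_set_def atoms_def by auto

text \<open>A bridge between subsets of the domain in HOL and elements of the structure: a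
  \<open>small\<close> subset is the extension of a set, which \<open>mk\<close> returns.
  Constructions can be written with sets of HOL and turned into elements at the end.\<close>

definition small :: "'v set \<Rightarrow> bool" where
  "small K \<longleftrightarrow> (\<exists>y. is_set M y \<and> ext M y = K)"

definition mk :: "'v set \<Rightarrow> 'v" where
  "mk K = (THE y. is_set M y \<and> ext M y = K)"

lemma mk_eq: "is_set M x \<Longrightarrow> ext M x = K \<Longrightarrow> mk K = x"
  unfolding mk_def by (rule the_equality) (auto intro: is_set_eqI)

lemma mk_props:
  assumes "small K"
  shows is_set_mk: "is_set M (mk K)" and ext_mk: "ext M (mk K) = K" and mk_in: "mk K \<in> Dom M"
  using assms mk_eq unfolding small_def by auto

lemma small_Dom: "small K \<Longrightarrow> K \<subseteq> Dom M"
  using ext_mk[of K] by blast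

lemma mk_inj: "small K \<Longrightarrow> small L \<Longrightarrow> mk K = mk L \<Longrightarrow> K = L"
  using ext_mk by metis

lemma small_empty: "small {}"
  using ax_empty unfolding small_def by blast

lemma small_pair: "a \<in> Dom M \<Longrightarrow> b \<in> Dom M \<Longrightarrow> small {a, b}"
  using ax_pair unfolding small_def by blast

lemma small_singleton: "a \<in> Dom M \<Longrightarrow> small {a}"
  using small_pair[of a a] by simp

lemma small_ext: "x \<in> Dom M \<Longrightarrow> small (ext M x)"
  using small_empty ext_atom unfolding small_def is_set_def by metis

lemma small_atoms: "small (atoms M)"
  unfolding atoms_def by (rule small_ext) simp

lemma small_Union: "x \<in> Dom M \<Longrightarrow> small (\<Union>y\<in>ext M x. ext M y)"
  using ax_union unfolding small_def by blast

lemma small_UN: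
  assumes "small K"
  shows "small (\<Union>y\<in>K. ext M y)"
  using small_Union[OF mk_in[OF assms]] by (simp add: ext_mk[OF assms])

lemma small_Un:
  assumes "small K" "small L"
  shows "small (K \<union> L)"
  using small_UN[OF small_pair[OF mk_in[OF assms(1)] mk_in[OF assms(2)]]] assms
  by (auto simp: ext_mk mk_in)

lemma small_insert: "a \<in> Dom M \<Longrightarrow> small K \<Longrightarrow> small (insert a K)"
  using small_Un[OF small_singleton] by simp

lemma small_Pow:
  assumes "small K"
  shows "small {y. is_set M y \<and> ext M y \<subseteq> K}"
  using ax_power[rule_format, OF mk_in[OF assms]]
  unfolding small_def by (simp add: ext_mk[OF assms])

lemma foundation:
  assumes "small K" "K \<noteq> {}"
  obtains y where "y \<in> K" "ext M y \<inter> K = {}"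
  using ax_found[rule_format, OF mk_in[OF assms(1)]] assms(2) that
  by (auto simp: ext_mk[OF assms(1)])

lemma not_in_self: "x \<in> Dom M \<Longrightarrow> x \<notin> ext M x"
  using foundation[OF small_singleton[of x]] by blast

lemma not_in_cycle: "x \<in> ext M y \<Longrightarrow> y \<notin> ext M x"
  using foundation[OF small_pair[of x y]] by (metis Int_iff in_extD empty_iff insert_iff)

section \<open>Separation, Replacement and images for definable predicates\<close>

lemma dfn_obtain:
  assumes "dfn M ps P" "set ps \<subseteq> Dom M"
  obtains \<phi> e where "range e \<subseteq> Dom M"
    "\<And>x y. x \<in> Dom M \<Longrightarrow> y \<in> Dom M \<Longrightarrow>
      sat M (e(0 := x, 1 := y)) \<phi> \<longleftrightarrow> P (case_nat x (case_nat y (\<lambda>_. AtomSet M)))"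
proof -
  obtain \<phi> where \<phi>: "\<And>e. range e \<subseteq> Dom M \<Longrightarrow> P e \<longleftrightarrow> sat M (with_params M ps e) \<phi>"
    using assms(1) unfolding dfn_def by blast
  define L where "L = Suc (length ps)"
  \<comment> \<open>The schemes reserve variables 0 and 1 for the arguments, so the set of atoms and
    the parameters move up to the indices from 2 on. Free variables beyond the two arguments all go
    to 2, which holds \<open>AtomSet M\<close>, the default in the environment on the other
    side.\<close>
  define \<sigma> where "\<sigma> k = (if k < L then k + 2 else if k < L + 2 then k - L else 2)" for k
  define e where "e k = (if k - 2 < L then (AtomSet M # ps) ! (k - 2) else AtomSet M)" for k
  have sub: "range e \<subseteq> Dom M"
  proof -
    have "(AtomSet M # ps) ! j \<in> Dom M" if "j < L" for j
      using nth_mem[of j "AtomSet M # ps"] that assms(2) by (auto simp: L_def)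
    then show ?thesis by (auto simp: e_def)
  qed
  show thesis
  proof (rule that[OF sub, of "rename_fm \<sigma> \<phi>"])
    fix x y assume xy: "x \<in> Dom M" "y \<in> Dom M"
    define e' where "e' = case_nat x (case_nat y (\<lambda>_. AtomSet M))"
    have "range e' \<subseteq> Dom M" using xy by (force simp: e'_def split: nat.splits)
    from \<phi>[OF this] have "P e' \<longleftrightarrow> sat M (with_params M ps e') \<phi>" .
    also have "with_params M ps e' = e(0 := x, 1 := y) \<circ> \<sigma>"
    proof
      fix k
      consider "k < L" | "k = L" | "k = L + 1" | j where "k = L + 2 + j"
        by (cases k L rule: linorder_cases) (auto simp: less_iff_Suc_add, metis not0_implies_Suc)
      then show "with_params M ps e' k = (e(0 := x, 1 := y) \<circ> \<sigma>) k"
      proof cases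
        case 1
        then have "\<sigma> k = k + 2" "e (k + 2) = (AtomSet M # ps) ! k" by (auto simp: \<sigma>_def e_def)
        then show ?thesis using 1 by (simp add: with_params_def L_def Let_def)
      next
        case 2
        then show ?thesis by (simp add: \<sigma>_def with_params_def L_def e'_def)
      next
        case 3
        then show ?thesis by (simp add: \<sigma>_def with_params_def L_def e'_def)
      next
        case 4
        then have "\<sigma> k = 2" by (simp add: \<sigma>_def)
        then show ?thesis using 4 by (simp add: with_params_def L_def e'_def e_def)
      qed
    qed
    finally show "sat M (e(0 := x, 1 := y)) (rename_fm \<sigma> \<phi>) \<longleftrightarrow> P e'"
      by (simp only: sat_rename)
  qed
qed

lemma sep:
  assumes "small K" "dfn M ps (\<lambda>e. P (e 0))" "set ps \<subseteq> Dom M"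
  shows "small {x \<in> K. P x}"
proof -
  obtain \<phi> e where e: "range e \<subseteq> Dom M"
    "\<And>x y. x \<in> Dom M \<Longrightarrow> y \<in> Dom M \<Longrightarrow> sat M (e(0 := x, 1 := y)) \<phi> \<longleftrightarrow> P x"
    by (rule dfn_obtain[OF assms(2,3)]) auto
  from ax_sep e(1) mk_in[OF assms(1)] obtain y where
    "is_set M y" "ext M y = {t \<in> ext M (mk K). sat M (e(0 := t)) \<phi>}"
    unfolding ax_separation_def by blast
  moreover have "sat M (e(0 := t)) \<phi> \<longleftrightarrow> P t" if "t \<in> K" for t
  proof -
    have "e(0 := t, 1 := e 1) = e(0 := t)" by auto
    with e(2)[of t "e 1"] show ?thesis using that small_Dom[OF assms(1)] e(1)
      by (metis rangeI subsetD)
  qed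
  ultimately show ?thesis unfolding small_def using ext_mk[OF assms(1)] by (intro exI[of _ y]) auto
qed

lemma repl:
  assumes "small K" "dfn M ps (\<lambda>e. R (e 0) (e (Suc 0)))" "set ps \<subseteq> Dom M"
    and "\<And>x u v. x \<in> K \<Longrightarrow> u \<in> Dom M \<Longrightarrow> v \<in> Dom M \<Longrightarrow> R x u \<Longrightarrow> R x v \<Longrightarrow> u = v"
  shows "small {u \<in> Dom M. \<exists>x\<in>K. R x u}"
proof -
  obtain \<phi> e where e: "range e \<subseteq> Dom M"
    "\<And>x y. x \<in> Dom M \<Longrightarrow> y \<in> Dom M \<Longrightarrow> sat M (e(0 := x, 1 := y)) \<phi> \<longleftrightarrow> R x y"
    by (rule dfn_obtain[OF assms(2,3)]) auto
  have K: "x \<in> Dom M" if "x \<in> K" for x using that small_Dom[OF assms(1)] by blast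
  have "\<forall>t\<in>ext M (mk K). \<forall>u\<in>Dom M. \<forall>v\<in>Dom M.
      sat M (e(0 := t, 1 := u)) \<phi> \<longrightarrow> sat M (e(0 := t, 1 := v)) \<phi> \<longrightarrow> u = v"
    unfolding ext_mk[OF assms(1)] using assms(4) K by (simp add: e(2)[unfolded One_nat_def])
  then obtain y where "is_set M y"
    "ext M y = {u \<in> Dom M. \<exists>t\<in>ext M (mk K). sat M (e(0 := t, 1 := u)) \<phi>}"
    using ax_repl e(1) mk_in[OF assms(1)] unfolding ax_replacement_def by blast
  moreover have "{u \<in> Dom M. \<exists>t\<in>ext M (mk K). sat M (e(0 := t, 1 := u)) \<phi>} = {u \<in> Dom M. \<exists>x\<in>K. R x u}"
    unfolding ext_mk[OF assms(1)] using K by (auto simp: e(2) simp del: One_nat_def)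
  ultimately show ?thesis unfolding small_def by blast
qed

text \<open>\<open>F\<close> is a function of HOL of which the structure knows nothing. Replacement
  is applied to a definable relation \<open>R\<close> that agrees with the graph of \<open>F\<close>
  over \<open>K\<close>; the later constructions of functions have the same format.\<close>

lemma small_image:
  assumes "small K" "dfn M ps (\<lambda>e. R (e 0) (e (Suc 0)))" "set ps \<subseteq> Dom M"
    and "\<And>x y. x \<in> K \<Longrightarrow> y \<in> Dom M \<Longrightarrow> R x y \<longleftrightarrow> y = F x" "\<And>x. x \<in> K \<Longrightarrow> F x \<in> Dom M"
  shows "small (F ` K)"
proof -
  have "small {u \<in> Dom M. \<exists>x\<in>K. R x u}"
    by (rule repl[OF assms(1,2,3)]) (simp add: assms(4))
  also have "{u \<in> Dom M. \<exists>x\<in>K. R x u} = F ` K"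
    using assms(4,5) by auto
  finally show ?thesis .
qed


subsection \<open>Pairs and functions\<close>

definition opr :: "'v \<Rightarrow> 'v \<Rightarrow> 'v" where
  "opr a b = mk {mk {a}, mk {a, b}}"

lemma opr_in [simp]: "a \<in> Dom M \<Longrightarrow> b \<in> Dom M \<Longrightarrow> opr a b \<in> Dom M"
  unfolding opr_def by (intro mk_in small_pair small_singleton)

lemma ext_opr: "a \<in> Dom M \<Longrightarrow> b \<in> Dom M \<Longrightarrow> ext M (opr a b) = {mk {a}, mk {a, b}}"
  unfolding opr_def by (intro ext_mk small_pair mk_in small_singleton)

lemma opair_Dom: "opair M a b p \<Longrightarrow> a \<in> Dom M \<and> b \<in> Dom M \<and> p \<in> Dom M"
  unfolding opair_def by blast

lemma opair_iff:
  assumes "a \<in> Dom M" "b \<in> Dom M"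
  shows "opair M a b p \<longleftrightarrow> p = opr a b"
proof
  assume "opair M a b p"
  then obtain u v where p: "p \<in> Dom M" "u \<in> Dom M" "v \<in> Dom M"
    "ext M u = {a}" "ext M v = {a, b}" "ext M p = {u, v}"
    unfolding opair_def by blast
  then have "is_set M u" "is_set M v" "is_set M p" by (auto intro: is_setI)
  then have "u = mk {a}" "v = mk {a, b}" "p = mk {u, v}" using p mk_eq by simp_all
  then show "p = opr a b" by (simp add: opr_def)
next
  assume "p = opr a b"
  then show "opair M a b p" unfolding opair_def using assms
    by (intro conjI bexI[of _ "mk {a}"] bexI[of _ "mk {a, b}"])
      (auto simp: ext_opr ext_mk small_pair small_singleton mk_in)
qed

lemma opr_inject:
  assumes "a \<in> Dom M" "b \<in> Dom M" "c \<in> Dom M" "d \<in> Dom M"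
  shows "opr a b = opr c d \<longleftrightarrow> a = c \<and> b = d"
proof
  assume "opr a b = opr c d"
  then have eq: "{mk {a}, mk {a, b}} = {mk {c}, mk {c, d}}" using ext_opr assms by metis
  have inj: "mk {x, y} = mk {z, w} \<longleftrightarrow> {x, y} = {z, w}"
    if "x \<in> Dom M" "y \<in> Dom M" "z \<in> Dom M" "w \<in> Dom M" for x y z w
    using mk_inj[OF small_pair small_pair] that by metis
  from eq inj[of a a c c] inj[of a a c d] inj[of a b c c] inj[of a b c d] inj[of a a a b] assms
  show "a = c \<and> b = d" unfolding doubleton_eq_iff by auto
qed simp

lemma opair_unique:
  assumes "opair M a b p" "opair M c d p"
  shows "a = c \<and> b = d"
  using opair_Dom[OF assms(1)] opair_Dom[OF assms(2)] assms
  by (simp add: opair_iff opr_inject)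

lemma rel_iff: "a \<in> Dom M \<Longrightarrow> b \<in> Dom M \<Longrightarrow> rel M f a b \<longleftrightarrow> opr a b \<in> ext M f"
  unfolding rel_def by (simp add: opair_iff)

lemma rel_Dom: "rel M f a b \<Longrightarrow> a \<in> Dom M \<and> b \<in> Dom M"
  unfolding rel_def using opair_Dom by blast

lemma fun_on_rel:
  assumes "fun_on M f K L" "rel M f a b"
  shows "a \<in> K \<and> b \<in> L"
proof -
  obtain p where "p \<in> ext M f" "opair M a b p" using assms(2) unfolding rel_def by blast
  moreover from this obtain a' b' where "a' \<in> K" "b' \<in> L" "opair M a' b' p"
    using assms(1) unfolding fun_on_def by blast
  ultimately show ?thesis using opair_unique by blast
qed

lemma fun_on_app:
  assumes "fun_on M f K L" "a \<in> K"
  shows rel_iff_app: "rel M f a b \<longleftrightarrow> b = app M f a" and app_in: "app M f a \<in> L"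
proof -
  obtain c where c: "c \<in> L" "rel M f a c" "\<And>d. d \<in> L \<Longrightarrow> rel M f a d \<Longrightarrow> d = c"
    using assms unfolding fun_on_def by blast
  have *: "rel M f a b \<longleftrightarrow> b = c" for b using c fun_on_rel[OF assms(1)] by blast
  have "c \<in> Dom M" using c(2) rel_Dom by blast
  then have "app M f a = c" unfolding app_def * by blast
  then show "rel M f a b \<longleftrightarrow> b = app M f a" "app M f a \<in> L" using * c(1) by auto
qed

lemma fun_on_Dom: "fun_on M f K L \<Longrightarrow> f \<in> Dom M \<and> K \<subseteq> Dom M \<and> L \<subseteq> Dom M"
  unfolding fun_on_def by blast

lemma fun_on_set: "fun_on M f K L \<Longrightarrow> is_set M f"
  unfolding fun_on_def by blast

lemma app_Dom: "fun_on M f K L \<Longrightarrow> a \<in> K \<Longrightarrow> app M f a \<in> Dom M"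
  using app_in fun_on_Dom by blast

lemma fun_on_ext:
  assumes "fun_on M f K L"
  shows "ext M f = (\<lambda>a. opr a (app M f a)) ` K"
proof
  show "ext M f \<subseteq> (\<lambda>a. opr a (app M f a)) ` K"
  proof
    fix p assume p: "p \<in> ext M f"
    then obtain a b where ab: "a \<in> K" "b \<in> L" "opair M a b p" using assms unfolding fun_on_def
      by blast
    then have "rel M f a b" using p unfolding rel_def by blast
    then have "b = app M f a" using rel_iff_app[OF assms ab(1)] by blast
    then show "p \<in> (\<lambda>a. opr a (app M f a)) ` K"
      using ab opair_Dom[OF ab(3)] by (auto simp: opair_iff)
  qed
  show "(\<lambda>a. opr a (app M f a)) ` K \<subseteq> ext M f"
  proof
    fix p assume "p \<in> (\<lambda>a. opr a (app M f a)) ` K"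
    then obtain a where a: "a \<in> K" "p = opr a (app M f a)" by blast
    then have "rel M f a (app M f a)" using rel_iff_app[OF assms] by blast
    then show "p \<in> ext M f" using a rel_Dom[of f a "app M f a"] by (simp add: rel_iff)
  qed
qed

lemma fun_on_eqI:
  assumes "fun_on M f K L" "fun_on M g K L'" "\<And>a. a \<in> K \<Longrightarrow> app M f a = app M g a"
  shows "f = g"
proof (rule is_set_eqI)
  show "ext M f = ext M g"
    unfolding fun_on_ext[OF assms(1)] fun_on_ext[OF assms(2)]
    by (rule image_cong[OF refl]) (simp add: assms(3))
qed (rule fun_on_set[OF assms(1)], rule fun_on_set[OF assms(2)])

lemma fun_onI:
  assumes "is_set M f" "ext M f = (\<lambda>a. opr a (F a)) ` K" "K \<subseteq> Dom M" "F ` K \<subseteq> L" "L \<subseteq> Dom M"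
  shows "fun_on M f K L" and "\<And>a. a \<in> K \<Longrightarrow> app M f a = F a"
proof -
  have *: "rel M f a b \<longleftrightarrow> b = F a" if "a \<in> K" for a b
  proof (cases "b \<in> Dom M")
    case True
    have "opr a b \<in> ext M f \<longleftrightarrow> b = F a"
      unfolding assms(2) using that True assms(3,4,5) opr_inject by
        (auto simp: image_iff subset_iff)
    then show ?thesis using that True assms(3) rel_iff by blast
  next
    case False
    then show ?thesis using rel_Dom that assms(4,5) by blast
  qed
  show f: "fun_on M f K L"
    unfolding fun_on_def
  proof (intro conjI ballI)
    fix p assume "p \<in> ext M f"
    then obtain a where "a \<in> K" "p = opr a (F a)" using assms(2) by auto
    moreover from this have "F a \<in> L" "a \<in> Dom M" "F a \<in> Dom M" using assms(3,4,5) by auto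
    ultimately show "\<exists>a\<in>K. \<exists>b\<in>L. opair M a b p" using opair_iff by blast
  next
    fix a assume "a \<in> K"
    then show "\<exists>!b. b \<in> L \<and> rel M f a b" using * assms(4) by auto
  qed (use assms in auto)
  show "app M f a = F a" if "a \<in> K" for a
    using rel_iff_app[OF f that] * that by blast
qed

text \<open>The graph is the image of \<open>K\<close> under the map from \<open>a\<close> to
  \<open>opr a (F a)\<close>, hence a set by Replacement; \<open>R\<close> stands in for
  \<open>F\<close> in the formula. \<open>L\<close> may be any class containing the values, since
  \<open>fun_on\<close> asks only the function itself to be an element.\<close>

lemma make_fun:
  assumes "small K" "dfn M ps (\<lambda>e. R (e 0) (e (Suc 0)))" "set ps \<subseteq> Dom M"
    and "\<And>x y. x \<in> K \<Longrightarrow> y \<in> Dom M \<Longrightarrow> R x y \<longleftrightarrow> y = F x" "F ` K \<subseteq> L" "L \<subseteq> Dom M"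
  obtains f where "fun_on M f K L" "\<And>a. a \<in> K \<Longrightarrow> app M f a = F a"
proof -
  have F: "F x \<in> Dom M" if "x \<in> K" for x using that assms(5,6) by blast
  have K: "K \<subseteq> Dom M" by (rule small_Dom[OF assms(1)])
  have "dfn M ps (\<lambda>e. \<exists>b\<in>Dom M. R (e 0) b \<and> opair M (e 0) b (e (Suc 0)))"
    by (intro dfn_intro dfn_subst2[OF assms(2)])
  then have "small ((\<lambda>a. opr a (F a)) ` K)"
  proof (rule small_image[OF assms(1) _ assms(3)])
    fix x y assume "x \<in> K" "y \<in> Dom M"
    then show "(\<exists>b\<in>Dom M. R x b \<and> opair M x b y) \<longleftrightarrow> y = opr x (F x)"
      using F K assms(4) by (auto simp: opair_iff subset_iff)
  qed (use F K in auto)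
  then obtain f where "is_set M f" "ext M f = (\<lambda>a. opr a (F a)) ` K"
    unfolding small_def by blast
  from fun_onI[OF this K assms(5,6)] show ?thesis by (rule that)
qed

lemma identity_fun:
  assumes "small K" "K \<subseteq> L" "L \<subseteq> Dom M"
  obtains f where "fun_on M f K L" "\<And>a. a \<in> K \<Longrightarrow> app M f a = a"
proof (rule make_fun[where K=K and L=L and F="\<lambda>a. a" and ps="[]" and R="\<lambda>x y. y = x"])
  show "dfn M [] (\<lambda>e. e (Suc 0) = e 0)" by (intro dfn_intro)
qed (use assms in auto)

text \<open>Replacement along the first components of the pairs in \<open>f\<close> recovers the
  domain, which \<open>fun_on\<close> mentions only as a subset of the structure.\<close>

lemma fun_on_small:
  assumes "fun_on M f K L"
  shows "small K"
proof -
  have f: "f \<in> Dom M" using fun_on_Dom[OF assms] by blast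
  have "small {a \<in> Dom M. \<exists>p\<in>ext M f. \<exists>b\<in>Dom M. opair M a b p}"
  proof (rule repl[of _ "[]"])
    show "dfn M [] (\<lambda>e. \<exists>b\<in>Dom M. opair M (e (Suc 0)) b (e 0))" by (intro dfn_intro)
  qed (use small_ext[OF f] opair_unique in auto)
  also have "{a \<in> Dom M. \<exists>p\<in>ext M f. \<exists>b\<in>Dom M. opair M a b p} = K"
  proof (intro equalityI subsetI)
    fix a assume "a \<in> {a \<in> Dom M. \<exists>p\<in>ext M f. \<exists>b\<in>Dom M. opair M a b p}"
    then show "a \<in> K" using fun_on_rel[OF assms] unfolding rel_def by blast
  next
    fix a assume "a \<in> K"
    with rel_iff_app[OF assms this] app_Dom[OF assms this] fun_on_Dom[OF assms]
    show "a \<in> {a \<in> Dom M. \<exists>p\<in>ext M f. \<exists>b\<in>Dom M. opair M a b p}"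
      unfolding rel_def by blast
  qed
  finally show ?thesis .
qed

text \<open>Kuratowski pairs of elements of \<open>K\<close> and \<open>L\<close> lie in the double
  power set of \<open>K \<union> L\<close>, from which Separation cuts out the product.\<close>

lemma small_prod:
  assumes "small K" "small L"
  shows "small {p. \<exists>a\<in>K. \<exists>b\<in>L. p = opr a b}"
proof -
  define k l where "k = mk K" and "l = mk L"
  have kl: "ext M k = K" "ext M l = L" "k \<in> Dom M" "l \<in> Dom M"
    using assms by (auto simp: k_def l_def mk_props)
  have KL: "K \<subseteq> Dom M" "L \<subseteq> Dom M" using assms small_Dom by auto
  let ?P = "{y. is_set M y \<and> ext M y \<subseteq> {y. is_set M y \<and> ext M y \<subseteq> K \<union> L}}"
  have "small ?P" by (intro small_Pow small_Un assms)
  moreover have "dfn M [k, l] (\<lambda>e. \<exists>a\<in>ext M k. \<exists>b\<in>ext M l. opair M a b (e 0))"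
    by (intro dfn_intro) (simp_all add: kl)
  ultimately have "small {p \<in> ?P. \<exists>a\<in>ext M k. \<exists>b\<in>ext M l. opair M a b p}"
    by (rule sep) (simp add: kl)
  also have "{p \<in> ?P. \<exists>a\<in>ext M k. \<exists>b\<in>ext M l. opair M a b p} = {p. \<exists>a\<in>K. \<exists>b\<in>L. p = opr a b}"
  proof -
    have "opr a b \<in> ?P" if "a \<in> K" "b \<in> L" for a b
    proof -
      have ab: "a \<in> Dom M" "b \<in> Dom M" using that KL by auto
      then have "is_set M (opr a b)" unfolding opr_def
        by (intro is_set_mk small_pair mk_in small_singleton)
      then show ?thesis using ab that by
        (auto simp: ext_opr is_set_mk ext_mk small_pair small_singleton)
    qed
    moreover have "opair M a b p \<longleftrightarrow> p = opr a b" if "a \<in> K" "b \<in> L" for a b p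
      using that KL by (intro opair_iff) auto
    ultimately show ?thesis unfolding kl by auto
  qed
  finally show ?thesis .
qed

lemma small_funs:
  assumes "small K" "small L"
  shows "small {f. fun_on M f K L}"
proof -
  define k l where "k = mk K" and "l = mk L"
  have kl: "ext M k = K" "ext M l = L" "k \<in> Dom M" "l \<in> Dom M"
    using assms by (auto simp: k_def l_def mk_props)
  let ?P = "{y. is_set M y \<and> ext M y \<subseteq> {p. \<exists>a\<in>K. \<exists>b\<in>L. p = opr a b}}"
  have "small ?P" by (intro small_Pow small_prod assms)
  moreover have "dfn M [k, l] (\<lambda>e. fun_on M (e 0) (ext M k) (ext M l))"
    by (intro dfn_intro) (simp_all add: kl)
  ultimately have "small {f \<in> ?P. fun_on M f (ext M k) (ext M l)}"
    by (rule sep) (simp add: kl)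
  also have "{f \<in> ?P. fun_on M f (ext M k) (ext M l)} = {f. fun_on M f K L}"
  proof -
    have "f \<in> ?P" if "fun_on M f K L" for f
      using fun_on_set[OF that] fun_on_ext[OF that] app_in[OF that] by auto
    then show ?thesis unfolding kl by blast
  qed
  finally show ?thesis .
qed


section \<open>Definability of injections, bijections, finiteness and countability\<close>

lemma inj_on_app_iff:
  assumes "fun_on M g K L"
  shows "inj_on (app M g) K \<longleftrightarrow>
    (\<forall>a\<in>K. \<forall>b\<in>K. \<forall>c\<in>Dom M. rel M g a c \<longrightarrow> rel M g b c \<longrightarrow> a = b)"
proof
  assume "inj_on (app M g) K"
  then show "\<forall>a\<in>K. \<forall>b\<in>K. \<forall>c\<in>Dom M. rel M g a c \<longrightarrow> rel M g b c \<longrightarrow> a = b"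
    using rel_iff_app[OF assms] by (auto dest: inj_onD)
next
  assume *: "\<forall>a\<in>K. \<forall>b\<in>K. \<forall>c\<in>Dom M. rel M g a c \<longrightarrow> rel M g b c \<longrightarrow> a = b"
  show "inj_on (app M g) K"
  proof (rule inj_onI)
    fix a b assume ab: "a \<in> K" "b \<in> K" "app M g a = app M g b"
    then show "a = b"
      using *[rule_format, OF ab(1,2) app_Dom[OF assms ab(1)]] rel_iff_app[OF assms] by simp
  qed
qed

lemma bij_betw_app_iff:
  assumes "fun_on M g K L"
  shows "bij_betw (app M g) K L \<longleftrightarrow> inj_on (app M g) K \<and> (\<forall>b\<in>L. \<exists>a\<in>K. rel M g a b)"
  using app_in[OF assms] rel_iff_app[OF assms] by (auto simp: bij_betw_def image_iff)

text \<open>\<open>app\<close> is a definite description and not a term, so injectivity is first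
  restated with \<open>rel\<close>. The restatement is correct for functions, hence the conjunction
  with \<open>fun_on\<close> is treated as a unit.\<close>

lemma dfn_injection [dfn_intro]:
  assumes "trm M ps g" "dcl M ps K" "dcl M ps L"
  shows "dfn M ps (\<lambda>e. fun_on M (g e) (K e) (L e) \<and> inj_on (app M (g e)) (K e))"
proof -
  have "dfn M ps (\<lambda>e. fun_on M (g e) (K e) (L e) \<and>
      (\<forall>a\<in>K e. \<forall>b\<in>K e. \<forall>c\<in>Dom M. rel M (g e) a c \<longrightarrow> rel M (g e) b c \<longrightarrow> a = b))"
    by (intro dfn_intro trm_shift[OF assms(1)] dcl_shift[OF assms(2)] dcl_shift[OF assms(3)])
  then show ?thesis by (rule dfn_cong) (simp cong: conj_cong add: inj_on_app_iff)
qed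

lemma dfn_bijection [dfn_intro]:
  assumes "trm M ps g" "dcl M ps K" "dcl M ps L"
  shows "dfn M ps (\<lambda>e. fun_on M (g e) (K e) (L e) \<and> bij_betw (app M (g e)) (K e) (L e))"
proof -
  have "dfn M ps (\<lambda>e. (fun_on M (g e) (K e) (L e) \<and> inj_on (app M (g e)) (K e)) \<and>
      (\<forall>b\<in>L e. \<exists>a\<in>K e. rel M (g e) a b))"
    by (intro dfn_intro trm_shift[OF assms(1)] dcl_shift[OF assms(2)] dcl_shift[OF assms(3)])
  then show ?thesis by (rule dfn_cong) (use bij_betw_app_iff in blast)
qed

lemma dfn_countable [dfn_intro]:
  assumes "dcl M ps K"
  shows "dfn M ps (\<lambda>e. countable_in M (K e))"
proof -
  have "dfn M ps (\<lambda>e. \<exists>g\<in>Dom M. fun_on M g (K e) (omega M) \<and> inj_on (app M g) (K e))"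
    by (rule dfn_ex, rule dfn_injection) (intro dfn_intro dcl_shift[OF assms])+
  then show ?thesis
    by (rule dfn_cong) (use fun_on_Dom in \<open>auto simp: countable_in_def\<close>)
qed

lemma dfn_finite [dfn_intro]:
  assumes "dcl M ps K"
  shows "dfn M ps (\<lambda>e. finite_in M (K e))"
proof -
  have "dfn M ps (\<lambda>e. \<exists>n\<in>omega M. \<exists>g\<in>Dom M. fun_on M g (ext M n) (K e)
    \<and> bij_betw (app M g) (ext M n) (K e))"
    by (rule dfn_bex, rule dcl_omega, rule dfn_ex, rule dfn_bijection) (intro dfn_intro dcl_shift[OF assms])+
  then show ?thesis
    unfolding finite_in_def by (rule dfn_cong) (use fun_on_Dom[THEN conjunct1] in meson)
qed


subsection \<open>Natural numbers\<close>

lemma zero_in_eq: "zero_in M = mk {}"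
  by (simp add: zero_in_def mk_def)

lemma zero_props [simp]: "is_set M (zero_in M)" "ext M (zero_in M) = {}" "zero_in M \<in> Dom M"
  unfolding zero_in_eq by (simp_all add: mk_props small_empty)

lemma eq_zero_iff: "is_set M x \<Longrightarrow> x = zero_in M \<longleftrightarrow> ext M x = {}"
  using is_set_eqI[of x "zero_in M"] by auto

definition suc :: "'v \<Rightarrow> 'v" where
  "suc n = mk (insert n (ext M n))"

lemma suc_props [simp]:
  assumes "n \<in> Dom M"
  shows "is_set M (suc n)" "ext M (suc n) = insert n (ext M n)" "suc n \<in> Dom M"
  unfolding suc_def using assms by (simp_all add: mk_props small_insert small_ext)

lemma eq_suc_iff: "n \<in> Dom M \<Longrightarrow> m = suc n \<longleftrightarrow> is_set M m \<and> ext M m = insert n (ext M n)"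
  using is_set_eqI[of m "suc n"] by auto

lemma one_in_eq: "one_in M = suc (zero_in M)"
  by (simp add: one_in_def suc_def mk_def)

lemma suc_inject: "m \<in> Dom M \<Longrightarrow> n \<in> Dom M \<Longrightarrow> suc m = suc n \<longleftrightarrow> m = n"
  using suc_props(2) not_in_cycle by (metis insertE insertI1)

lemma suc_not_zero: "n \<in> Dom M \<Longrightarrow> suc n \<noteq> zero_in M"
  using suc_props(2) zero_props(2) by (metis insert_not_empty)

lemma inductive_iff:
  "inductive_set_in M I \<longleftrightarrow> is_set M I \<and> zero_in M \<in> ext M I \<and> (\<forall>x\<in>ext M I. suc x \<in> ext M I)"
proof -
  have "(\<exists>z\<in>ext M I. is_set M z \<and> ext M z = {}) \<longleftrightarrow> zero_in M \<in> ext M I"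
    using eq_zero_iff zero_props by blast
  moreover have "(\<exists>y\<in>ext M I. is_set M y \<and> ext M y = insert x (ext M x)) \<longleftrightarrow> suc x \<in> ext M I"
    if "x \<in> ext M I" for x
  proof -
    have "x \<in> Dom M" using that by blast
    then have "is_set M y \<and> ext M y = insert x (ext M x) \<longleftrightarrow> y = suc x" for y
      using eq_suc_iff by simp
    then show ?thesis by simp
  qed
  ultimately show ?thesis unfolding inductive_set_in_def by auto
qed

lemma omega_inductive: "zero_in M \<in> omega M" "n \<in> omega M \<Longrightarrow> suc n \<in> omega M"
  unfolding omega_def inductive_iff by auto

lemma omega_Dom [simp, dest]: "n \<in> omega M \<Longrightarrow> n \<in> Dom M"
  by (simp add: omega_def)

lemma one_in_omega: "one_in M \<in> omega M"
  unfolding one_in_eq by (intro omega_inductive)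

lemma one_props [simp]: "one_in M \<in> Dom M" "one_in M \<noteq> zero_in M" "zero_in M \<noteq> one_in M"
  using one_in_omega suc_not_zero[of "zero_in M"] by (auto simp: one_in_eq)

lemma small_omega: "small (omega M)"
proof -
  obtain I where I: "inductive_set_in M I" using ax_infinity by blast
  then have "small (ext M I)" using small_ext by (simp add: inductive_iff is_setD)
  then have "small {n \<in> ext M I. n \<in> omega M}"
    by (rule sep[of _ "[]"]) (intro dfn_intro, simp)
  moreover have "{n \<in> ext M I. n \<in> omega M} = omega M"
    using I unfolding omega_def by blast
  ultimately show ?thesis by simp
qed

text \<open>Separation collects the numbers satisfying \<open>P\<close> into an inductive set, which
  contains every element of \<open>omega M\<close>, nonstandard ones included.\<close>

lemma omega_induct:
  assumes "n \<in> omega M" "dfn M ps (\<lambda>e. P (e 0))" "set ps \<subseteq> Dom M"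
    and "P (zero_in M)" "\<And>n. n \<in> omega M \<Longrightarrow> P n \<Longrightarrow> P (suc n)"
  shows "P n"
proof -
  have sm: "small {n \<in> omega M. P n}"
    by (rule sep[OF small_omega assms(2,3)])
  have "inductive_set_in M (mk {n \<in> omega M. P n})"
    unfolding inductive_iff ext_mk[OF sm] using is_set_mk[OF sm] assms(4,5) omega_inductive by blast
  then have "n \<in> ext M (mk {n \<in> omega M. P n})"
    using assms(1) unfolding omega_def by blast
  then show ?thesis unfolding ext_mk[OF sm] by blast
qed

lemma is_set_omega: "n \<in> omega M \<Longrightarrow> is_set M n"
proof (rule omega_induct[where ps="[]" and P="is_set M"])
qed (auto intro!: dfn_intro)

lemma omega_ext_subset: "n \<in> omega M \<Longrightarrow> ext M n \<subseteq> omega M"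
proof (rule omega_induct[where ps="[]" and P="\<lambda>n. ext M n \<subseteq> omega M"])
qed (auto intro!: dfn_intro)

lemma omega_ext_trans: "n \<in> omega M \<Longrightarrow> m \<in> ext M n \<Longrightarrow> ext M m \<subseteq> ext M n"
proof -
  have "n \<in> omega M \<Longrightarrow> \<forall>m\<in>ext M n. ext M m \<subseteq> ext M n"
  proof (rule omega_induct[where ps="[]" and P="\<lambda>n. \<forall>m\<in>ext M n. ext M m \<subseteq> ext M n"])
  qed (auto intro!: dfn_intro)
  then show "n \<in> omega M \<Longrightarrow> m \<in> ext M n \<Longrightarrow> ext M m \<subseteq> ext M n" by blast
qed

lemma zero_in_ext:
  assumes "n \<in> omega M"
  shows "n = zero_in M \<or> zero_in M \<in> ext M n"
proof (rule omega_induct[where ps="[zero_in M]", OF assms])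
  show "dfn M [zero_in M] (\<lambda>e. e 0 = zero_in M \<or> zero_in M \<in> ext M (e 0))"
    by (intro dfn_intro) simp_all
qed auto

lemma suc_in_ext:
  assumes "n \<in> omega M" "m \<in> ext M n"
  shows "suc m = n \<or> suc m \<in> ext M n"
proof -
  \<comment> \<open>\<open>suc\<close> is no term of the language, so for the induction the
    successor of \<open>m\<close> is described by its elements.\<close>
  have "\<forall>m\<in>ext M n. \<exists>k\<in>insert n (ext M n). is_set M k \<and> ext M k = insert m (ext M m)"
  proof (rule omega_induct[where ps="[]", OF assms(1)])
    fix n
    assume n: "n \<in> omega M"
      "\<forall>m\<in>ext M n. \<exists>k\<in>insert n (ext M n). is_set M k \<and> ext M k = insert m (ext M m)"
    then have "n \<in> Dom M" by blast
    then show "\<forall>m\<in>ext M (suc n). \<exists>k\<in>insert (suc n) (ext M (suc n)).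
        is_set M k \<and> ext M k = insert m (ext M m)"
      using n(2) by auto
  qed (auto intro!: dfn_intro)
  then obtain k where "k \<in> insert n (ext M n)" "is_set M k \<and> ext M k = insert m (ext M m)"
    using assms(2) by blast
  moreover from this have "k = suc m" using eq_suc_iff assms(2) by blast
  ultimately show ?thesis by blast
qed

lemma omega_linear:
  assumes "m \<in> omega M" "n \<in> omega M"
  shows "m \<in> ext M n \<or> m = n \<or> n \<in> ext M m"
proof (rule omega_induct[where ps="[m]", OF assms(2)])
  show "m \<in> ext M (zero_in M) \<or> m = zero_in M \<or> zero_in M \<in> ext M m"
    using zero_in_ext[OF assms(1)] by blast
  fix n
  assume n: "n \<in> omega M" "m \<in> ext M n \<or> m = n \<or> n \<in> ext M m"
  then have "n \<in> Dom M" by blast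
  then show "m \<in> ext M (suc n) \<or> m = suc n \<or> suc n \<in> ext M m"
    using n suc_in_ext[OF assms(1), of n] by auto
qed (use assms in \<open>auto intro!: dfn_intro\<close>)

lemma small_Diff1: "small K \<Longrightarrow> a \<in> Dom M \<Longrightarrow> small (K - {a})"
  using sep[of K "[a]" "\<lambda>x. x \<noteq> a"] by (simp add: set_diff_eq dfn_not dfn_eq trm_var trm_const)

text \<open>\<open>h\<close> is the least relation that contains the pair of zero and
  \<open>x0\<close> and is closed under passing from \<open>(n, x)\<close> to
  \<open>(suc n, g x)\<close>. As an intersection of elements of the structure it is obtained by
  Separation, with no recursion outside the structure.\<close>

lemma omega_rec:
  assumes g: "fun_on M g X X" and x0: "x0 \<in> X"
  obtains h where "fun_on M h (omega M) X" "app M h (zero_in M) = x0"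
    "\<And>n. n \<in> omega M \<Longrightarrow> app M h (suc n) = app M g (app M h n)"
proof -
  define xx where "xx = mk X"
  have xx: "ext M xx = X" "xx \<in> Dom M"
    using fun_on_small[OF g] by (auto simp: xx_def mk_props)
  have gD: "g \<in> Dom M" "X \<subseteq> Dom M" using fun_on_Dom[OF g] by auto
  define W where "W = {p. \<exists>n\<in>omega M. \<exists>x\<in>X. p = opr n x}"
  have W: "small W" unfolding W_def by (intro small_prod small_omega fun_on_small[OF g])
  \<comment> \<open>The closure conditions are written with \<open>rel\<close> and with elements in
    place of \<open>app\<close> and \<open>suc\<close>, so that they are definable;
    \<open>C_iff\<close> gives the readable form.\<close>
  define C where "C r \<longleftrightarrow> rel M r (zero_in M) x0 \<and> (\<forall>n\<in>omega M. \<forall>m\<in>omega M. \<forall>x\<in>ext M xx. \<forall>y\<in>ext M xx.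
      rel M r n x \<longrightarrow> is_set M m \<and> ext M m = insert n (ext M n) \<longrightarrow> rel M g x y \<longrightarrow> rel M r m y)" for r
  have C_iff: "C r \<longleftrightarrow> rel M r (zero_in M) x0 \<and>
      (\<forall>n\<in>omega M. \<forall>x\<in>X. rel M r n x \<longrightarrow> rel M r (suc n) (app M g x))" for r
  proof -
    have "(\<forall>m\<in>omega M. \<forall>y\<in>ext M xx. rel M r n x \<longrightarrow> is_set M m \<and> ext M m = insert n (ext M n)
      \<longrightarrow> rel M g x y \<longrightarrow> rel M r m y)
      \<longleftrightarrow> (rel M r n x \<longrightarrow> rel M r (suc n) (app M g x))" if "n \<in> omega M" "x \<in> X" for n x
    proof -
      have *: "is_set M m \<and> ext M m = insert n (ext M n) \<longleftrightarrow> m = suc n" for m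
        using eq_suc_iff[OF omega_Dom[OF that(1)]] by blast
      show ?thesis
        unfolding xx(1) * rel_iff_app[OF g that(2)]
        using app_in[OF g that(2)] omega_inductive(2)[OF that(1)] by auto
    qed
    then show ?thesis unfolding C_def xx(1) by blast
  qed
  define H where "H = {p \<in> W. \<forall>r\<in>Dom M. C r \<longrightarrow> p \<in> ext M r}"
  have "small H"
    unfolding H_def
  proof (rule sep[OF W, of "[zero_in M, x0, xx, g]"])
    show "dfn M [zero_in M, x0, xx, g] (\<lambda>e. \<forall>r\<in>Dom M. C r \<longrightarrow> e 0 \<in> ext M r)"
      unfolding C_def using x0 gD xx(2) by (intro dfn_intro) auto
  qed (use x0 gD xx(2) in auto)
  define h where "h = mk H"
  have h: "ext M h = H" "is_set M h" "h \<in> Dom M" using \<open>small H\<close> by (auto simp: h_def mk_props)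
  have relH: "rel M h n x \<longleftrightarrow> n \<in> omega M \<and> x \<in> X \<and> (\<forall>r\<in>Dom M. C r \<longrightarrow> rel M r n x)" for n x
  proof (cases "n \<in> Dom M \<and> x \<in> Dom M")
    case True
    then have "opr n x \<in> W \<longleftrightarrow> n \<in> omega M \<and> x \<in> X"
      unfolding W_def using opr_inject gD(2) omega_Dom by blast
    then show ?thesis using True
      unfolding rel_iff[OF conjunct1[OF True] conjunct2[OF True]] h(1) H_def by blast
  next
    case False
    then show ?thesis using rel_Dom[of h n x] gD(2) by blast
  qed
  have Ch: "C h"
  proof (rule C_iff[THEN iffD2], intro conjI ballI impI)
    show "rel M h (zero_in M) x0"
      unfolding relH using x0 omega_inductive(1) C_iff by blast
    fix n x
    assume n: "n \<in> omega M" and x: "x \<in> X" and "rel M h n x"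
    then have "rel M r n x" if "r \<in> Dom M" "C r" for r using that unfolding relH by blast
    then have "rel M r (suc n) (app M g x)" if "r \<in> Dom M" "C r" for r
      using that n x C_iff by blast
    then show "rel M h (suc n) (app M g x)"
      unfolding relH using omega_inductive(2)[OF n] app_in[OF g x] by blast
  qed
  \<comment> \<open>By leastness: a pair that is neither the initial one nor produced by a step
    could be removed, leaving a smaller closed relation.\<close>
  have inversion: "n = zero_in M \<and> x = x0 \<or> (\<exists>m\<in>omega M. \<exists>y\<in>X. n = suc m \<and> rel M h m y
    \<and> x = app M g y)"
    if nx: "rel M h n x" for n x
  proof (rule ccontr)
    assume no: "\<not> ?thesis"
    have D: "n \<in> Dom M" "x \<in> Dom M" using rel_Dom[OF nx] by auto
    have sm: "small (H - {opr n x})" using D by (intro small_Diff1 \<open>small H\<close>) simp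
    define h' where "h' = mk (H - {opr n x})"
    have h': "ext M h' = H - {opr n x}" "h' \<in> Dom M" using sm by (auto simp: h'_def mk_props)
    have relH': "rel M h' k z \<longleftrightarrow> rel M h k z \<and> \<not> (k = n \<and> z = x)" for k z
    proof (cases "k \<in> Dom M \<and> z \<in> Dom M")
      case True
      then show ?thesis using D by (auto simp: rel_iff h' h opr_inject)
    next
      case False
      then show ?thesis using rel_Dom[of h k z] rel_Dom[of h' k z] by blast
    qed
    have "C h'"
    proof (rule C_iff[THEN iffD2], intro conjI ballI impI)
      show "rel M h' (zero_in M) x0" unfolding relH' using Ch C_iff no by blast
      fix k z assume "k \<in> omega M" "z \<in> X" "rel M h' k z"
      then show "rel M h' (suc k) (app M g z)" unfolding relH' using Ch[unfolded C_iff] no by blast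
    qed
    then have "rel M h' n x" using nx h'(2) unfolding relH by blast
    then show False unfolding relH' by blast
  qed
  \<comment> \<open>Induction on \<open>n\<close>: by inversion, a value at \<open>suc n\<close>
    comes from a value at a number with the same successor, that is, at \<open>n\<close>
    itself.\<close>
  have unique: "\<exists>x\<in>ext M xx. \<forall>y\<in>Dom M. rel M h n y \<longleftrightarrow> y = x" if "n \<in> omega M" for n
  proof (rule omega_induct[where ps="[xx, h]", OF that])
    show "\<exists>x\<in>ext M xx. \<forall>y\<in>Dom M. rel M h (zero_in M) y \<longleftrightarrow> y = x"
      unfolding xx(1)
    proof (intro bexI[OF _ x0] ballI iffI)
      fix y assume "rel M h (zero_in M) y"
      from inversion[OF this] show "y = x0" using suc_not_zero omega_Dom by metis
    qed (use Ch[unfolded C_iff] in blast)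
    fix n assume n: "n \<in> omega M" "\<exists>x\<in>ext M xx. \<forall>y\<in>Dom M. rel M h n y \<longleftrightarrow> y = x"
    then obtain x where x: "x \<in> X" "\<And>y. y \<in> Dom M \<Longrightarrow> rel M h n y \<longleftrightarrow> y = x" unfolding xx(1) by blast
    show "\<exists>x\<in>ext M xx. \<forall>y\<in>Dom M. rel M h (suc n) y \<longleftrightarrow> y = x"
      unfolding xx(1)
    proof (intro bexI[OF _ app_in[OF g x(1)]] ballI iffI)
      fix y assume "rel M h (suc n) y"
      from inversion[OF this] obtain m z where "m \<in> omega M" "z \<in> X" "suc n = suc m" "rel M h m z"
        "y = app M g z"
        using suc_not_zero[OF omega_Dom[OF n(1)]] by blast
      moreover from this have "n = m" using suc_inject[OF omega_Dom omega_Dom] n(1) by blast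
      ultimately show "y = app M g x" using x gD(2) by blast
    next
      fix y assume "y = app M g x"
      moreover have "rel M h n x" using x gD(2) by blast
      ultimately show "rel M h (suc n) y" using Ch[unfolded C_iff] n(1) x(1) by blast
    qed
  qed (use xx(2) h(3) in \<open>auto intro!: dfn_intro\<close>)
  have fh: "fun_on M h (omega M) X"
    unfolding fun_on_def
  proof (intro conjI ballI)
    fix p assume "p \<in> ext M h"
    then obtain n x where "n \<in> omega M" "x \<in> X" "p = opr n x" unfolding h(1) H_def W_def by blast
    then show "\<exists>n\<in>omega M. \<exists>x\<in>X. opair M n x p" using opair_iff omega_Dom gD(2) by blast
  next
    fix n assume "n \<in> omega M"
    from unique[OF this] obtain x where "x \<in> X" "\<And>y. y \<in> Dom M \<Longrightarrow> rel M h n y \<longleftrightarrow> y = x"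
      unfolding xx(1) by blast
    then show "\<exists>!x. x \<in> X \<and> rel M h n x" using gD(2) by (intro ex1I[of _ x]) auto
  qed (rule h(2), blast, rule gD(2))
  show thesis
  proof (rule that[OF fh])
    have "rel M h (zero_in M) x0" using Ch unfolding C_iff by (rule conjunct1)
    then show "app M h (zero_in M) = x0"
      by (simp add: rel_iff_app[OF fh omega_inductive(1)])
    fix n assume n: "n \<in> omega M"
    have "rel M h n (app M h n)" by (simp add: rel_iff_app[OF fh n])
    then have "rel M h (suc n) (app M g (app M h n))"
      using Ch[unfolded C_iff] n app_in[OF fh n] by blast
    then show "app M h (suc n) = app M g (app M h n)"
      by (simp add: rel_iff_app[OF fh omega_inductive(2)[OF n]])
  qed
qed


subsection \<open>Finite and countable sets\<close>

text \<open>An enumeration of \<open>K\<close> along \<open>n\<close> meets the sequence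
  \<open>x\<close> only at bounded indices, by induction on the part enumerated so far. If
  \<open>b\<close> is the bound, the value of \<open>x\<close> at \<open>b\<close> is enumerated
  too, so that \<open>b \<in> b\<close>. This replaces a pigeonhole argument.\<close>

lemma not_finite_if_sequence:
  assumes x: "fun_on M x (omega M) L" "inj_on (app M x) (omega M)" "app M x ` omega M \<subseteq> K"
  shows "\<not> finite_in M K"
proof
  assume "finite_in M K"
  then obtain n g where n: "n \<in> omega M"
    and g: "fun_on M g (ext M n) K" "bij_betw (app M g) (ext M n) K"
    unfolding finite_in_def by blast
  have gx: "g \<in> Dom M" "x \<in> Dom M" using fun_on_Dom g(1) x(1) by blast+
  have rel_x: "rel M x i w \<longleftrightarrow> i \<in> omega M \<and> w = app M x i" for i w
    using fun_on_rel[OF x(1)] rel_iff_app[OF x(1)] by blast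
  have rel_g: "rel M g k w \<longleftrightarrow> k \<in> ext M n \<and> w = app M g k" for k w
    using fun_on_rel[OF g(1)] rel_iff_app[OF g(1)] by blast
  have "\<exists>b\<in>omega M. \<forall>k\<in>ext M m. \<forall>j\<in>omega M. \<forall>w\<in>Dom M. rel M g k w \<longrightarrow> rel M x j w \<longrightarrow> j \<in> ext M b"
    if "m \<in> omega M" for m
  proof (rule omega_induct[where ps="[g, x]", OF that])
    fix m
    assume m: "m \<in> omega M" "\<exists>b\<in>omega M. \<forall>k\<in>ext M m. \<forall>j\<in>omega M. \<forall>w\<in>Dom M.
        rel M g k w \<longrightarrow> rel M x j w \<longrightarrow> j \<in> ext M b"
    then obtain b where b: "b \<in> omega M" "\<And>k j w. k \<in> ext M m \<Longrightarrow> rel M g k w \<Longrightarrow> rel M x j w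
      \<Longrightarrow> j \<in> ext M b"
      using rel_x rel_Dom by metis
    show "\<exists>b\<in>omega M. \<forall>k\<in>ext M (suc m). \<forall>j\<in>omega M. \<forall>w\<in>Dom M.
        rel M g k w \<longrightarrow> rel M x j w \<longrightarrow> j \<in> ext M b"
    proof (cases "\<exists>j\<in>omega M. \<exists>w. rel M g m w \<and> rel M x j w")
      case False
      then show ?thesis using b m(1) by (intro bexI[of _ b]) auto
    next
      case True
      then obtain i w where i: "i \<in> omega M" "rel M g m w" "rel M x i w" by blast
      have j: "j = i" if "rel M g m v" "rel M x j v" for j v
        using that i x(2) unfolding rel_x rel_g by (metis inj_onD)
      \<comment> \<open>One further index \<open>i\<close> is absorbed by keeping \<open>b\<close>
        or moving to \<open>suc i\<close>, whichever is larger.\<close>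
      have "\<exists>c\<in>omega M. insert i (ext M b) \<subseteq> ext M c"
      proof (cases "i \<in> ext M b")
        case True
        then show ?thesis using b(1) by blast
      next
        case False
        then have "ext M b \<subseteq> ext M (suc i)"
          using omega_linear[OF i(1) b(1)] omega_ext_trans[OF i(1)] i(1) by auto
        then show ?thesis using omega_inductive(2)[OF i(1)] i(1) by (intro bexI[of _ "suc i"]) auto
      qed
      then obtain c where c: "c \<in> omega M" "insert i (ext M b) \<subseteq> ext M c" by blast
      show ?thesis
      proof (intro bexI[OF _ c(1)] ballI impI)
        fix k j v assume "k \<in> ext M (suc m)" "rel M g k v" "rel M x j v"
        then show "j \<in> ext M c" using b(2)[of k v j] j[of v j] c(2) m(1) by auto
      qed
    qed
  qed (use gx omega_inductive(1) in \<open>auto intro!: dfn_intro\<close>)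
  from this[OF n] obtain b where b: "b \<in> omega M"
    "\<And>k j w. k \<in> ext M n \<Longrightarrow> w \<in> Dom M \<Longrightarrow> rel M g k w \<Longrightarrow> rel M x j w \<Longrightarrow> j \<in> ext M b"
    using rel_x by blast
  have "app M x b \<in> K" using x(3) b(1) by blast
  then obtain k where "k \<in> ext M n" "app M x b = app M g k"
    using g(2) unfolding bij_betw_def by blast
  then have "b \<in> ext M b"
    using b(2)[of k "app M x b" b] rel_x rel_g b(1) app_Dom[OF x(1) b(1)] by blast
  then show False using not_in_self[of b] b(1) by blast
qed

lemma omega_infinite: "\<not> finite_in M (omega M)"
proof -
  obtain i where "fun_on M i (omega M) (omega M)" "\<And>n. n \<in> omega M \<Longrightarrow> app M i n = n"
    by (rule identity_fun[OF small_omega subset_refl]) auto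
  then show ?thesis by (intro not_finite_if_sequence[of i "omega M"]) (auto simp: inj_on_def)
qed

lemma countable_omega: "countable_in M (omega M)"
proof -
  obtain i where "fun_on M i (omega M) (omega M)" "\<And>n. n \<in> omega M \<Longrightarrow> app M i n = n"
    by (rule identity_fun[OF small_omega subset_refl]) auto
  then show ?thesis unfolding countable_in_def by (auto simp: inj_on_def)
qed

lemma finite_empty: "finite_in M {}"
  unfolding finite_in_def
proof (intro bexI[OF _ omega_inductive(1)] exI conjI)
  show "fun_on M (zero_in M) (ext M (zero_in M)) {}" by (simp add: fun_on_def)
qed (simp add: bij_betw_def)

lemma finite_insert:
  assumes "finite_in M K" "a \<in> Dom M" "a \<notin> K"
  shows "finite_in M (insert a K)"
proof -
  obtain n g where n: "n \<in> omega M" and g: "fun_on M g (ext M n) K" "bij_betw (app M g) (ext M n) K"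
    using assms(1) unfolding finite_in_def by blast
  have nD: "n \<in> Dom M" and gD: "g \<in> Dom M" "K \<subseteq> Dom M" using n fun_on_Dom[OF g(1)] by auto
  have nn: "n \<notin> ext M n" using not_in_self nD by blast
  define F where "F k = (if k = n then a else app M g k)" for k
  obtain f where f: "fun_on M f (ext M (suc n)) (insert a K)"
    "\<And>k. k \<in> ext M (suc n) \<Longrightarrow> app M f k = F k"
  proof (rule make_fun[where K="ext M (suc n)" and F=F and L="insert a K" and ps="[n, a, g]"
        and R="\<lambda>x y. if x = n then y = a else rel M g x y"])
    show "(if k = n then y = a else rel M g k y) \<longleftrightarrow> y = F k" if "k \<in> ext M (suc n)" for k y
      using that nD rel_iff_app[OF g(1)] by (auto simp: F_def)
    show "F ` ext M (suc n) \<subseteq> insert a K" using app_in[OF g(1)] nD by (auto simp: F_def)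
  qed (use nD assms(2) gD small_ext[of "suc n"] in \<open>auto intro!: dfn_intro\<close>)
  have "bij_betw F (ext M n) K \<longleftrightarrow> bij_betw (app M g) (ext M n) K"
    by (rule bij_betw_cong) (use nn in \<open>auto simp: F_def\<close>)
  moreover have "bij_betw F {n} {a}" by (simp add: F_def bij_betw_def)
  ultimately have "bij_betw F (ext M n \<union> {n}) (K \<union> {a})"
    using g(2) assms(3) by (intro bij_betw_combine) auto
  then have "bij_betw (app M f) (ext M (suc n)) (insert a K)"
    using bij_betw_cong[of "ext M (suc n)" "app M f" F] f(2) nD by simp
  then show ?thesis unfolding finite_in_def using f(1) omega_inductive(2)[OF n] by blast
qed

lemma finite_ext_omega:
  assumes "n \<in> omega M"
  shows "finite_in M (ext M n)"
proof -
  have "small (ext M n)" using assms by (simp add: small_ext)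
  then obtain f where "fun_on M f (ext M n) (ext M n)" "\<And>k. k \<in> ext M n \<Longrightarrow> app M f k = k"
    by (rule identity_fun[where L="ext M n"]) auto
  moreover from this have "bij_betw (app M f) (ext M n) (ext M n)"
    using bij_betw_cong[of "ext M n" "app M f" id] by simp
  ultimately show ?thesis unfolding finite_in_def using assms by blast
qed

lemma countable_small: "countable_in M K \<Longrightarrow> small K"
  unfolding countable_in_def using fun_on_small by blast

text \<open>The injection into \<open>omega M\<close> is the given one preceded by the inverse of
  \<open>F\<close>; inside the structure that inverse is read from the function \<open>f\<close>
  representing \<open>F\<close>.\<close>

lemma countable_image:
  assumes "countable_in M K" "dfn M ps (\<lambda>e. R (e 0) (e (Suc 0)))" "set ps \<subseteq> Dom M"
    and "\<And>x y. x \<in> K \<Longrightarrow> y \<in> Dom M \<Longrightarrow> R x y \<longleftrightarrow> y = F x" "F ` K \<subseteq> Dom M" "inj_on F K"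
  shows "countable_in M (F ` K)"
proof -
  obtain g where g: "fun_on M g K (omega M)" "inj_on (app M g) K"
    using assms(1) unfolding countable_in_def by blast
  define k where "k = mk K"
  have k: "k \<in> Dom M" "ext M k = K" using countable_small[OF assms(1)] by
    (auto simp: k_def mk_props)
  have gD: "g \<in> Dom M" and KD: "K \<subseteq> Dom M" using fun_on_Dom[OF g(1)] by auto
  obtain f where f: "fun_on M f K (F ` K)" "\<And>x. x \<in> K \<Longrightarrow> app M f x = F x"
    by (rule make_fun[OF countable_small[OF assms(1)] assms(2,3,4) subset_refl assms(5)]) auto
  have fD: "f \<in> Dom M" using fun_on_Dom[OF f(1)] by auto
  have inv: "the_inv_into K F (F x) = x" if "x \<in> K" for x
    using the_inv_into_f_f[OF assms(6) that] .
  define G where "G y = app M g (the_inv_into K F y)" for y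
  obtain h where h: "fun_on M h (F ` K) (omega M)" "\<And>y. y \<in> F ` K \<Longrightarrow> app M h y = G y"
  proof (rule make_fun[where K="F ` K" and F=G and L="omega M" and ps="[f, g, k]"
        and R="\<lambda>y z. \<exists>x\<in>ext M k. rel M f x y \<and> rel M g x z"])
    show "small (F ` K)" by (rule small_image[OF countable_small[OF assms(1)] assms(2,3,4)])
      (use assms(5) in auto)
    show "(\<exists>x\<in>ext M k. rel M f x y \<and> rel M g x z) \<longleftrightarrow> z = G y" if y: "y \<in> F ` K" for y z
    proof -
      obtain x where x: "x \<in> K" "y = F x" using y by blast
      have "rel M f x' y \<longleftrightarrow> x' = x" if "x' \<in> K" for x'
        using rel_iff_app[OF f(1) that] f(2)[OF that] x assms(6) that by (auto dest: inj_onD)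
      then show ?thesis unfolding k(2) G_def x(2) inv[OF x(1)]
        using x rel_iff_app[OF g(1) x(1)] by auto
    qed
    show "G ` F ` K \<subseteq> omega M" using app_in[OF g(1)] inv by (auto simp: G_def)
  qed (use gD fD k in \<open>auto intro!: dfn_intro\<close>)
  have "inj_on (app M h) (F ` K)"
  proof (rule inj_onI)
    fix y z assume yz: "y \<in> F ` K" "z \<in> F ` K" "app M h y = app M h z"
    then obtain u v where "u \<in> K" "y = F u" "v \<in> K" "z = F v" by blast
    then show "y = z" using yz h(2) inv inj_onD[OF g(2)] by (auto simp: G_def)
  qed
  then show ?thesis unfolding countable_in_def using h(1) by blast
qed

lemma finite_countable:
  assumes "finite_in M K"
  shows "countable_in M K"
proof -
  obtain n g where n: "n \<in> omega M" and g: "fun_on M g (ext M n) K" "bij_betw (app M g) (ext M n) K"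
    using assms unfolding finite_in_def by blast
  have gD: "g \<in> Dom M" "K \<subseteq> Dom M" using fun_on_Dom[OF g(1)] by auto
  have small: "small (ext M n)" using n by (simp add: small_ext)
  obtain f where "fun_on M f (ext M n) (omega M)" "\<And>k. k \<in> ext M n \<Longrightarrow> app M f k = k"
    by (rule identity_fun[OF small omega_ext_subset[OF n]]) auto
  then have "countable_in M (ext M n)"
    unfolding countable_in_def by (auto simp: inj_on_def)
  then have "countable_in M (app M g ` ext M n)"
  proof (rule countable_image[where ps="[g]" and R="rel M g"])
    show "dfn M [g] (\<lambda>e. rel M g (e 0) (e (Suc 0)))" using gD by (intro dfn_intro) auto
    show "app M g ` ext M n \<subseteq> Dom M" using app_in[OF g(1)] gD(2) by blast
  qed (use gD g(2) rel_iff_app[OF g(1)] in \<open>auto simp: bij_betw_def\<close>)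
  then show ?thesis using g(2) by (simp add: bij_betw_def)
qed

lemma countable_subset:
  assumes "countable_in M K" "L \<subseteq> K" "small L"
  shows "countable_in M L"
proof -
  obtain g where g: "fun_on M g K (omega M)" "inj_on (app M g) K"
    using assms(1) unfolding countable_in_def by blast
  have gD: "g \<in> Dom M" using fun_on_Dom[OF g(1)] by auto
  obtain f where f: "fun_on M f L (omega M)" "\<And>k. k \<in> L \<Longrightarrow> app M f k = app M g k"
  proof (rule make_fun[where K=L and F="app M g" and L="omega M" and ps="[g]" and R="rel M g"])
    show "app M g ` L \<subseteq> omega M" using app_in[OF g(1)] assms(2) by blast
    show "rel M g x y \<longleftrightarrow> y = app M g x" if "x \<in> L" for x y
      using rel_iff_app[OF g(1)] assms(2) that by blast
  qed (use gD assms(3) in \<open>auto intro!: dfn_intro\<close>)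
  have "inj_on (app M f) L"
    using inj_on_subset[OF g(2) assms(2)] inj_on_cong[of L "app M f" "app M g"] f(2) by blast
  then show ?thesis unfolding countable_in_def using f(1) by blast
qed

end

section \<open>Consequences of the axiom of choice\<close>

locale zfac_model = zfa_model +
  assumes ac: "axiom_of_choice M"
begin

lemma choice:
  assumes "small K" "\<And>y. y \<in> K \<Longrightarrow> ext M y \<noteq> {}"
  obtains f where "fun_on M f K (\<Union>y\<in>K. ext M y)" "\<And>y. y \<in> K \<Longrightarrow> app M f y \<in> ext M y"
proof -
  have "mk K \<in> Dom M" using assms(1) by (rule mk_in)
  then have "(\<forall>y\<in>ext M (mk K). ext M y \<noteq> {}) \<longrightarrow>
        (\<exists>f. fun_on M f (ext M (mk K)) (\<Union>y\<in>ext M (mk K). ext M y) \<and>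
             (\<forall>y\<in>ext M (mk K). app M f y \<in> ext M y))"
    using ac unfolding axiom_of_choice_def by (rule bspec[rotated])
  then show ?thesis using assms(2) that unfolding ext_mk[OF assms(1)] by blast
qed

text \<open>The axiom selects from a family of nonempty sets. It is applied to the sets
  \<open>{y \<in> K. R x y}\<close>, and the selector is then composed with the map taking
  \<open>x\<close> to its set; \<open>Q\<close> is the definable graph of that map.\<close>

lemma choice_rel:
  assumes X: "small X" and K: "small K" and R: "dfn M ps (\<lambda>e. R (e 0) (e (Suc 0)))" "set ps \<subseteq> Dom M"
    and ex: "\<And>x. x \<in> X \<Longrightarrow> \<exists>y\<in>K. R x y"
  obtains f where "fun_on M f X K" "\<And>x. x \<in> X \<Longrightarrow> R x (app M f x)"
proof -
  define k where "k = mk K"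
  have k: "k \<in> Dom M" "ext M k = K" using K by (auto simp: k_def mk_props)
  have D: "X \<subseteq> Dom M" "K \<subseteq> Dom M" using X K small_Dom by auto
  have sm: "small {y \<in> K. R x y}" if "x \<in> X" for x
  proof (rule sep[where ps="x # ps", OF K])
    show "dfn M (x # ps) (\<lambda>e. R x (e 0))"
      by (rule dfn_subst2[OF dfn_Cons[OF R(1)]]) (use that D in \<open>auto intro!: dfn_intro\<close>)
  qed (use that D R(2) in auto)
  define F where "F x = mk {y \<in> K. R x y}" for x
  have F: "is_set M (F x)" "ext M (F x) = {y \<in> K. R x y}" if "x \<in> X" for x
    unfolding F_def using mk_props[OF sm[OF that]] by auto
  define Q where "Q x P \<longleftrightarrow> is_set M P \<and> (\<forall>y\<in>Dom M. y \<in> ext M P \<longleftrightarrow> y \<in> ext M k \<and> R x y)" for x P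
  have Q: "Q x P \<longleftrightarrow> P = F x" if "x \<in> X" for x P
  proof -
    have "(\<forall>y\<in>Dom M. y \<in> ext M P \<longleftrightarrow> y \<in> K \<and> R x y) \<longleftrightarrow> ext M P = {y \<in> K. R x y}" using D(2) by blast
    then show ?thesis unfolding Q_def k(2) using F[OF that] mk_eq[of P "{y \<in> K. R x y}"] by
      (auto simp: F_def)
  qed
  have dQ: "dfn M (c # k # ps) (\<lambda>e. Q (e 0) (e (Suc 0)))" for c
    unfolding Q_def by (intro dfn_intro dfn_subst2[OF dfn_Cons[OF dfn_Cons[OF R(1)]]])
      (simp add: k(1))
  have small_F: "small (F ` X)"
    by (rule small_image[OF X dQ[of k]]) (use k(1) R(2) Q F is_setD in auto)
  have "ext M P \<noteq> {}" if "P \<in> F ` X" for P using that F(2) ex by force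
  then obtain c where c: "fun_on M c (F ` X) (\<Union>P\<in>F ` X. ext M P)"
    "\<And>P. P \<in> F ` X \<Longrightarrow> app M c P \<in> ext M P"
    using choice[OF small_F] by metis
  have good: "app M c (F x) \<in> K \<and> R x (app M c (F x))" if "x \<in> X" for x
    using c(2)[of "F x"] that F(2)[OF that] by blast
  have cD: "c \<in> Dom M" using fun_on_Dom[OF c(1)] by blast
  obtain f where "fun_on M f X K" "\<And>x. x \<in> X \<Longrightarrow> app M f x = app M c (F x)"
  proof (rule make_fun[where K=X and L=K and F="\<lambda>x. app M c (F x)" and ps="c # k # ps"
      and R="\<lambda>x y. \<exists>P\<in>Dom M. Q x P \<and> rel M c P y", OF X])
    show "dfn M (c # k # ps) (\<lambda>e. \<exists>P\<in>Dom M. Q (e 0) P \<and> rel M c P (e (Suc 0)))"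
      by (rule dfn_ex, rule dfn_conj, rule dfn_subst2[OF dQ]) (use cD in \<open>auto intro!: dfn_intro\<close>)
    show "(\<exists>P\<in>Dom M. Q x P \<and> rel M c P y) \<longleftrightarrow> y = app M c (F x)" if "x \<in> X" for x y
      using Q[OF that] F(1)[OF that] rel_iff_app[OF c(1), of "F x"] that by auto
  qed (use cD k(1) R(2) good D in auto)
  then show thesis using good by (intro that) auto
qed

text \<open>Two disjoint sequences at once, so that a set and its complement are seen to be infinite.\<close>

lemma infinite_split:
  assumes K: "small K" "\<not> finite_in M K"
  obtains x y where "fun_on M x (omega M) K" "fun_on M y (omega M) K"
    "inj_on (app M x) (omega M)" "inj_on (app M y) (omega M)"
    "\<And>m n. m \<in> omega M \<Longrightarrow> n \<in> omega M \<Longrightarrow> app M x m \<noteq> app M y n"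
proof -
  define k where "k = mk K"
  have k: "k \<in> Dom M" "ext M k = K" using K(1) by (auto simp: k_def mk_props)
  have KD: "K \<subseteq> Dom M" by (rule small_Dom[OF K(1)])
  \<comment> \<open>The finite subsets of \<open>K\<close>. As \<open>K\<close> is not finite, each
    misses a point \<open>p F\<close> and, once that is added, a second point \<open>q F\<close>;
    choice selects both. Adding them maps \<open>X\<close> into itself, and this map is iterated
    from the empty set.\<close>
  define X where "X = {F \<in> {y. is_set M y \<and> ext M y \<subseteq> K}. finite_in M (ext M F)}"
  have X: "small X"
    unfolding X_def by (rule sep[OF small_Pow[OF K(1)], of "[]"]) (intro dfn_intro, simp)
  have XD: "X \<subseteq> Dom M" by (rule small_Dom[OF X])
  have more: "\<exists>x\<in>K. x \<notin> S" if "finite_in M S" "S \<subseteq> K" for S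
  proof (rule ccontr)
    assume "\<not> ?thesis"
    then have "S = K" using that(2) by blast
    then show False using that(1) K(2) by simp
  qed
  have "\<exists>x\<in>K. x \<notin> ext M F" if "F \<in> X" for F using more that by (auto simp: X_def)
  then obtain fp where fp: "fun_on M fp X K" "\<And>F. F \<in> X \<Longrightarrow> app M fp F \<notin> ext M F"
    by (rule choice_rel[OF X K(1), where ps="[]" and R="\<lambda>F x. x \<notin> ext M F", rotated 2])
      (auto intro!: dfn_intro)
  have fpD: "fp \<in> Dom M" using fun_on_Dom[OF fp(1)] by blast
  define p where "p F = app M fp F" for F
  have p: "p F \<in> K - ext M F" if "F \<in> X" for F using fp that app_in[OF fp(1) that] by
    (auto simp: p_def)
  have fin: "finite_in M (insert (p F) (ext M F))" "ext M F \<subseteq> K" if F: "F \<in> X" for F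
    using F p[OF F] KD by (auto simp: X_def intro!: finite_insert)
  have "\<exists>x\<in>K. x \<notin> ext M F \<and> \<not> rel M fp F x" if "F \<in> X" for F
    using more[OF fin(1)[OF that]] p[OF that] fin(2)[OF that] rel_iff_app[OF fp(1) that] by
      (auto simp: p_def)
  then obtain fq where fq: "fun_on M fq X K" "\<And>F. F \<in> X \<Longrightarrow> app M fq F \<notin> ext M F
    \<and> \<not> rel M fp F (app M fq F)"
    by (rule choice_rel[OF X K(1), where ps="[fp]" and R="\<lambda>F x. x \<notin> ext M F
      \<and> \<not> rel M fp F x", rotated 2])
      (use fpD in \<open>auto intro!: dfn_intro\<close>)
  have fqD: "fq \<in> Dom M" using fun_on_Dom[OF fq(1)] by blast
  define q where "q F = app M fq F" for F
  have q: "q F \<in> K - ext M F - {p F}" if "F \<in> X" for F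
    using fq(2)[OF that] app_in[OF fq(1) that] rel_iff_app[OF fp(1) that] by
      (auto simp: p_def q_def)
  define G where "G F = mk (insert (q F) (insert (p F) (ext M F)))" for F
  have smG: "small (insert (q F) (insert (p F) (ext M F)))" if "F \<in> X" for F
    using p[OF that] q[OF that] that XD KD by (intro small_insert small_ext) auto
  have GX: "G F \<in> X" if "F \<in> X" for F
  proof -
    have F: "is_set M F" "F \<in> Dom M" "ext M F \<subseteq> K" "finite_in M (ext M F)" using that by
      (auto simp: X_def)
    have "finite_in M (insert (q F) (insert (p F) (ext M F)))"
      by (intro finite_insert fin(1) that) (use p[OF that] q[OF that] KD in auto)
    then show ?thesis using p[OF that] q[OF that] F(3) is_set_mk[OF smG[OF that]]
      unfolding X_def G_def by (auto simp: ext_mk[OF smG[OF that]])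
  qed
  obtain g where g: "fun_on M g X X" "\<And>F. F \<in> X \<Longrightarrow> app M g F = G F"
  proof (rule make_fun[where K=X and F=G and L=X and ps="[fp, fq]"
      and R="\<lambda>F H. is_set M H \<and> (\<exists>y\<in>Dom M. \<exists>z\<in>Dom M. rel M fp F y \<and> rel M fq F z
        \<and> ext M H = insert z (insert y (ext M F)))"])
    show "is_set M H \<and> (\<exists>y\<in>Dom M. \<exists>z\<in>Dom M. rel M fp F y \<and> rel M fq F z
      \<and> ext M H = insert z (insert y (ext M F)))
      \<longleftrightarrow> H = G F" if F: "F \<in> X" for F H
    proof -
      have D: "p F \<in> Dom M" "q F \<in> Dom M" using p[OF F] q[OF F] KD by auto
      have "rel M fp F y \<longleftrightarrow> y = p F" "rel M fq F y \<longleftrightarrow> y = q F" for y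
        using rel_iff_app[OF fp(1) F] rel_iff_app[OF fq(1) F] by (simp_all add: p_def q_def)
      then show ?thesis
        using mk_eq[of H] is_set_mk[OF smG[OF F]] ext_mk[OF smG[OF F]] D unfolding G_def by auto
    qed
  qed (use X XD fpD fqD GX in \<open>auto intro!: dfn_intro\<close>)
  have "zero_in M \<in> X" unfolding X_def using finite_empty by simp
  from omega_rec[OF g(1) this] obtain h where h: "fun_on M h (omega M) X"
    "\<And>n. n \<in> omega M \<Longrightarrow> app M h (suc n) = app M g (app M h n)" by blast
  have hD: "h \<in> Dom M" using fun_on_Dom[OF h(1)] by blast
  have hX: "app M h n \<in> X" if "n \<in> omega M" for n using app_in[OF h(1) that] .
  have h_suc: "ext M (app M h (suc n)) = insert (q (app M h n)) (insert (p (app M h n)) (ext M (app M h n)))"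
    if "n \<in> omega M" for n
    using h(2)[OF that] g(2)[OF hX[OF that]] ext_mk[OF smG[OF hX[OF that]]] by (simp add: G_def)
  have mono: "w \<in> ext M (app M h n)"
    if n: "n \<in> omega M" and m: "m \<in> ext M n" and w: "w \<in> ext M (app M h (suc m))" for m n w
  proof -
    have rel_h: "(\<exists>v\<in>Dom M. rel M h n v \<and> w \<in> ext M v) \<longleftrightarrow> w \<in> ext M (app M h n)" if "n \<in> omega M"
      for n
      using rel_iff_app[OF h(1) that] app_Dom[OF h(1) that] by auto
    have "m \<in> ext M n \<longrightarrow> (\<exists>v\<in>Dom M. rel M h n v \<and> w \<in> ext M v)"
    proof (rule omega_induct[where ps="[h, m, w]", OF n])
      fix n
      assume n: "n \<in> omega M" "m \<in> ext M n \<longrightarrow> (\<exists>v\<in>Dom M. rel M h n v \<and> w \<in> ext M v)"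
      then show "m \<in> ext M (suc n) \<longrightarrow> (\<exists>v\<in>Dom M. rel M h (suc n) v \<and> w \<in> ext M v)"
        unfolding rel_h[OF n(1)] rel_h[OF omega_inductive(2)[OF n(1)]] using w h_suc[OF n(1)]
          by auto
    qed (use hD m w in \<open>auto intro!: dfn_intro\<close>)
    then show ?thesis using m rel_h[OF n] by blast
  qed
  have step: "app M f (app M h n) \<in> K" if "fun_on M f X K" "n \<in> omega M" for f n
    using app_in[OF that(1) hX[OF that(2)]] .
  have comp: "\<exists>x. fun_on M x (omega M) K \<and> (\<forall>n\<in>omega M. app M x n = app M f (app M h n))"
    if f: "fun_on M f X K" for f
  proof -
    have fD: "f \<in> Dom M" using fun_on_Dom[OF f] by blast
    obtain x where "fun_on M x (omega M) K" "\<And>n. n \<in> omega M \<Longrightarrow> app M x n = app M f (app M h n)"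
    proof (rule make_fun[where K="omega M" and F="\<lambda>n. app M f (app M h n)" and L=K and ps="[f, h]"
        and R="\<lambda>n x. \<exists>u\<in>Dom M. rel M h n u \<and> rel M f u x"])
      show "(\<exists>u\<in>Dom M. rel M h n u \<and> rel M f u x) \<longleftrightarrow> x = app M f (app M h n)" if "n \<in> omega M"
        for n x
        using rel_iff_app[OF h(1) that] rel_iff_app[OF f hX[OF that]] hX[OF that] XD by auto
    qed (use small_omega KD fD hD step[OF f] in \<open>auto intro!: dfn_intro\<close>)
    then show ?thesis by blast
  qed
  obtain x where x: "fun_on M x (omega M) K" "\<And>n. n \<in> omega M \<Longrightarrow> app M x n = p (app M h n)"
    using comp[OF fp(1)] by (auto simp: p_def)
  obtain y where y: "fun_on M y (omega M) K" "\<And>n. n \<in> omega M \<Longrightarrow> app M y n = q (app M h n)"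
    using comp[OF fq(1)] by (auto simp: q_def)
  \<comment> \<open>Stage \<open>n\<close> already contains both points chosen at any earlier stage
    \<open>m\<close>, whereas the points chosen at stage \<open>n\<close> lie outside it.\<close>
  have apart: "{app M x m, app M y m} \<inter> {app M x n, app M y n} = {}"
    if "m \<in> omega M" "n \<in> omega M" "m \<in> ext M n" for m n
    using mono[OF that(2,3)] h_suc[OF that(1)] p[OF hX[OF that(2)]] q[OF hX[OF that(2)]] x(2) y(2) that
    by auto
  show thesis
  proof (rule that[OF x(1) y(1)])
    show "inj_on (app M x) (omega M)"
      by (rule inj_onI) (use apart omega_linear in blast)
    show "inj_on (app M y) (omega M)"
      by (rule inj_onI) (use apart omega_linear in blast)
    fix m n assume mn: "m \<in> omega M" "n \<in> omega M"
    consider "m \<in> ext M n" | "m = n" | "n \<in> ext M m" using omega_linear[OF mn] by blast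
    then show "app M x m \<noteq> app M y n"
    proof cases
      case 2
      then show ?thesis using q[OF hX[OF mn(1)]] x(2) y(2) mn by auto
    qed (use apart mn in blast)+
  qed
qed

text \<open>\<open>infinite_split\<close> applied to \<open>omega M\<close> yields two injections
  with disjoint ranges, which play the role of the even and the odd numbers and save doing
  arithmetic in the structure.\<close>

lemma countable_Un:
  assumes "countable_in M K" "countable_in M L"
  shows "countable_in M (K \<union> L)"
proof -
  obtain g h where g: "fun_on M g K (omega M)" "inj_on (app M g) K"
    and h: "fun_on M h L (omega M)" "inj_on (app M h) L"
    using assms unfolding countable_in_def by blast
  from infinite_split[OF small_omega omega_infinite] obtain x y where
    x: "fun_on M x (omega M) (omega M)" "inj_on (app M x) (omega M)" and
    y: "fun_on M y (omega M) (omega M)" "inj_on (app M y) (omega M)" and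
    xy: "\<And>m n. m \<in> omega M \<Longrightarrow> n \<in> omega M \<Longrightarrow> app M x m \<noteq> app M y n" by metis
  define F where "F a = (if a \<in> K then app M x (app M g a) else app M y (app M h a))" for a
  define k where "k = mk K"
  have k: "k \<in> Dom M" "ext M k = K" using countable_small[OF assms(1)] by
    (auto simp: k_def mk_props)
  have D: "g \<in> Dom M" "h \<in> Dom M" "x \<in> Dom M" "y \<in> Dom M"
    using fun_on_Dom g(1) h(1) x(1) y(1) by blast+
  note gw = app_in[OF g(1)] and hw = app_in[OF h(1)]
  obtain f where f: "fun_on M f (K \<union> L) (omega M)" "\<And>a. a \<in> K \<union> L \<Longrightarrow> app M f a = F a"
  proof (rule make_fun[where K="K \<union> L" and F=F and L="omega M" and ps="[k, g, h, x, y]" and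
      R="\<lambda>a z. if a \<in> ext M k then \<exists>u\<in>Dom M. rel M g a u \<and> rel M x u z else \<exists>u\<in>Dom M. rel M h a u
        \<and> rel M y u z"])
    show "small (K \<union> L)" using assms by (intro small_Un countable_small)
    show "(if a \<in> ext M k then \<exists>u\<in>Dom M. rel M g a u \<and> rel M x u z else \<exists>u\<in>Dom M. rel M h a u
      \<and> rel M y u z)
        \<longleftrightarrow> z = F a" if "a \<in> K \<union> L" for a z
      using that rel_iff_app[OF g(1)] rel_iff_app[OF h(1)] rel_iff_app[OF x(1) gw] rel_iff_app[OF y(1) hw]
        app_Dom[OF g(1)] app_Dom[OF h(1)] unfolding F_def k(2) by auto
    show "F ` (K \<union> L) \<subseteq> omega M" using app_in[OF x(1) gw] app_in[OF y(1) hw] by (auto simp: F_def)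
  qed (use k D in \<open>auto intro!: dfn_intro\<close>)
  have "inj_on F (K \<union> L)"
  proof (rule inj_onI)
    fix a b assume ab: "a \<in> K \<union> L" "b \<in> K \<union> L" "F a = F b"
    consider "a \<in> K" "b \<in> K" | "a \<in> K" "b \<in> L" "b \<notin> K" | "a \<in> L" "a \<notin> K" "b \<in> K" | "a \<in> L" "a \<notin> K"
      "b \<in> L" "b \<notin> K"
      using ab(1,2) by blast
    then show "a = b"
    proof cases
      case 1
      then have "app M g a = app M g b" using ab(3) inj_onD[OF x(2)] gw by (simp add: F_def)
      then show ?thesis using 1 inj_onD[OF g(2)] by blast
    next
      case 2
      then show ?thesis using ab(3) xy[OF gw hw] by (simp add: F_def)
    next
      case 3
      then show ?thesis using ab(3) xy[OF gw hw, of b a] by (simp add: F_def)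
    next
      case 4
      then have "app M h a = app M h b" using ab(3) inj_onD[OF y(2)] hw by (simp add: F_def)
      then show ?thesis using 4 inj_onD[OF h(2)] by blast
    qed
  qed
  then have "inj_on (app M f) (K \<union> L)" using inj_on_cong[of "K \<union> L" "app M f" F] f(2) by blast
  then show ?thesis unfolding countable_in_def using f(1) by blast
qed

end

context zfa_model
begin

subsection \<open>The well-founded part\<close>

lemma dfn_trans_set [dfn_intro]:
  assumes "trm M ps t"
  shows "dfn M ps (\<lambda>e. trans_set M (t e))"
  unfolding trans_set_def by (intro dfn_intro trm_shift[OF assms])

lemma dfn_trans_closure [dfn_intro]:
  assumes "trm M ps s" "trm M ps t"
  shows "dfn M ps (\<lambda>e. is_trans_closure M (s e) (t e))"
proof -
  have "dfn M ps (\<lambda>e. trans_set M (t e) \<and> s e \<in> ext M (t e) \<and>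
     (\<forall>T\<in>Dom M. trans_set M T \<longrightarrow> s e \<in> ext M T \<longrightarrow> ext M (t e) \<subseteq> ext M T))"
    by (intro dfn_intro trm_shift[OF assms(1)] trm_shift[OF assms(2)])
  then show ?thesis
    by (rule dfn_cong) (auto simp: is_trans_closure_def trans_set_def)
qed

definition grounded :: "'v set" where
  "grounded = {x \<in> Dom M. \<exists>T\<in>Dom M. trans_set M T \<and> x \<in> ext M T}"

lemma dcl_grounded [dfn_intro]: "dcl M ps (\<lambda>e. grounded)"
  unfolding grounded_def by (intro dfn_intro)

lemma grounded_Dom [simp, dest]: "x \<in> grounded \<Longrightarrow> x \<in> Dom M"
  by (simp add: grounded_def)

lemma trans_set_grounded: "trans_set M T \<Longrightarrow> x \<in> ext M T \<Longrightarrow> x \<in> grounded"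
  unfolding grounded_def trans_set_def by blast

lemma groundedE:
  assumes "x \<in> grounded"
  obtains T where "trans_set M T" "x \<in> ext M T"
  using assms unfolding grounded_def by blast

lemma grounded_ext: "x \<in> grounded \<Longrightarrow> y \<in> ext M x \<Longrightarrow> y \<in> grounded"
  by (erule groundedE) (meson trans_set_def trans_set_grounded subsetD)

text \<open>The counterexamples inside a transitive set containing \<open>x\<close> form a set by
  Separation, and a minimal one given by Foundation contradicts the step, because its elements stay
  in the transitive set.\<close>

lemma eps_induct:
  assumes "x \<in> grounded" "dfn M ps (\<lambda>e. P (e 0))" "set ps \<subseteq> Dom M"
    and step: "\<And>x. x \<in> grounded \<Longrightarrow> (\<And>y. y \<in> ext M x \<Longrightarrow> P y) \<Longrightarrow> P x"
  shows "P x"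
proof (rule ccontr)
  assume "\<not> P x"
  obtain T where T: "trans_set M T" "x \<in> ext M T" using assms(1) by (rule groundedE)
  have "small {y \<in> ext M T. \<not> P y}"
    by (rule sep[OF small_ext dfn_not[OF assms(2)] assms(3)]) (use T in \<open>auto simp: trans_set_def\<close>)
  moreover have "{y \<in> ext M T. \<not> P y} \<noteq> {}" using \<open>\<not> P x\<close> T by blast
  ultimately obtain y where y: "y \<in> {y \<in> ext M T. \<not> P y}" "ext M y \<inter> {y \<in> ext M T. \<not> P y} = {}"
    by (rule foundation)
  have "ext M y \<subseteq> ext M T" using T y(1) unfolding trans_set_def by blast
  then have "P z" if "z \<in> ext M y" for z using that y(2) by blast
  then have "P y" using step trans_set_grounded[OF T(1)] y(1) by blast
  then show False using y(1) by blast
qed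

text \<open>The intersection of all transitive sets containing \<open>x\<close> is formed inside one
  of them, which exists because \<open>x\<close> is grounded.\<close>

lemma trans_closure_exists:
  assumes "x \<in> grounded"
  obtains T where "is_trans_closure M x T"
proof -
  obtain T where T: "trans_set M T" "x \<in> ext M T" using assms by (rule groundedE)
  define K where "K = {y \<in> ext M T. \<forall>S\<in>Dom M. trans_set M S \<longrightarrow> x \<in> ext M S \<longrightarrow> y \<in> ext M S}"
  have K: "small K"
    unfolding K_def
  proof (rule sep[where ps="[x]"])
    show "dfn M [x] (\<lambda>e. \<forall>S\<in>Dom M. trans_set M S \<longrightarrow> x \<in> ext M S \<longrightarrow> e 0 \<in> ext M S)"
      using assms by (intro dfn_intro) auto
  qed (use T assms small_ext in \<open>auto simp: trans_set_def\<close>)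
  have "trans_set M (mk K)"
    unfolding trans_set_def ext_mk[OF K]
  proof (intro conjI ballI)
    fix y assume "y \<in> K"
    then show "ext M y \<subseteq> K" using T(1) unfolding K_def trans_set_def by blast
  qed (rule is_set_mk[OF K])
  moreover have "x \<in> ext M (mk K)" unfolding ext_mk[OF K] using T by (auto simp: K_def)
  moreover have "ext M (mk K) \<subseteq> ext M S" if "trans_set M S" "x \<in> ext M S" for S
    unfolding ext_mk[OF K] using that by (auto simp: K_def trans_set_def)
  ultimately have "is_trans_closure M x (mk K)" unfolding is_trans_closure_def by blast
  then show thesis by (rule that)
qed

text \<open>Picking a transitive set around each element of \<open>x\<close> would take choice, but
  transitive closures are unique, so Replacement collects them. Their union together with
  \<open>x\<close> is transitive.\<close>

lemma grounded_setI:
  assumes "is_set M x" "ext M x \<subseteq> grounded"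
  shows "x \<in> grounded"
proof -
  have xD: "x \<in> Dom M" using assms(1) by blast
  define K where "K = {T \<in> Dom M. \<exists>y\<in>ext M x. is_trans_closure M y T}"
  have "small K"
    unfolding K_def
  proof (rule repl[where ps="[]", OF small_ext[OF xD]])
    show "dfn M [] (\<lambda>e. is_trans_closure M (e 0) (e (Suc 0)))" by (intro dfn_intro)
    fix y S T assume "is_trans_closure M y S" "is_trans_closure M y T"
    then show "S = T" unfolding is_trans_closure_def trans_set_def
      by (meson is_set_eqI subset_antisym)
  qed simp
  then have sm: "small (insert x (\<Union>T\<in>K. ext M T))" by (intro small_insert xD small_UN)
  have sub: "ext M x \<subseteq> (\<Union>T\<in>K. ext M T)"
  proof
    fix y assume y: "y \<in> ext M x"
    then obtain T where T: "is_trans_closure M y T" using assms(2) trans_closure_exists by blast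
    then have "T \<in> K" "y \<in> ext M T" using y unfolding K_def is_trans_closure_def trans_set_def
      by auto
    then show "y \<in> (\<Union>T\<in>K. ext M T)" by blast
  qed
  have "trans_set M (mk (insert x (\<Union>T\<in>K. ext M T)))"
    unfolding trans_set_def ext_mk[OF sm]
  proof (intro conjI ballI)
    fix y assume "y \<in> insert x (\<Union>T\<in>K. ext M T)"
    then consider "y = x" | T where "T \<in> K" "y \<in> ext M T" by blast
    then show "ext M y \<subseteq> insert x (\<Union>T\<in>K. ext M T)"
    proof cases
      case 2
      then have "trans_set M T" unfolding K_def is_trans_closure_def by blast
      then have "ext M y \<subseteq> ext M T" using 2(2) unfolding trans_set_def by blast
      then show ?thesis using 2(1) by blast
    qed (use sub in blast)
  qed (rule is_set_mk[OF sm])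
  moreover have "x \<in> ext M (mk (insert x (\<Union>T\<in>K. ext M T)))" unfolding ext_mk[OF sm] by blast
  ultimately show ?thesis by (rule trans_set_grounded)
qed

lemma atoms_grounded: "a \<in> atoms M \<Longrightarrow> a \<in> grounded"
proof (rule trans_set_grounded[of "mk {a}"])
  assume a: "a \<in> atoms M"
  then have sm: "small {a}" by (intro small_singleton) blast
  show "trans_set M (mk {a})" "a \<in> ext M (mk {a})"
    unfolding trans_set_def ext_mk[OF sm] using is_set_mk[OF sm] ext_atom[OF a] by auto
qed

lemma AtomSet_grounded: "AtomSet M \<in> grounded"
  by (rule grounded_setI[OF is_set_AtomSet]) (use atoms_grounded in \<open>auto simp: atoms_def\<close>)

lemma omega_grounded: "n \<in> omega M \<Longrightarrow> n \<in> grounded"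
proof (rule omega_induct[where ps="[]" and P="\<lambda>n. n \<in> grounded"])
  show "zero_in M \<in> grounded" by (rule grounded_setI) auto
  show "suc n \<in> grounded" if "n \<in> omega M" "n \<in> grounded" for n
    by (rule grounded_setI) (use that grounded_ext[OF that(2)] in auto)
qed (auto intro!: dfn_intro)


subsection \<open>The action of permutations\<close>

lemma dcl_perms [dfn_intro]: "dcl M ps (\<lambda>e. perms M)"
proof -
  have "perms M = {\<pi> \<in> Dom M. fun_on M \<pi> (atoms M) (atoms M)
    \<and> bij_betw (app M \<pi>) (atoms M) (atoms M)}"
    using fun_on_Dom unfolding perms_def by blast
  moreover have "dcl M ps (\<lambda>e. {\<pi> \<in> Dom M. fun_on M \<pi> (atoms M) (atoms M) \<and>
      bij_betw (app M \<pi>) (atoms M) (atoms M)})"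
    by (rule dcl_collect[OF dcl_Dom], rule dfn_bijection) (intro dfn_intro)+
  ultimately show ?thesis by simp
qed

lemma perms_fun: "\<pi> \<in> perms M \<Longrightarrow> fun_on M \<pi> (atoms M) (atoms M)"
  and perms_bij: "\<pi> \<in> perms M \<Longrightarrow> bij_betw (app M \<pi>) (atoms M) (atoms M)"
  by (auto simp: perms_def)

lemma perms_Dom [simp, dest]: "\<pi> \<in> perms M \<Longrightarrow> \<pi> \<in> Dom M"
  using perms_fun fun_on_Dom by blast

lemma perms_app [simp]: "\<pi> \<in> perms M \<Longrightarrow> a \<in> atoms M \<Longrightarrow> app M \<pi> a \<in> atoms M"
  using app_in[OF perms_fun] .

lemma perms_rel: "\<pi> \<in> perms M \<Longrightarrow> a \<in> atoms M \<Longrightarrow> rel M \<pi> a b \<longleftrightarrow> b = app M \<pi> a"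
  using rel_iff_app[OF perms_fun] .

lemma perms_eqI:
  assumes "\<pi> \<in> perms M" "\<rho> \<in> perms M" "\<And>a. a \<in> atoms M \<Longrightarrow> app M \<pi> a = app M \<rho> a"
  shows "\<pi> = \<rho>"
  by (rule fun_on_eqI[OF perms_fun[OF assms(1)] perms_fun[OF assms(2)] assms(3)])

lemma small_perms: "small (perms M)"
proof -
  have "small {\<pi> \<in> {f. fun_on M f (atoms M) (atoms M)}. \<pi> \<in> perms M}"
    by (rule sep[of _ "[]"]) (intro small_funs small_atoms dfn_intro, intro dfn_intro, simp)
  moreover have "{\<pi> \<in> {f. fun_on M f (atoms M) (atoms M)}. \<pi> \<in> perms M} = perms M"
    using perms_fun by blast
  ultimately show ?thesis by simp
qed

lemma perms_of_bij:
  assumes "dfn M ps (\<lambda>e. R (e 0) (e (Suc 0)))" "set ps \<subseteq> Dom M"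
    and "\<And>a b. a \<in> atoms M \<Longrightarrow> b \<in> Dom M \<Longrightarrow> R a b \<longleftrightarrow> b = F a" and F: "bij_betw F (atoms M) (atoms M)"
  obtains \<pi> where "\<pi> \<in> perms M" "\<And>a. a \<in> atoms M \<Longrightarrow> app M \<pi> a = F a"
proof -
  obtain f where f: "fun_on M f (atoms M) (atoms M)" "\<And>a. a \<in> atoms M \<Longrightarrow> app M f a = F a"
    by (rule make_fun[where L="atoms M", OF small_atoms assms(1,2,3)])
      (use bij_betw_imp_surj_on[OF F] in auto)
  then have "f \<in> perms M" using F bij_betw_cong[of "atoms M" "app M f" F] by (simp add: perms_def)
  then show thesis using f(2) by (rule that)
qed

lemma perms_compose:
  assumes "\<pi> \<in> perms M" "\<rho> \<in> perms M"
  obtains \<tau> where "\<tau> \<in> perms M" "\<And>a. a \<in> atoms M \<Longrightarrow> app M \<tau> a = app M \<pi> (app M \<rho> a)"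
proof (rule perms_of_bij[where F="app M \<pi> \<circ> app M \<rho>" and ps="[\<pi>, \<rho>]"
    and R="\<lambda>a c. \<exists>b\<in>Dom M. rel M \<rho> a b \<and> rel M \<pi> b c"])
  show "(\<exists>b\<in>Dom M. rel M \<rho> a b \<and> rel M \<pi> b c) \<longleftrightarrow> c = (app M \<pi> \<circ> app M \<rho>) a" if "a \<in> atoms M" for a c
    using that assms perms_rel atomsD[OF perms_app[OF assms(2) that]] by auto
  show "bij_betw (app M \<pi> \<circ> app M \<rho>) (atoms M) (atoms M)"
    by (rule bij_betw_trans[OF perms_bij[OF assms(2)] perms_bij[OF assms(1)]])
qed (use assms in \<open>auto intro!: dfn_intro\<close>)

lemma perms_identity:
  obtains \<iota> where "\<iota> \<in> perms M" "\<And>a. a \<in> atoms M \<Longrightarrow> app M \<iota> a = a"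
proof (rule perms_of_bij[where F="\<lambda>a. a" and ps="[]" and R="\<lambda>a b. b = a"])
  show "bij_betw (\<lambda>a. a) (atoms M) (atoms M)" by (simp add: bij_betw_def)
qed (auto intro!: dfn_intro)

lemma perms_inverse:
  assumes "\<pi> \<in> perms M"
  obtains \<rho> where "\<rho> \<in> perms M" "\<And>a. a \<in> atoms M \<Longrightarrow> app M \<rho> (app M \<pi> a) = a"
    "\<And>a. a \<in> atoms M \<Longrightarrow> app M \<pi> (app M \<rho> a) = a"
proof -
  let ?F = "the_inv_into (atoms M) (app M \<pi>)"
  have inj: "inj_on (app M \<pi>) (atoms M)" and im: "app M \<pi> ` atoms M = atoms M"
    using perms_bij[OF assms] by (auto simp: bij_betw_def)
  have F: "?F b \<in> atoms M" "app M \<pi> (?F b) = b" if "b \<in> atoms M" for b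
    using the_inv_into_into[OF inj, of b "atoms M"] f_the_inv_into_f[OF inj, of b] that im by auto
  obtain \<rho> where \<rho>: "\<rho> \<in> perms M" "\<And>a. a \<in> atoms M \<Longrightarrow> app M \<rho> a = ?F a"
  proof (rule perms_of_bij[where F="?F" and ps="[\<pi>]" and R="\<lambda>b a. a \<in> atoms M \<and> rel M \<pi> a b"])
    show "a \<in> atoms M \<and> rel M \<pi> a b \<longleftrightarrow> a = ?F b" if "b \<in> atoms M" for a b
      using that F perms_rel[OF assms] inj_onD[OF inj] by metis
    show "bij_betw ?F (atoms M) (atoms M)" by (rule bij_betw_the_inv_into[OF perms_bij[OF assms]])
  qed (use assms in \<open>auto intro!: dfn_intro\<close>)
  show thesis
    by (rule that[OF \<rho>(1)]) (use \<rho>(2) F assms the_inv_into_f_f[OF inj] in auto)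
qed

text \<open>The recursion behind \<^const>\<open>act\<close>, in terms of relations instead of \<^const>\<open>app\<close>, so that it is
  definable.\<close>

definition act_fun :: "'v \<Rightarrow> 'v \<Rightarrow> 'v \<Rightarrow> bool" where
  "act_fun \<pi> T g \<longleftrightarrow> trans_set M T \<and> fun_on M g (ext M T) (Dom M) \<and>
     (\<forall>z\<in>ext M T. \<forall>w\<in>Dom M. rel M g z w \<longrightarrow>
       (if z \<in> atoms M then rel M \<pi> z w
        else is_set M w \<and> (\<forall>v\<in>Dom M. v \<in> ext M w \<longleftrightarrow> (\<exists>u\<in>ext M z. rel M g u v))))"

definition act_rel :: "'v \<Rightarrow> 'v \<Rightarrow> 'v \<Rightarrow> bool" where
  "act_rel \<pi> x y \<longleftrightarrow> (\<exists>T\<in>Dom M. \<exists>g\<in>Dom M. act_fun \<pi> T g \<and> x \<in> ext M T \<and> rel M g x y)"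

lemma act_funD: "act_fun \<pi> T g \<Longrightarrow> trans_set M T" "act_fun \<pi> T g \<Longrightarrow> fun_on M g (ext M T) (Dom M)"
  unfolding act_fun_def by (elim conjE, assumption)+

lemma dfn_act_fun [dfn_intro]:
  assumes "trm M ps p" "trm M ps s" "trm M ps t"
  shows "dfn M ps (\<lambda>e. act_fun (p e) (s e) (t e))"
  unfolding act_fun_def
  by (intro dfn_intro trm_shift[OF assms(1)] trm_shift[OF assms(2)] trm_shift[OF assms(3)])

lemma dfn_act_rel [dfn_intro]:
  assumes "trm M ps p" "trm M ps s" "trm M ps t"
  shows "dfn M ps (\<lambda>e. act_rel (p e) (s e) (t e))"
  unfolding act_rel_def
  by (intro dfn_intro trm_shift[OF assms(1)] trm_shift[OF assms(2)] trm_shift[OF assms(3)])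

context
  fixes \<pi> assumes \<pi>: "\<pi> \<in> perms M"
begin

lemma act_fun_iff:
  "act_fun \<pi> T g \<longleftrightarrow> trans_set M T \<and> fun_on M g (ext M T) (Dom M) \<and>
     (\<forall>z\<in>ext M T. if z \<in> atoms M then app M g z = app M \<pi> z
        else is_set M (app M g z) \<and> ext M (app M g z) = app M g ` ext M z)"
proof (cases "trans_set M T \<and> fun_on M g (ext M T) (Dom M)")
  case True
  then have T: "trans_set M T" and g: "fun_on M g (ext M T) (Dom M)" by auto
  have "(\<forall>w\<in>Dom M. rel M g z w \<longrightarrow> (if z \<in> atoms M then rel M \<pi> z w
        else is_set M w \<and> (\<forall>v\<in>Dom M. v \<in> ext M w \<longleftrightarrow> (\<exists>u\<in>ext M z. rel M g u v)))) \<longleftrightarrow>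
      (if z \<in> atoms M then app M g z = app M \<pi> z
        else is_set M (app M g z) \<and> ext M (app M g z) = app M g ` ext M z)" if z: "z \<in> ext M T" for z
  proof -
    have sub: "ext M z \<subseteq> ext M T" using T z unfolding trans_set_def by blast
    have *: "rel M g u v \<longleftrightarrow> v = app M g u" if "u \<in> ext M T" for u v
      using rel_iff_app[OF g that] .
    have "(\<forall>v\<in>Dom M. v \<in> ext M w \<longleftrightarrow> (\<exists>u\<in>ext M z. rel M g u v)) \<longleftrightarrow> ext M w = app M g ` ext M z" for w
    proof -
      have "(\<exists>u\<in>ext M z. rel M g u v) \<longleftrightarrow> v \<in> app M g ` ext M z" for v using * sub by auto
      moreover have "app M g ` ext M z \<subseteq> Dom M" using app_in[OF g] sub by blast
      ultimately show ?thesis by auto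
    qed
    then show ?thesis using *[OF z] app_in[OF g z] perms_rel[OF \<pi>, of z] by simp
  qed
  then show ?thesis unfolding act_fun_def using True by simp
qed (auto simp: act_fun_def)

text \<open>The right-hand side repeats the description in \<open>act\<close> word for word, so that
  \<open>act\<close> becomes a definite description over a definable relation.\<close>

lemma act_rel_iff:
  "act_rel \<pi> x y \<longleftrightarrow> (\<exists>T g. trans_set M T \<and> x \<in> ext M T \<and> fun_on M g (ext M T) (Dom M) \<and>
     (\<forall>z\<in>ext M T. if z \<in> atoms M then app M g z = app M \<pi> z
        else is_set M (app M g z) \<and> ext M (app M g z) = app M g ` ext M z) \<and>
     y = app M g x)"
  (is "_ \<longleftrightarrow> (\<exists>T g. ?Q T g)")
proof -
  have "act_fun \<pi> T g \<and> x \<in> ext M T \<and> rel M g x y \<longleftrightarrow> ?Q T g" for T g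
    unfolding act_fun_iff using rel_iff_app[of g "ext M T" "Dom M" x y] by blast
  moreover have "T \<in> Dom M \<and> g \<in> Dom M" if "?Q T g" for T g
    using that fun_on_Dom[of g "ext M T" "Dom M"] unfolding trans_set_def by blast
  ultimately have "?Q T g \<longleftrightarrow> T \<in> Dom M \<and> g \<in> Dom M \<and> act_fun \<pi> T g \<and> x \<in> ext M T \<and> rel M g x y"
    for T g
    by (metis (no_types))
  then show ?thesis unfolding act_rel_def Bex_def by simp
qed

text \<open>Domains of partial solutions are transitive, so \<in>-induction applies to their common
  part: two solutions agreeing on the elements of \<open>z\<close> agree at
  \<open>z\<close>.\<close>

lemma act_fun_unique:
  assumes "act_fun \<pi> T g" "act_fun \<pi> T' g'" "x \<in> ext M T" "x \<in> ext M T'"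
  shows "app M g x = app M g' x"
proof -
  have T: "trans_set M T" "trans_set M T'"
    and g: "fun_on M g (ext M T) (Dom M)" "fun_on M g' (ext M T') (Dom M)"
    by (rule act_funD[OF assms(1)] act_funD[OF assms(2)])+
  have D: "T \<in> Dom M" "g \<in> Dom M" "T' \<in> Dom M" "g' \<in> Dom M"
    using T fun_on_Dom[OF g(1)] fun_on_Dom[OF g(2)] unfolding trans_set_def by auto
  define P where "P z \<longleftrightarrow> z \<in> ext M T \<longrightarrow> z \<in> ext M T' \<longrightarrow> (\<forall>w\<in>Dom M. rel M g z w \<longrightarrow> rel M g' z w)" for z
  have P_iff: "P z \<longleftrightarrow> (z \<in> ext M T \<longrightarrow> z \<in> ext M T' \<longrightarrow> app M g z = app M g' z)" for z
    unfolding P_def using rel_iff_app[OF g(1)] rel_iff_app[OF g(2)] app_in[OF g(1)] by auto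
  have "P x"
  proof (rule eps_induct[where ps="[T, g, T', g']"])
    show "x \<in> grounded" using trans_set_grounded[OF T(1) assms(3)] .
    show "dfn M [T, g, T', g'] (\<lambda>e. P (e 0))" unfolding P_def using D by (intro dfn_intro) auto
    fix z assume IH: "\<And>y. y \<in> ext M z \<Longrightarrow> P y"
    show "P z" unfolding P_iff
    proof (intro impI)
      assume z: "z \<in> ext M T" "z \<in> ext M T'"
      then have sub: "ext M z \<subseteq> ext M T" "ext M z \<subseteq> ext M T'" using T unfolding trans_set_def
        by blast+
      show "app M g z = app M g' z"
      proof (cases "z \<in> atoms M")
        case True
        then show ?thesis using assms(1,2) z unfolding act_fun_iff by auto
      next
        case False
        have "app M g ` ext M z = app M g' ` ext M z"
          using IH sub unfolding P_iff by (intro image_cong) auto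
        moreover have "is_set M (app M g z) \<and> ext M (app M g z) = app M g ` ext M z"
          "is_set M (app M g' z) \<and> ext M (app M g' z) = app M g' ` ext M z"
          using assms(1,2) z False unfolding act_fun_iff by auto
        ultimately show ?thesis by (intro is_set_eqI) auto
      qed
    qed
  qed (use D in auto)
  then show ?thesis unfolding P_iff using assms by blast
qed

lemma act_rel_unique:
  assumes "act_rel \<pi> x y" "act_rel \<pi> x z"
  shows "y = z"
proof -
  obtain T g where T: "act_fun \<pi> T g" "x \<in> ext M T" "rel M g x y" using assms(1)
    unfolding act_rel_def by blast
  obtain T' g' where T': "act_fun \<pi> T' g'" "x \<in> ext M T'" "rel M g' x z" using assms(2)
    unfolding act_rel_def by blast
  have "y = app M g x" "z = app M g' x"
    using rel_iff_app[OF act_funD(2)[OF T(1)] T(2)] T(3) rel_iff_app[OF act_funD(2)[OF T'(1)] T'(2)] T'(3)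
    by simp_all
  then show ?thesis using act_fun_unique[OF T(1) T'(1) T(2) T'(2)] by simp
qed

lemma act_eqI: "act_rel \<pi> x y \<Longrightarrow> act M \<pi> x = y"
  unfolding act_def act_rel_iff[symmetric] using act_rel_unique by blast

lemma act_rel_ext:
  assumes "act_rel \<pi> x y" "u \<in> ext M x"
  shows "\<exists>v\<in>Dom M. act_rel \<pi> u v"
proof -
  obtain T g where T: "act_fun \<pi> T g" "x \<in> ext M T" "T \<in> Dom M" "g \<in> Dom M"
    using assms(1) unfolding act_rel_def by blast
  have u: "u \<in> ext M T" using assms(2) T(2) act_funD(1)[OF T(1)] unfolding trans_set_def by blast
  have g: "fun_on M g (ext M T) (Dom M)" by (rule act_funD(2)[OF T(1)])
  have "rel M g u (app M g u)" using rel_iff_app[OF g u] by simp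
  then have "act_rel \<pi> u (app M g u)" unfolding act_rel_def using T u by blast
  then show ?thesis using app_in[OF g u] by blast
qed

lemma act_rel_step:
  assumes "act_rel \<pi> x y"
  shows "y \<in> Dom M" "x \<in> atoms M \<Longrightarrow> y = app M \<pi> x"
    "x \<notin> atoms M \<Longrightarrow> is_set M y \<and> ext M y = act M \<pi> ` ext M x"
proof -
  obtain T g where T: "act_fun \<pi> T g" "x \<in> ext M T" "rel M g x y" "T \<in> Dom M" "g \<in> Dom M"
    using assms unfolding act_rel_def by blast
  have g: "fun_on M g (ext M T) (Dom M)" and tr: "trans_set M T" by (rule act_funD[OF T(1)])+
  have y: "y = app M g x" using rel_iff_app[OF g T(2)] T(3) by simp
  show "y \<in> Dom M" using T(3) rel_Dom by blast
  show "x \<in> atoms M \<Longrightarrow> y = app M \<pi> x" using T(1,2) y unfolding act_fun_iff by auto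
  have "act M \<pi> u = app M g u" if "u \<in> ext M x" for u
  proof (rule act_eqI)
    have u: "u \<in> ext M T" using that tr T(2) unfolding trans_set_def by blast
    show "act_rel \<pi> u (app M g u)"
      unfolding act_rel_def using T(1,4,5) u rel_iff_app[OF g u] by blast
  qed
  then have "act M \<pi> ` ext M x = app M g ` ext M x" by simp
  then show "is_set M y \<and> ext M y = act M \<pi> ` ext M x" if "x \<notin> atoms M"
    using T(1,2) y that unfolding act_fun_iff by auto
qed

text \<open>If \<open>x\<close> were a minimal point without a value, the values on the part
  \<open>S\<close> of a transitive set where the action is defined could be extended to
  \<open>x\<close>. Taking all of \<open>S\<close>, and not just the elements of \<open>x\<close>,
  gives the extension a transitive domain.\<close>

lemma act_rel_exists:
  assumes "x \<in> grounded"
  shows "\<exists>y\<in>Dom M. act_rel \<pi> x y"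
proof (rule eps_induct[where ps="[\<pi>]", OF assms])
  fix x assume x: "x \<in> grounded" and IH: "\<And>z. z \<in> ext M x \<Longrightarrow> \<exists>y\<in>Dom M. act_rel \<pi> z y"
  show "\<exists>y\<in>Dom M. act_rel \<pi> x y"
  proof (rule ccontr)
    assume no: "\<not> (\<exists>y\<in>Dom M. act_rel \<pi> x y)"
    obtain T where T: "trans_set M T" "x \<in> ext M T" using x by (rule groundedE)
    have xD: "x \<in> Dom M" and TD: "T \<in> Dom M" using x T unfolding trans_set_def by auto
    define S where "S = {z \<in> ext M T. \<exists>y\<in>Dom M. act_rel \<pi> z y}"
    have "small S"
      unfolding S_def
    proof (rule sep[where ps="[\<pi>]", OF small_ext[OF TD]])
    qed (use \<pi> in \<open>auto intro!: dfn_intro\<close>)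
    then have sm: "small (insert x S)" by (intro small_insert xD)
    have xS: "x \<notin> S" using no by (simp add: S_def)
    have V: "act_rel \<pi> z y \<longleftrightarrow> y = act M \<pi> z" if "z \<in> S" for z y
      using that act_eqI unfolding S_def by blast
    have V_Dom: "act M \<pi> z \<in> Dom M" if "z \<in> S" for z
      using V[OF that] act_rel_step(1) by blast
    have S_ext: "ext M z \<subseteq> S" if "z \<in> S" for z
    proof
      fix u assume u: "u \<in> ext M z"
      have "act_rel \<pi> z (act M \<pi> z)" using V[OF that] by blast
      from act_rel_ext[OF this u] show "u \<in> S" using u that T(1) unfolding S_def trans_set_def
        by blast
    qed
    have x_ext: "ext M x \<subseteq> S" using IH T unfolding S_def trans_set_def by blast
    have "small (act M \<pi> ` ext M x)"
    proof (rule small_image[where ps="[\<pi>]" and R="act_rel \<pi>", OF small_ext[OF xD]])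
    qed (use \<pi> V V_Dom x_ext in \<open>auto intro!: dfn_intro\<close>)
    note im = mk_props[OF this]
    define y0 where "y0 = (if x \<in> atoms M then app M \<pi> x else mk (act M \<pi> ` ext M x))"
    have y0: "y0 \<in> Dom M" using im atomsD[OF perms_app[OF \<pi>]] by (auto simp: y0_def)
    define F where "F z = (if z = x then y0 else act M \<pi> z)" for z
    obtain g where g: "fun_on M g (insert x S) (Dom M)" "\<And>z. z \<in> insert x S \<Longrightarrow> app M g z = F z"
    proof (rule make_fun[where K="insert x S" and L="Dom M" and F=F and ps="[x, y0, \<pi>]"
        and R="\<lambda>z y. if z = x then y = y0 else act_rel \<pi> z y", OF sm])
      show "dfn M [x, y0, \<pi>] (\<lambda>e. if e 0 = x then e (Suc 0) = y0 else act_rel \<pi> (e 0) (e (Suc 0)))"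
        using xD y0 \<pi> by (intro dfn_intro) auto
    qed (use xD y0 \<pi> V V_Dom in \<open>auto simp: F_def\<close>)
    have FS: "F z = act M \<pi> z" if "z \<in> S" for z using that xS by (auto simp: F_def)
    have "trans_set M (mk (insert x S))"
      unfolding trans_set_def ext_mk[OF sm] using is_set_mk[OF sm] x_ext S_ext by auto
    moreover have "if z \<in> atoms M then app M g z = app M \<pi> z
        else is_set M (app M g z) \<and> ext M (app M g z) = app M g ` ext M z" if z: "z \<in> insert x S" for z
    proof -
      have "ext M z \<subseteq> S" using z x_ext S_ext by blast
      then have eq: "app M g ` ext M z = act M \<pi> ` ext M z" using g(2) FS by (intro image_cong) auto
      show ?thesis
      proof (cases "z = x")
        case True
        then show ?thesis unfolding eq using g(2)[OF z] im by (simp add: F_def y0_def)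
      next
        case False
        then have "z \<in> S" using z by blast
        then have "act_rel \<pi> z (act M \<pi> z)" using V by blast
        from act_rel_step(2,3)[OF this] show ?thesis unfolding eq g(2)[OF z] FS[OF \<open>z \<in> S\<close>] by simp
      qed
    qed
    ultimately have "act_fun \<pi> (mk (insert x S)) g"
      unfolding act_fun_iff ext_mk[OF sm] using g(1) by blast
    then have "act_rel \<pi> x (app M g x)"
      unfolding act_rel_def using mk_in[OF sm] fun_on_Dom[OF g(1)] rel_iff_app[OF g(1)]
      by (intro bexI[of _ "mk (insert x S)"] bexI[of _ g]) (simp_all add: ext_mk[OF sm])
    then show False using no act_rel_step(1) by blast
  qed
qed (use \<pi> in \<open>auto intro!: dfn_intro\<close>)

lemma act_rel_act: "x \<in> grounded \<Longrightarrow> act_rel \<pi> x y \<longleftrightarrow> y = act M \<pi> x"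
  using act_rel_exists act_eqI by blast

lemma act_atom: "a \<in> atoms M \<Longrightarrow> act M \<pi> a = app M \<pi> a"
  using act_rel_step(2) act_rel_act atoms_grounded by blast

lemma act_set:
  assumes "x \<in> grounded" "is_set M x"
  shows "is_set M (act M \<pi> x)" "ext M (act M \<pi> x) = act M \<pi> ` ext M x"
  using act_rel_step(3)[of x "act M \<pi> x"] act_rel_act[OF assms(1)] assms(2) unfolding is_set_def
    by auto

lemma ext_act:
  assumes "x \<in> grounded"
  shows "ext M (act M \<pi> x) = act M \<pi> ` ext M x"
proof (cases "x \<in> atoms M")
  case True
  then show ?thesis using act_atom ext_atom perms_app[OF \<pi>] by simp
next
  case False
  then show ?thesis using act_set(2)[OF assms] assms by (simp add: is_set_def)
qed

lemma act_grounded: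
  assumes "x \<in> grounded"
  shows "act M \<pi> x \<in> grounded"
proof -
  have "\<exists>y\<in>grounded. act_rel \<pi> x y"
  proof (rule eps_induct[where ps="[\<pi>]", OF assms])
    fix x assume x: "x \<in> grounded" and IH: "\<And>z. z \<in> ext M x \<Longrightarrow> \<exists>y\<in>grounded. act_rel \<pi> z y"
    have "act M \<pi> x \<in> grounded"
    proof (cases "x \<in> atoms M")
      case True
      then show ?thesis using act_atom atoms_grounded perms_app[OF \<pi>] by simp
    next
      case False
      then have "is_set M x" using x by (simp add: is_set_def)
      from act_set[OF x this] show ?thesis
      proof (intro grounded_setI)
        assume "ext M (act M \<pi> x) = act M \<pi> ` ext M x"
        then show "ext M (act M \<pi> x) \<subseteq> grounded" using IH act_eqI by auto
      qed
    qed
    then show "\<exists>y\<in>grounded. act_rel \<pi> x y" using act_rel_act[OF x] by blast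
  qed (use \<pi> in \<open>auto intro!: dfn_intro\<close>)
  then show ?thesis using act_eqI by blast
qed

lemma is_set_act: "x \<in> grounded \<Longrightarrow> is_set M (act M \<pi> x) \<longleftrightarrow> is_set M x"
  using act_set(1) act_atom perms_app[OF \<pi>] unfolding is_set_def by (metis grounded_Dom)

lemma act_omega:
  assumes "n \<in> omega M"
  shows "act M \<pi> n = n"
proof -
  have "act_rel \<pi> n n"
  proof (rule omega_induct[where ps="[\<pi>]", OF assms])
    have "act M \<pi> (zero_in M) = zero_in M"
      using act_set[OF omega_grounded[OF omega_inductive(1)]] by (intro is_set_eqI) auto
    then show "act_rel \<pi> (zero_in M) (zero_in M)"
      using act_rel_act[OF omega_grounded[OF omega_inductive(1)]] by simp
    fix n assume n: "n \<in> omega M" "act_rel \<pi> n n"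
    have ng: "n \<in> grounded" "suc n \<in> grounded" using n(1) omega_grounded omega_inductive(2) by auto
    have "act M \<pi> n = n" using n(2) act_eqI by blast
    then have "act M \<pi> ` ext M n = ext M n" using ext_act[OF ng(1)] by simp
    then have "act M \<pi> (suc n) = suc n"
      using act_set[OF ng(2)] n(1) \<open>act M \<pi> n = n\<close> by (intro is_set_eqI) auto
    then show "act_rel \<pi> (suc n) (suc n)" using act_rel_act[OF ng(2)] by simp
  qed (use \<pi> in \<open>auto intro!: dfn_intro\<close>)
  then show ?thesis by (rule act_eqI)
qed

end

lemma act_compose:
  assumes "\<pi> \<in> perms M" "\<rho> \<in> perms M" "\<tau> \<in> perms M"
    and \<tau>: "\<And>a. a \<in> atoms M \<Longrightarrow> app M \<tau> a = app M \<pi> (app M \<rho> a)" and "x \<in> grounded"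
  shows "act M \<tau> x = act M \<pi> (act M \<rho> x)"
proof -
  define P where "P x \<longleftrightarrow> (\<exists>y\<in>Dom M. \<exists>z\<in>Dom M. act_rel \<rho> x y \<and> act_rel \<pi> y z \<and> act_rel \<tau> x z)" for x
  have P_iff: "P x \<longleftrightarrow> act M \<tau> x = act M \<pi> (act M \<rho> x)" if "x \<in> grounded" for x
  proof -
    have "act M \<rho> x \<in> grounded" "act M \<tau> x \<in> grounded" using act_grounded assms that by auto
    then show ?thesis unfolding P_def
      using act_rel_act[OF assms(1)] act_rel_act[OF assms(2) that] act_rel_act[OF assms(3) that]
        by auto
  qed
  have "P x"
  proof (rule eps_induct[where ps="[\<pi>, \<rho>, \<tau>]", OF assms(5)])
    show "dfn M [\<pi>, \<rho>, \<tau>] (\<lambda>e. P (e 0))" unfolding P_def using assms by (intro dfn_intro) auto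
    fix x assume x: "x \<in> grounded" and IH: "\<And>y. y \<in> ext M x \<Longrightarrow> P y"
    have g: "act M \<rho> x \<in> grounded" using act_grounded assms x by auto
    have "act M \<tau> x = act M \<pi> (act M \<rho> x)"
    proof (cases "x \<in> atoms M")
      case True
      then show ?thesis using act_atom assms by simp
    next
      case False
      then have "is_set M x" using x by (simp add: is_set_def)
      moreover from this have "is_set M (act M \<rho> x)" using is_set_act[OF assms(2) x] by simp
      moreover have "act M \<tau> ` ext M x = act M \<pi> ` act M \<rho> ` ext M x"
        unfolding image_image using IH P_iff grounded_ext[OF x] by (intro image_cong) auto
      ultimately show ?thesis
        using act_set[OF assms(3) x] act_set[OF assms(2) x] act_set[OF assms(1) g]
          by (intro is_set_eqI) auto
    qed
    then show "P x" using P_iff[OF x] by simp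
  qed (use assms in auto)
  then show ?thesis using P_iff[OF assms(5)] by simp
qed

lemma act_identity:
  assumes "\<iota> \<in> perms M" "\<And>a. a \<in> atoms M \<Longrightarrow> app M \<iota> a = a" "x \<in> grounded"
  shows "act M \<iota> x = x"
proof -
  have "act_rel \<iota> x x"
  proof (rule eps_induct[where ps="[\<iota>]", OF assms(3)])
    fix x assume x: "x \<in> grounded" and IH: "\<And>y. y \<in> ext M x \<Longrightarrow> act_rel \<iota> y y"
    have "act M \<iota> ` ext M x = ext M x" using IH act_eqI[OF assms(1)] by force
    have "act M \<iota> x = x"
    proof (cases "x \<in> atoms M")
      case True
      then show ?thesis using act_atom[OF assms(1)] assms(2) by simp
    next
      case False
      then have "is_set M x" using x by (simp add: is_set_def)
      then show ?thesis
        using act_set[OF assms(1) x] \<open>act M \<iota> ` ext M x = ext M x\<close> by (intro is_set_eqI) auto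
    qed
    then show "act_rel \<iota> x x" using act_rel_act[OF assms(1) x] by simp
  qed (use assms in \<open>auto intro!: dfn_intro\<close>)
  then show ?thesis by (rule act_eqI[OF assms(1)])
qed

lemma act_inverse:
  assumes "\<pi> \<in> perms M"
  obtains \<rho> where "\<rho> \<in> perms M" "\<And>a. a \<in> atoms M \<Longrightarrow> app M \<rho> (app M \<pi> a) = a"
    "\<And>x. x \<in> grounded \<Longrightarrow> act M \<rho> (act M \<pi> x) = x" "\<And>x. x \<in> grounded \<Longrightarrow> act M \<pi> (act M \<rho> x) = x"
proof -
  obtain \<rho> where \<rho>: "\<rho> \<in> perms M" "\<And>a. a \<in> atoms M \<Longrightarrow> app M \<rho> (app M \<pi> a) = a"
    "\<And>a. a \<in> atoms M \<Longrightarrow> app M \<pi> (app M \<rho> a) = a"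
    using perms_inverse[OF assms] by blast
  obtain \<iota> where \<iota>: "\<iota> \<in> perms M" "\<And>a. a \<in> atoms M \<Longrightarrow> app M \<iota> a = a" by (rule perms_identity) blast
  show thesis
  proof (rule that[OF \<rho>(1,2)])
    show "act M \<rho> (act M \<pi> x) = x" if "x \<in> grounded" for x
      using act_compose[OF \<rho>(1) assms \<iota>(1) _ that] act_identity[OF \<iota> that] \<iota>(2) \<rho>(2) by simp
    show "act M \<pi> (act M \<rho> x) = x" if "x \<in> grounded" for x
      using act_compose[OF assms \<rho>(1) \<iota>(1) _ that] act_identity[OF \<iota> that] \<iota>(2) \<rho>(3) by simp
  qed
qed

lemma act_inj: "\<pi> \<in> perms M \<Longrightarrow> inj_on (act M \<pi>) grounded"
  by (erule act_inverse) (metis inj_on_inverseI)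

lemma act_AtomSet: "\<pi> \<in> perms M \<Longrightarrow> act M \<pi> (AtomSet M) = AtomSet M"
proof (rule is_set_eqI)
  assume \<pi>: "\<pi> \<in> perms M"
  have "act M \<pi> ` atoms M = app M \<pi> ` atoms M" using act_atom[OF \<pi>] by simp
  also have "\<dots> = atoms M" using perms_bij[OF \<pi>] by (simp add: bij_betw_def)
  finally show "ext M (act M \<pi> (AtomSet M)) = ext M (AtomSet M)"
    unfolding ext_act[OF \<pi> AtomSet_grounded] atoms_def .
  show "is_set M (act M \<pi> (AtomSet M))"
    using is_set_act[OF \<pi> AtomSet_grounded] is_set_AtomSet by simp
qed (rule is_set_AtomSet)


subsection \<open>The permutation model\<close>

lemma sym_grp_mult:
  assumes "\<pi> \<in> perms M" "\<rho> \<in> perms M"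
  shows "\<pi> \<otimes>\<^bsub>sym_grp M\<^esub> \<rho> \<in> perms M"
    and "a \<in> atoms M \<Longrightarrow> app M (\<pi> \<otimes>\<^bsub>sym_grp M\<^esub> \<rho>) a = app M \<pi> (app M \<rho> a)"
proof -
  obtain \<tau> where \<tau>: "\<tau> \<in> perms M" "\<And>a. a \<in> atoms M \<Longrightarrow> app M \<tau> a = app M \<pi> (app M \<rho> a)"
    using perms_compose[OF assms] by blast
  have "\<pi> \<otimes>\<^bsub>sym_grp M\<^esub> \<rho> = \<tau>"
    unfolding sym_grp_def by simp (rule the_equality, use \<tau> perms_eqI in auto)
  then show "\<pi> \<otimes>\<^bsub>sym_grp M\<^esub> \<rho> \<in> perms M"
    "a \<in> atoms M \<Longrightarrow> app M (\<pi> \<otimes>\<^bsub>sym_grp M\<^esub> \<rho>) a = app M \<pi> (app M \<rho> a)"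
    using \<tau> by auto
qed

lemma sym_grp_one:
  shows "\<one>\<^bsub>sym_grp M\<^esub> \<in> perms M"
    and "a \<in> atoms M \<Longrightarrow> app M \<one>\<^bsub>sym_grp M\<^esub> a = a"
proof -
  obtain \<tau> where \<tau>: "\<tau> \<in> perms M" "\<And>a. a \<in> atoms M \<Longrightarrow> app M \<tau> a = a"
    by (rule perms_identity) auto
  have "\<one>\<^bsub>sym_grp M\<^esub> = \<tau>"
    unfolding sym_grp_def by simp (rule the_equality, use \<tau> perms_eqI in auto)
  then show "\<one>\<^bsub>sym_grp M\<^esub> \<in> perms M" "a \<in> atoms M \<Longrightarrow> app M \<one>\<^bsub>sym_grp M\<^esub> a = a"
    using \<tau> by auto
qed

lemma carrier_sym_grp [simp]: "carrier (sym_grp M) = perms M"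
  by (simp add: sym_grp_def)

text \<open>The filter is defined through \<open>subgroup\<close>, so the group axioms have to be
  available for permutations that are elements of the structure.\<close>

lemma group_sym_grp: "group (sym_grp M)"
proof (rule groupI, unfold carrier_sym_grp)
  fix \<pi> assume \<pi>: "\<pi> \<in> perms M"
  show "\<one>\<^bsub>sym_grp M\<^esub> \<otimes>\<^bsub>sym_grp M\<^esub> \<pi> = \<pi>"
    by (rule perms_eqI) (use \<pi> in \<open>auto simp: sym_grp_mult sym_grp_one\<close>)
  obtain \<rho> where "\<rho> \<in> perms M" "\<And>a. a \<in> atoms M \<Longrightarrow> app M \<rho> (app M \<pi> a) = a"
    using perms_inverse[OF \<pi>] by blast
  then show "\<exists>\<rho>\<in>perms M. \<rho> \<otimes>\<^bsub>sym_grp M\<^esub> \<pi> = \<one>\<^bsub>sym_grp M\<^esub>"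
    using \<pi> by (intro bexI[of _ \<rho>], rule_tac perms_eqI) (auto simp: sym_grp_mult sym_grp_one)
next
  fix \<pi> \<rho> \<tau> assume "\<pi> \<in> perms M" "\<rho> \<in> perms M" "\<tau> \<in> perms M"
  then show "\<pi> \<otimes>\<^bsub>sym_grp M\<^esub> \<rho> \<otimes>\<^bsub>sym_grp M\<^esub> \<tau> = \<pi> \<otimes>\<^bsub>sym_grp M\<^esub> (\<rho> \<otimes>\<^bsub>sym_grp M\<^esub> \<tau>)"
    by (rule_tac perms_eqI) (auto simp: sym_grp_mult)
qed (auto simp: sym_grp_mult sym_grp_one)

lemma subgroup_sym_of:
  assumes x: "x \<in> grounded"
  shows "subgroup (sym_of M x) (sym_grp M)"
proof (rule group.subgroupI[OF group_sym_grp])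
  show "sym_of M x \<subseteq> carrier (sym_grp M)" by (auto simp: sym_of_def)
  have "act M \<one>\<^bsub>sym_grp M\<^esub> x = x"
    by (rule act_identity[OF sym_grp_one x])
  then show "sym_of M x \<noteq> {}" using sym_grp_one(1) by (auto simp: sym_of_def)
  fix \<pi> assume "\<pi> \<in> sym_of M x"
  then have \<pi>: "\<pi> \<in> perms M" "act M \<pi> x = x" by (auto simp: sym_of_def)
  let ?\<rho> = "inv\<^bsub>sym_grp M\<^esub> \<pi>"
  have \<rho>: "?\<rho> \<in> perms M" "?\<rho> \<otimes>\<^bsub>sym_grp M\<^esub> \<pi> = \<one>\<^bsub>sym_grp M\<^esub>"
    using group.inv_closed[OF group_sym_grp] group.l_inv[OF group_sym_grp] \<pi>(1) by auto
  have "act M \<one>\<^bsub>sym_grp M\<^esub> x = act M ?\<rho> (act M \<pi> x)"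
    unfolding \<rho>(2)[symmetric]
    by (rule act_compose[OF \<rho>(1) \<pi>(1) sym_grp_mult[OF \<rho>(1) \<pi>(1)] x])
  then have "act M ?\<rho> x = x" using \<open>act M \<one>\<^bsub>sym_grp M\<^esub> x = x\<close> \<pi>(2) by simp
  then show "?\<rho> \<in> sym_of M x" using \<rho>(1) by (simp add: sym_of_def)
  fix \<tau> assume "\<tau> \<in> sym_of M x"
  then have \<tau>: "\<tau> \<in> perms M" "act M \<tau> x = x" by (auto simp: sym_of_def)
  have "act M (\<pi> \<otimes>\<^bsub>sym_grp M\<^esub> \<tau>) x = act M \<pi> (act M \<tau> x)"
    by (rule act_compose[OF \<pi>(1) \<tau>(1) sym_grp_mult[OF \<pi>(1) \<tau>(1)] x])
  then show "\<pi> \<otimes>\<^bsub>sym_grp M\<^esub> \<tau> \<in> sym_of M x"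
    using \<pi> \<tau> sym_grp_mult(1)[OF \<pi>(1) \<tau>(1)] by (simp add: sym_of_def)
qed

text \<open>As in \<^const>\<open>act_rel\<close>, relations replace function values to make the predicate definable.\<close>

definition supports :: "'v \<Rightarrow> 'v \<Rightarrow> bool" where
  "supports C x \<longleftrightarrow> is_set M C \<and> ext M C \<subseteq> atoms M \<and> countable_in M (ext M C) \<and>
     (\<forall>\<pi>\<in>perms M. (\<forall>a\<in>ext M C. rel M \<pi> a a) \<longrightarrow> act_rel \<pi> x x)"

lemma dfn_supports [dfn_intro]:
  assumes "trm M ps s" "trm M ps t"
  shows "dfn M ps (\<lambda>e. supports (s e) (t e))"
  unfolding supports_def by (intro dfn_intro trm_shift[OF assms(1)] trm_shift[OF assms(2)])

lemma supports_iff: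
  assumes x: "x \<in> grounded"
  shows "supports C x \<longleftrightarrow> is_set M C \<and> ext M C \<subseteq> atoms M \<and> countable_in M (ext M C) \<and>
     (\<forall>\<pi>\<in>perms M. (\<forall>a\<in>ext M C. app M \<pi> a = a) \<longrightarrow> act M \<pi> x = x)"
proof (cases "ext M C \<subseteq> atoms M")
  case True
  have "((\<forall>a\<in>ext M C. rel M \<pi> a a) \<longrightarrow> act_rel \<pi> x x) \<longleftrightarrow> ((\<forall>a\<in>ext M C. app M \<pi> a = a) \<longrightarrow> act M \<pi> x = x)"
    if "\<pi> \<in> perms M" for \<pi>
  proof -
    have "rel M \<pi> a a \<longleftrightarrow> app M \<pi> a = a" if "a \<in> ext M C" for a
      using perms_rel[OF \<open>\<pi> \<in> perms M\<close>, of a a] True that by auto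
    then show ?thesis using act_rel_act[OF that x] by auto
  qed
  then show ?thesis unfolding supports_def using True by auto
next
  case False
  then show ?thesis unfolding supports_def by blast
qed

text \<open>\<open>sym_of M x\<close> is itself the required member of the filter once it contains
  some pointwise stabilizer: it is a subgroup, and it is a set by Separation from
  \<open>perms M\<close>.\<close>

lemma symmetric_iff:
  assumes x: "x \<in> grounded"
  shows "symmetric M x \<longleftrightarrow> (\<exists>C\<in>Dom M. supports C x)"
proof -
  have "pointwise_stab M C \<subseteq> sym_of M x \<longleftrightarrow> (\<forall>\<pi>\<in>perms M. (\<forall>a\<in>ext M C. app M \<pi> a = a)
    \<longrightarrow> act M \<pi> x = x)" for C
    unfolding pointwise_stab_def sym_of_def by blast
  then have *: "(\<exists>C. is_set M C \<and> ext M C \<subseteq> atoms M \<and> countable_in M (ext M C)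
    \<and> pointwise_stab M C \<subseteq> sym_of M x)
      \<longleftrightarrow> (\<exists>C\<in>Dom M. supports C x)"
    unfolding supports_iff[OF x] by blast
  show ?thesis
  proof
    assume "symmetric M x"
    then show "\<exists>C\<in>Dom M. supports C x"
      unfolding symmetric_def supp_filter_def *[symmetric] by auto
  next
    assume C: "\<exists>C\<in>Dom M. supports C x"
    have "small {\<pi> \<in> perms M. act_rel \<pi> x x}"
    proof (rule sep[where ps="[x]", OF small_perms])
    qed (use x in \<open>auto intro!: dfn_intro\<close>)
    moreover have "{\<pi> \<in> perms M. act_rel \<pi> x x} = sym_of M x"
      using act_rel_act[OF _ x] unfolding sym_of_def by auto
    ultimately have "small (sym_of M x)" by simp
    then show "symmetric M x"
      unfolding symmetric_def supp_filter_def
      using subgroup_sym_of[OF x] C[folded *] by (intro bexI[of _ "mk (sym_of M x)"])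
        (auto simp: mk_props)
  qed
qed

text \<open>The hereditarily symmetric elements.\<close>

definition hs :: "'v set" where
  "hs = {x \<in> grounded. \<exists>T\<in>Dom M. trans_set M T \<and> x \<in> ext M T
    \<and> (\<forall>y\<in>ext M T. \<exists>C\<in>Dom M. supports C y)}"

lemma dcl_hs [dfn_intro]: "dcl M ps (\<lambda>e. hs)"
  unfolding hs_def by (intro dfn_intro)

lemma hs_grounded: "x \<in> hs \<Longrightarrow> x \<in> grounded"
  by (simp add: hs_def)

lemma hs_Dom [simp, dest]: "x \<in> hs \<Longrightarrow> x \<in> Dom M"
  using hs_grounded by blast

text \<open>The transitive closure of \<open>x\<close> lies in every transitive set containing
  \<open>x\<close>, so asking for symmetry on the closure or on some transitive set amounts to the
  same.\<close>

lemma Dom_perm_model: "Dom (perm_model M) = hs"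
proof -
  have "(\<exists>T. is_trans_closure M x T \<and> (\<forall>y\<in>ext M T. symmetric M y)) \<longleftrightarrow> x \<in> hs" if "x \<in> Dom M" for x
  proof
    assume "\<exists>T. is_trans_closure M x T \<and> (\<forall>y\<in>ext M T. symmetric M y)"
    then obtain T where T: "is_trans_closure M x T" "\<forall>y\<in>ext M T. symmetric M y" by blast
    then have "trans_set M T" "x \<in> ext M T" unfolding is_trans_closure_def by auto
    moreover from this have "\<exists>C\<in>Dom M. supports C y" if "y \<in> ext M T" for y
      using T(2) that symmetric_iff trans_set_grounded by blast
    ultimately show "x \<in> hs" unfolding hs_def using trans_set_grounded
      unfolding trans_set_def by blast
  next
    assume x: "x \<in> hs"
    then obtain T where T: "trans_set M T" "x \<in> ext M T" "\<forall>y\<in>ext M T. \<exists>C\<in>Dom M. supports C y"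
      unfolding hs_def by blast
    obtain S where S: "is_trans_closure M x S" using trans_closure_exists hs_grounded[OF x] by blast
    then have "ext M S \<subseteq> ext M T" using T unfolding is_trans_closure_def by blast
    then have "\<forall>y\<in>ext M S. symmetric M y" using T symmetric_iff trans_set_grounded by blast
    then show "\<exists>T. is_trans_closure M x T \<and> (\<forall>y\<in>ext M T. symmetric M y)" using S by blast
  qed
  moreover have "hs \<subseteq> Dom M" by auto
  ultimately show ?thesis unfolding perm_model_def by auto
qed

lemma hs_supports: "x \<in> hs \<Longrightarrow> \<exists>C. supports C x"
  unfolding hs_def by blast

lemma hs_ext: "x \<in> hs \<Longrightarrow> y \<in> ext M x \<Longrightarrow> y \<in> hs"
  unfolding hs_def trans_set_def using grounded_ext by blast

text \<open>From any transitive set around \<open>x\<close>, keeping \<open>x\<close> and the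
  hereditarily symmetric elements leaves a transitive set of symmetric elements. Membership in
  \<open>hs\<close> can thus be checked one level at a time.\<close>

lemma hsI:
  assumes x: "x \<in> Dom M" "ext M x \<subseteq> hs" "x \<in> atoms M \<or> is_set M x" and C: "supports C x"
  shows "x \<in> hs"
proof -
  have g: "x \<in> grounded" using x atoms_grounded grounded_setI hs_grounded by blast
  then obtain T where T: "trans_set M T" "x \<in> ext M T" by (rule groundedE)
  have "small {z \<in> ext M T. z \<in> hs}"
    by (rule sep[where ps="[]"]) (use T in \<open>auto simp: trans_set_def intro!: dfn_intro small_ext\<close>)
  then have sm: "small (insert x {z \<in> ext M T. z \<in> hs})" by (intro small_insert x(1))
  have "trans_set M (mk (insert x {z \<in> ext M T. z \<in> hs}))"
    unfolding trans_set_def ext_mk[OF sm]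
    using is_set_mk[OF sm] T x(2) hs_ext unfolding trans_set_def by blast
  moreover have "x \<in> ext M (mk (insert x {z \<in> ext M T. z \<in> hs}))" unfolding ext_mk[OF sm] by blast
  moreover have "\<exists>C\<in>Dom M. supports C y" if "y \<in> ext M (mk (insert x {z \<in> ext M T. z \<in> hs}))" for y
    using that C hs_supports[of y] unfolding ext_mk[OF sm] supports_def by blast
  ultimately have "\<exists>T\<in>Dom M. trans_set M T \<and> x \<in> ext M T \<and> (\<forall>y\<in>ext M T. \<exists>C\<in>Dom M. supports C y)"
    using mk_in[OF sm] by blast
  then show ?thesis using g by (simp only: hs_def mem_Collect_eq)
qed

lemma supports_empty:
  assumes "x \<in> grounded" "\<And>\<pi>. \<pi> \<in> perms M \<Longrightarrow> act M \<pi> x = x"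
  shows "supports (zero_in M) x"
  unfolding supports_iff[OF assms(1)] using assms(2) finite_countable[OF finite_empty] by simp

lemma atoms_hs: "a \<in> atoms M \<Longrightarrow> a \<in> hs"
proof (rule hsI[of a "mk {a}"])
  assume a: "a \<in> atoms M"
  then have aD: "a \<in> Dom M" by blast
  have "countable_in M {a}" by (intro finite_countable finite_insert finite_empty aD) simp
  then show "supports (mk {a}) a"
    unfolding supports_iff[OF atoms_grounded[OF a]] using a act_atom[OF _ a]
    by (simp add: mk_props small_singleton aD)
  show "ext M a \<subseteq> hs" using ext_atom[OF a] by simp
qed auto

lemma AtomSet_hs: "AtomSet M \<in> hs"
proof (rule hsI)
  show "supports (zero_in M) (AtomSet M)"
    by (rule supports_empty[OF AtomSet_grounded act_AtomSet])
qed (use is_set_AtomSet atoms_hs in \<open>auto simp: atoms_def\<close>)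

lemma hs_act:
  assumes \<pi>: "\<pi> \<in> perms M" and "x \<in> hs"
  shows "act M \<pi> x \<in> hs"
proof -
  have "x \<in> hs \<longrightarrow> (\<exists>y\<in>hs. act_rel \<pi> x y)"
  proof (rule eps_induct[where ps="[\<pi>]", OF hs_grounded[OF assms(2)]])
    fix x assume g: "x \<in> grounded" and IH: "\<And>y. y \<in> ext M x \<Longrightarrow> y \<in> hs \<longrightarrow> (\<exists>z\<in>hs. act_rel \<pi> y z)"
    show "x \<in> hs \<longrightarrow> (\<exists>y\<in>hs. act_rel \<pi> x y)"
    proof
      assume x: "x \<in> hs"
      have ag: "act M \<pi> x \<in> grounded" by (rule act_grounded[OF \<pi> g])
      have "act M \<pi> x \<in> hs"
      proof -
        obtain C where "supports C x" using hs_supports[OF x] by blast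
        then have C: "is_set M C" "ext M C \<subseteq> atoms M" "countable_in M (ext M C)"
          "\<And>\<rho>. \<rho> \<in> perms M \<Longrightarrow> (\<And>a. a \<in> ext M C \<Longrightarrow> app M \<rho> a = a) \<Longrightarrow> act M \<rho> x = x"
          unfolding supports_iff[OF g] by auto
        let ?D = "app M \<pi> ` ext M C"
        have D: "?D \<subseteq> atoms M" using C(2) perms_app[OF \<pi>] by blast
        have count: "countable_in M ?D"
        proof (rule countable_image[OF C(3), where ps="[\<pi>]" and R="rel M \<pi>"])
          show "rel M \<pi> a b \<longleftrightarrow> b = app M \<pi> a" if "a \<in> ext M C" for a b
            using perms_rel[OF \<pi>] C(2) that by blast
          show "inj_on (app M \<pi>) (ext M C)" using perms_bij[OF \<pi>] C(2)
            by (meson bij_betw_def inj_on_subset)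
        qed (use \<pi> D in \<open>auto intro!: dfn_intro\<close>)
        note sm = countable_small[OF count]
        obtain \<rho> where \<rho>: "\<rho> \<in> perms M" "\<And>a. a \<in> atoms M \<Longrightarrow> app M \<rho> (app M \<pi> a) = a"
          "\<And>x. x \<in> grounded \<Longrightarrow> act M \<pi> (act M \<rho> x) = x" using act_inverse[OF \<pi>] by metis
        \<comment> \<open>The image of \<open>C\<close> under \<open>\<pi>\<close> supports
          \<open>act M \<pi> x\<close>: when \<open>\<tau>\<close> fixes that image pointwise, the
          conjugate \<open>\<tau>2\<close>, which is \<open>\<rho>\<close> after
          \<open>\<tau>\<close> after \<open>\<pi>\<close>, fixes \<open>C\<close> pointwise and
          hence \<open>x\<close>.\<close>
        have fixed: "act M \<tau> (act M \<pi> x) = act M \<pi> x"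
          if \<tau>: "\<tau> \<in> perms M" "\<And>a. a \<in> ?D \<Longrightarrow> app M \<tau> a = a" for \<tau>
        proof -
          obtain \<tau>1 where t1: "\<tau>1 \<in> perms M" "\<And>a. a \<in> atoms M \<Longrightarrow> app M \<tau>1 a = app M \<tau> (app M \<pi> a)"
            using perms_compose[OF \<tau>(1) \<pi>] by blast
          obtain \<tau>2 where t2: "\<tau>2 \<in> perms M" "\<And>a. a \<in> atoms M \<Longrightarrow> app M \<tau>2 a = app M \<rho> (app M \<tau>1 a)"
            using perms_compose[OF \<rho>(1) t1(1)] by blast
          have "app M \<tau>2 a = a" if "a \<in> ext M C" for a
            using that t1(2) t2(2) \<tau>(2) \<rho>(2) C(2) by auto
          then have "act M \<tau>2 x = x" by (rule C(4)[OF t2(1)])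
          moreover have "act M \<tau>2 x = act M \<rho> (act M \<tau> (act M \<pi> x))"
            using act_compose[OF \<rho>(1) t1(1) t2 g] act_compose[OF \<tau>(1) \<pi> t1 g] by simp
          moreover have "act M \<tau> (act M \<pi> x) \<in> grounded" using act_grounded \<tau>(1) ag by blast
          ultimately show ?thesis using \<rho>(3) by metis
        qed
        have "supports (mk ?D) (act M \<pi> x)"
          unfolding supports_iff[OF ag] ext_mk[OF sm] using D count is_set_mk[OF sm] fixed by blast
        moreover have "ext M (act M \<pi> x) \<subseteq> hs"
        proof
          fix z assume "z \<in> ext M (act M \<pi> x)"
          then obtain y where y: "y \<in> ext M x" "z = act M \<pi> y" unfolding ext_act[OF \<pi> g] by blast
          then have "y \<in> hs" using hs_ext x by blast
          then show "z \<in> hs" using IH[OF y(1)] y act_eqI[OF \<pi>] by blast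
        qed
        moreover have "act M \<pi> x \<in> atoms M \<or> is_set M (act M \<pi> x)" using ag by
          (auto simp: is_set_def)
        ultimately show ?thesis using ag by (intro hsI) auto
      qed
      then show "\<exists>y\<in>hs. act_rel \<pi> x y" using act_rel_act[OF \<pi> g] by blast
    qed
  qed (use \<pi> in \<open>auto intro!: dfn_intro\<close>)
  then show ?thesis using assms(2) act_eqI[OF \<pi>] by blast
qed

lemma act_mem:
  assumes \<pi>: "\<pi> \<in> perms M" and "x \<in> grounded" "y \<in> grounded"
  shows "act M \<pi> x \<in> ext M (act M \<pi> y) \<longleftrightarrow> x \<in> ext M y"
  unfolding ext_act[OF \<pi> assms(3)]
  using inj_on_image_mem_iff[OF act_inj[OF \<pi>] assms(2), of "ext M y"] grounded_ext[OF assms(3)]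
    by blast

section \<open>Truth in the permutation model\<close>

abbreviation (input) "B \<equiv> perm_model M"

lemma B_simps [simp]: "Mem B = Mem M" "AtomSet B = AtomSet M" "Dom B = hs"
  using Dom_perm_model by (auto simp: perm_model_def)

lemma ext_B [simp]: "x \<in> hs \<Longrightarrow> ext B x = ext M x"
  using hs_ext[of x] hs_Dom unfolding ext_def by auto

lemma atoms_B [simp]: "atoms B = atoms M"
  unfolding atoms_def using AtomSet_hs by simp

lemma is_set_B: "is_set B x \<longleftrightarrow> x \<in> hs \<and> is_set M x"
  unfolding is_set_def by auto

text \<open>A permutation acts on \<open>B\<close> as an automorphism. The inverse permutation makes
  the action onto, which is what the quantifier case needs.\<close>

lemma sat_act:
  assumes \<pi>: "\<pi> \<in> perms M" and "range e \<subseteq> hs"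
  shows "sat B (act M \<pi> \<circ> e) \<phi> \<longleftrightarrow> sat B e \<phi>"
  using assms(2)
proof (induction \<phi> arbitrary: e)
  case (FMem i j)
  then have ij: "e i \<in> hs" "e j \<in> hs" by auto
  have "Mem M x y \<longleftrightarrow> x \<in> ext M y" if "x \<in> hs" for x y using that by (auto simp: ext_def)
  then show ?case using ij hs_act[OF \<pi>] act_mem[OF \<pi>] hs_grounded by simp
next
  case (FEq i j)
  then have "e i \<in> grounded" "e j \<in> grounded" using hs_grounded by auto
  then show ?case using inj_onD[OF act_inj[OF \<pi>]] by auto
next
  case (FAll i \<phi>)
  obtain \<rho> where \<rho>: "\<rho> \<in> perms M" "\<And>x. x \<in> grounded \<Longrightarrow> act M \<pi> (act M \<rho> x) = x"
    using act_inverse[OF \<pi>] by metis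
  have "sat B ((act M \<pi> \<circ> e)(i := act M \<pi> x)) \<phi> \<longleftrightarrow> sat B (e(i := x)) \<phi>" if "x \<in> hs" for x
  proof -
    have "range (e(i := x)) \<subseteq> hs" using FAll.prems that by auto
    moreover have "act M \<pi> \<circ> e(i := x) = (act M \<pi> \<circ> e)(i := act M \<pi> x)" by auto
    ultimately show ?thesis using FAll.IH by metis
  qed
  moreover have "(\<forall>x\<in>hs. Q x) \<longleftrightarrow> (\<forall>x\<in>hs. Q (act M \<pi> x))" for Q
    using hs_act[OF \<pi>] hs_act[OF \<rho>(1)] \<rho>(2) hs_grounded by metis
  note this[of "\<lambda>x. sat B ((act M \<pi> \<circ> e)(i := x)) \<phi>"]
  ultimately show ?case by (simp del: o_apply)
qed auto

text \<open>Quantifiers are relativised to \<open>hs\<close>, which is definable without parameters.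
  This brings the axiom schemes of \<open>M\<close> to bear on formulas evaluated in
  \<open>B\<close>.\<close>

lemma dfn_sat_B: "dfn M [] (\<lambda>e. sat B e \<phi>)"
proof (induction \<phi>)
  case (FMem i j)
  then show ?case by (simp, intro dfn_intro)
next
  case (FEq i j)
  then show ?case by (simp, intro dfn_intro)
next
  case (FNeg \<phi>)
  then show ?case by (simp, intro dfn_intro)
next
  case (FConj \<phi> \<psi>)
  then show ?case by (simp, intro dfn_intro)
next
  case (FAll i \<phi>)
  obtain \<psi> where \<psi>: "\<And>e. range e \<subseteq> Dom M \<Longrightarrow> sat B e \<phi> \<longleftrightarrow> sat M (with_params M [] e) \<psi>"
    using FAll unfolding dfn_def by blast
  have "dfn M [] (\<lambda>e. e i \<in> hs)" by (intro dfn_intro)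
  then obtain \<delta> where \<delta>: "\<And>e. range e \<subseteq> Dom M \<Longrightarrow> e i \<in> hs \<longleftrightarrow> sat M (with_params M [] e) \<delta>"
    unfolding dfn_def by blast
  \<comment> \<open>The environment starts with the set of atoms, so variable \<open>i\<close> has
    index \<open>Suc i\<close>; the nested negations spell out an implication.\<close>
  have "sat B e (FAll i \<phi>) \<longleftrightarrow> sat M (with_params M [] e) (FAll (Suc i) (FNeg (FConj \<delta> (FNeg \<psi>))))"
    if e: "range e \<subseteq> Dom M" for e
  proof -
    have *: "(with_params M [] e)(Suc i := x) = with_params M [] (e(i := x))" for x
      by (auto simp: with_params_def Let_def fun_eq_iff)
    have "range (e(i := x)) \<subseteq> Dom M" if "x \<in> Dom M" for x using e that by auto
    then have "(\<forall>x\<in>Dom M. x \<in> hs \<longrightarrow> sat B (e(i := x)) \<phi>) \<longleftrightarrow>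
      (\<forall>x\<in>Dom M. sat M (with_params M [] (e(i := x))) \<delta> \<longrightarrow> sat M (with_params M [] (e(i := x))) \<psi>)"
      using \<psi> \<delta> by (metis (no_types, lifting) fun_upd_same)
    then show ?thesis by (auto simp: *)
  qed
  then show ?case unfolding dfn_def by blast
qed

end

context zfac_model
begin

section \<open>Sets definable in the permutation model are symmetric\<close>

lemma common_support:
  assumes "set ps \<subseteq> hs"
  shows "\<exists>C. is_set M C \<and> (\<forall>x\<in>set ps. supports C x) \<and> ext M C \<subseteq> atoms M \<and> countable_in M (ext M C)"
  using assms
proof (induction ps)
  case Nil
  then show ?case using finite_countable[OF finite_empty] by (intro exI[of _ "zero_in M"]) simp
next
  case (Cons x ps)
  then obtain C where C: "is_set M C" "\<forall>x\<in>set ps. supports C x" "ext M C \<subseteq> atoms M"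
    "countable_in M (ext M C)" by auto
  obtain D where D: "supports D x" using hs_supports Cons.prems by force
  then have D': "ext M D \<subseteq> atoms M" "countable_in M (ext M D)" unfolding supports_def by auto
  define E where "E = mk (ext M C \<union> ext M D)"
  have count: "countable_in M (ext M C \<union> ext M D)" by (intro countable_Un C D')
  have E: "is_set M E" "ext M E = ext M C \<union> ext M D"
    unfolding E_def using mk_props[OF countable_small[OF count]] by auto
  have mono: "supports E y" if "supports F y" "ext M F \<subseteq> ext M E" for F y
    unfolding supports_def
  proof (intro conjI ballI impI)
    fix \<pi> assume "\<pi> \<in> perms M" "\<forall>a\<in>ext M E. rel M \<pi> a a"
    then show "act_rel \<pi> y y" using that unfolding supports_def by blast
  qed (use E count C(3) D'(1) in auto)
  have "supports E y" if "y \<in> set (x # ps)" for y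
    using mono[of D y] mono[of C y] that D C(2) E(2) by auto
  then show ?case using E count C(3) D'(1) by (intro exI[of _ E]) auto
qed

lemma definable_set_hs:
  assumes y: "is_set M y" "ext M y = {u \<in> hs. P u}" and P: "dfn B ps (\<lambda>e. P (e 0))"
    and ps: "set ps \<subseteq> hs"
  shows "y \<in> hs"
proof -
  obtain C where C: "is_set M C" "\<And>x. x \<in> set ps \<Longrightarrow> supports C x" "ext M C \<subseteq> atoms M"
    "countable_in M (ext M C)"
    using common_support[OF ps] by blast
  have g: "y \<in> grounded" by (rule grounded_setI) (use y hs_grounded in auto)
  obtain \<phi> where \<phi>: "\<And>e. range e \<subseteq> hs \<Longrightarrow> P (e 0) \<longleftrightarrow> sat B (with_params B ps e) \<phi>"
    using P unfolding dfn_def by auto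
  have "act M \<pi> y = y" if \<pi>: "\<pi> \<in> perms M" and C_fix: "\<And>a. a \<in> ext M C \<Longrightarrow> app M \<pi> a = a" for \<pi>
  proof -
    have fixed: "act M \<pi> x = x" if "x \<in> set ps" for x
    proof -
      have "x \<in> grounded" using that ps hs_grounded by blast
      then show ?thesis using C(2)[OF that] supports_iff \<pi> C_fix by blast
    qed
    have P_act: "P (act M \<pi> u) \<longleftrightarrow> P u" if u: "u \<in> hs" for u
    proof -
      \<comment> \<open>Only entry 0 matters to \<open>P\<close>, so a constant environment will do;
        it keeps all entries in \<open>hs\<close>.\<close>
      have r: "range (with_params B ps (\<lambda>_. u)) \<subseteq> hs"
        by (rule range_with_params) (use u ps AtomSet_hs in auto)
      have "act M \<pi> \<circ> with_params B ps (\<lambda>_. u) = with_params B ps (\<lambda>_. act M \<pi> u)"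
        using comp_with_params[of "act M \<pi>" B ps "\<lambda>_. u"] fixed act_AtomSet[OF \<pi>] by
          (simp add: comp_def)
      then show ?thesis
        using \<phi>[of "\<lambda>_. u"] \<phi>[of "\<lambda>_. act M \<pi> u"] sat_act[OF \<pi> r] u hs_act[OF \<pi> u] by simp
    qed
    have "ext M (act M \<pi> y) = ext M y"
    proof -
      obtain \<rho> where \<rho>: "\<rho> \<in> perms M" "\<And>x. x \<in> grounded \<Longrightarrow> act M \<pi> (act M \<rho> x) = x"
        using act_inverse[OF \<pi>] by metis
      have "act M \<pi> ` {u \<in> hs. P u} = {u \<in> hs. P u}"
      proof (intro equalityI subsetI)
        fix u assume "u \<in> act M \<pi> ` {u \<in> hs. P u}"
        then show "u \<in> {u \<in> hs. P u}" using P_act hs_act[OF \<pi>] by auto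
      next
        fix u assume u: "u \<in> {u \<in> hs. P u}"
        then have "act M \<rho> u \<in> hs" "act M \<pi> (act M \<rho> u) = u"
          using hs_act[OF \<rho>(1)] \<rho>(2) hs_grounded by auto
        then show "u \<in> act M \<pi> ` {u \<in> hs. P u}" using u P_act[of "act M \<rho> u"] by force
      qed
      then show ?thesis unfolding ext_act[OF \<pi> g] y(2) .
    qed
    then show ?thesis using is_set_act[OF \<pi> g] y(1) by (intro is_set_eqI) auto
  qed
  then have "supports C y" unfolding supports_iff[OF g] using C by blast
  then show ?thesis using y by (intro hsI) auto
qed

text \<open>There are two separate demands: \<open>K\<close> must be a set of \<open>M\<close>,
  which an axiom of \<open>M\<close> provides, and it must be symmetric, which definability in
  \<open>B\<close> provides. Pairing, Union, Power Set and the schemes in \<open>B\<close> all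
  follow this pattern.\<close>

lemma definable_set_B:
  assumes "small K" "K = {u \<in> hs. P u}" "dfn B ps (\<lambda>e. P (e 0))" "set ps \<subseteq> hs"
  shows "\<exists>y. is_set B y \<and> ext B y = K"
  using definable_set_hs[of
    "mk K", OF is_set_mk[OF assms(1)] _ assms(3,4)] ext_mk[OF assms(1)] assms(2)
    is_set_mk[OF assms(1)] by (intro exI[of _ "mk K"]) (simp add: is_set_B)

lemma omega_hs: "n \<in> omega M \<Longrightarrow> n \<in> hs"
proof (rule omega_induct[where ps="[]" and P="\<lambda>n. n \<in> hs"])
  have 0: "supports (zero_in M) n" if "n \<in> omega M" for n
    by (rule supports_empty[OF omega_grounded[OF that] act_omega[OF _ that]])
  show "zero_in M \<in> hs" by (rule hsI[OF _ _ _ 0]) (auto simp: omega_inductive)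
  show "suc n \<in> hs" if "n \<in> omega M" "n \<in> hs" for n
    by (rule hsI[OF _ _ _ 0]) (use that hs_ext[OF that(2)] omega_inductive in auto)
qed (auto intro!: dfn_intro)

lemma omega_set_hs: "mk (omega M) \<in> hs"
proof (rule hsI)
  have g: "mk (omega M) \<in> grounded"
    by (rule grounded_setI) (use mk_props[OF small_omega] omega_grounded in auto)
  show "supports (zero_in M) (mk (omega M))"
  proof (rule supports_empty[OF g], rule is_set_eqI)
    fix \<pi> assume \<pi>: "\<pi> \<in> perms M"
    show "is_set M (act M \<pi> (mk (omega M)))" "is_set M (mk (omega M))"
      using is_set_act[OF \<pi> g] is_set_mk[OF small_omega] by auto
    have "act M \<pi> ` omega M = omega M" using act_omega[OF \<pi>] by simp
    then show "ext M (act M \<pi> (mk (omega M))) = ext M (mk (omega M))"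
      unfolding ext_act[OF \<pi> g] ext_mk[OF small_omega] .
  qed
qed (use mk_props[OF small_omega] omega_hs in auto)

section \<open>The axioms of ZFA in the permutation model\<close>

lemma dfn_B_sat: "dfn B [] (\<lambda>e. sat B e \<phi>)"
  by (rule dfn_of_sat) (auto simp: with_params_def intro: exI[of _ "Suc _"])

lemma separation_B: "ax_separation B"
  unfolding ax_separation_def
proof (intro allI impI ballI)
  fix \<phi> and e :: "nat \<Rightarrow> 'a" and x assume e: "range e \<subseteq> Dom B" and x: "x \<in> Dom B"
  let ?P = "\<lambda>t. sat B (e(0 := t)) \<phi>"
  have upd: "e(0 := t, 1 := e 1) = e(0 := t)" for t by auto
  have eM: "range e \<subseteq> Dom M" using e by auto
  \<comment> \<open>Definability in \<open>M\<close> serves to form the set; definability in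
    \<open>B\<close>, with parameters \<open>qs\<close>, serves for its symmetry. In both, entry 1
    is set back to \<open>e 1\<close>, as only entry 0 varies in Separation.\<close>
  obtain ps where ps: "set ps \<subseteq> range e" "e 1 \<in> set ps"
    "dfn M ps (\<lambda>e'. sat B (e(0 := e' 0, 1 := e' (Suc 0))) \<phi>)"
    by (rule dfn_fix_params[OF dfn_sat_B eM])
  have "dfn M ps (\<lambda>e'. sat B (e(0 := e' 0, 1 := e 1)) \<phi>)"
    by (rule dfn_subst2[OF ps(3) trm_var trm_const]) (use ps eM in auto)
  then have "small {t \<in> ext M x. ?P t}"
    unfolding upd by (rule sep[rotated]) (use ps eM x small_ext in auto)
  obtain qs where qs: "set qs \<subseteq> range e" "e 1 \<in> set qs"
    "dfn B qs (\<lambda>e'. sat B (e(0 := e' 0, 1 := e' (Suc 0))) \<phi>)"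
    by (rule dfn_fix_params[OF dfn_B_sat e])
  have "dfn B qs (\<lambda>e'. sat B (e(0 := e' 0, 1 := e 1)) \<phi>)"
    by (rule dfn_subst2[OF qs(3) trm_var trm_const]) (use qs e in auto)
  then have "dfn B qs (\<lambda>e'. ?P (e' 0))" unfolding upd .
  then have d: "dfn B (x # qs) (\<lambda>e'. e' 0 \<in> ext B x \<and> ?P (e' 0))"
    using x by (intro dfn_conj dfn_Cons dfn_in dcl_ext trm_var trm_const) auto
  show "\<exists>y. is_set B y \<and> ext B y = {t \<in> ext B x. ?P t}"
  proof (rule definable_set_B[OF _ _ d])
    have "ext B x = ext M x" "ext M x \<subseteq> hs" using x hs_ext by auto
    then show "small {t \<in> ext B x. ?P t}" "{t \<in> ext B x. ?P t} = {t \<in> hs. t \<in> ext B x \<and> ?P t}"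
      using \<open>small {t \<in> ext M x. ?P t}\<close> by (simp_all only:) blast+
  qed (use x qs(1) e in auto)
qed

lemma replacement_B: "ax_replacement B"
  unfolding ax_replacement_def
proof (intro allI impI ballI)
  fix \<phi> and e :: "nat \<Rightarrow> 'a" and x
  let ?R = "\<lambda>t u. sat B (e(0 := t, 1 := u)) \<phi>"
  assume e: "range e \<subseteq> Dom B" and x: "x \<in> Dom B"
    and single: "\<forall>t\<in>ext B x. \<forall>u\<in>Dom B. \<forall>v\<in>Dom B. ?R t u \<longrightarrow> ?R t v \<longrightarrow> u = v"
  have eM: "range e \<subseteq> Dom M" using e by auto
  obtain ps where ps: "set ps \<subseteq> range e" "e 1 \<in> set ps" "dfn M ps (\<lambda>e'. ?R (e' 0) (e' (Suc 0)))"
    by (rule dfn_fix_params[OF dfn_sat_B eM])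
  have "small {u \<in> Dom M. \<exists>t\<in>ext M x. u \<in> hs \<and> ?R t u}"
  proof (rule repl)
    show "dfn M ps (\<lambda>e'. e' (Suc 0) \<in> hs \<and> ?R (e' 0) (e' (Suc 0)))"
      by (intro dfn_conj ps(3) dfn_in trm_var dcl_hs)
    show "small (ext M x)" using x by (intro small_ext) auto
    show "set ps \<subseteq> Dom M" using ps eM by auto
    fix t u v assume "t \<in> ext M x" "u \<in> hs \<and> ?R t u" "v \<in> hs \<and> ?R t v"
    then show "u = v" using single x by auto
  qed
  moreover have "{u \<in> Dom M. \<exists>t\<in>ext M x. u \<in> hs \<and> ?R t u} = {u \<in> Dom B. \<exists>t\<in>ext B x. ?R t u}"
    using x by auto
  ultimately have sm: "small {u \<in> Dom B. \<exists>t\<in>ext B x. ?R t u}" by simp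
  obtain qs where qs: "set qs \<subseteq> range e" "e 1 \<in> set qs" "dfn B qs (\<lambda>e'. ?R (e' 0) (e' (Suc 0)))"
    by (rule dfn_fix_params[OF dfn_B_sat e])
  have d: "dfn B (x # qs) (\<lambda>e'. \<exists>t\<in>ext B x. ?R t (e' 0))"
  proof (rule dfn_bex)
    show "dcl B (x # qs) (\<lambda>e. ext B x)" using x by (intro dcl_ext trm_const) auto
    show "dfn B (x # qs) (\<lambda>e'. ?R (e' 0) (e' (Suc 0)))" by (rule dfn_Cons[OF qs(3)])
  qed
  show "\<exists>y. is_set B y \<and> ext B y = {u \<in> Dom B. \<exists>t\<in>ext B x. ?R t u}"
  proof (rule definable_set_B[OF sm _ d])
    show "{u \<in> Dom B. \<exists>t\<in>ext B x. ?R t u} = {u \<in> hs. \<exists>t\<in>ext B x. ?R t u}"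
      by (simp only: B_simps)
  qed (use x qs(1) e in auto)
qed

text \<open>The set of numbers of \<open>M\<close> belongs to \<open>B\<close>, which gives Infinity
  there and later the inclusion of \<open>omega B\<close> in \<open>omega M\<close>.\<close>

lemma inductive_omega_B: "inductive_set_in B (mk (omega M))"
  unfolding inductive_set_in_def
proof (intro conjI ballI)
  have om: "ext B (mk (omega M)) = omega M" using omega_set_hs by (simp add: ext_mk[OF small_omega])
  show "is_set B (mk (omega M))" using omega_set_hs is_set_mk[OF small_omega] by
    (simp add: is_set_B)
  show "\<exists>z\<in>ext B (mk (omega M)). is_set B z \<and> ext B z = {}"
    unfolding om using omega_inductive(1) omega_hs[OF omega_inductive(1)]
    by (intro bexI[of _ "zero_in M"]) (auto simp: is_set_B)
  show "\<exists>y\<in>ext B (mk (omega M)). is_set B y \<and> ext B y = insert x (ext B x)"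
    if "x \<in> ext B (mk (omega M))" for x
  proof -
    have x: "x \<in> omega M" using that unfolding om .
    show ?thesis
      unfolding om using omega_inductive(2)[OF x] omega_hs[OF omega_inductive(2)[OF x]] omega_hs[OF x] x
      by (intro bexI[of _ "suc x"]) (auto simp: is_set_B)
  qed
qed

lemma zfa_perm_model: "zfa B"
  unfolding zfa_def
proof (intro conjI ballI allI impI)
  show "AtomSet B \<in> Dom B" using AtomSet_hs by simp
  show "ext B a = {}" if "a \<in> atoms B" for a
    using that ext_atom atoms_hs by simp
  show "\<exists>z. is_set B z \<and> ext B z = {}"
    using omega_hs[OF omega_inductive(1)] by (intro exI[of _ "zero_in M"]) (simp add: is_set_B)
  show "x = y" if "is_set B x" "is_set B y" "ext B x = ext B y" for x y
    using that by (intro is_set_eqI) (auto simp: is_set_B)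
  show "\<exists>z. is_set B z \<and> ext B z = {x, y}" if xy: "x \<in> Dom B" "y \<in> Dom B" for x y
  proof (rule definable_set_B[where P="\<lambda>u. u = x \<or> u = y" and ps="[x, y]"])
    show "dfn B [x, y] (\<lambda>e. e 0 = x \<or> e 0 = y)" using xy by (intro dfn_intro) auto
  qed (use xy in \<open>auto intro: small_pair\<close>)
  show "\<exists>u. is_set B u \<and> ext B u = (\<Union>y\<in>ext B x. ext B y)" if x: "x \<in> Dom B" for x
  proof (rule definable_set_B[where P="\<lambda>u. \<exists>y\<in>ext B x. u \<in> ext B y" and ps="[x]"])
    show "dfn B [x] (\<lambda>e. \<exists>y\<in>ext B x. e 0 \<in> ext B y)" using x by (intro dfn_intro) auto
    have "(\<Union>y\<in>ext B x. ext B y) = (\<Union>y\<in>ext M x. ext M y)" using x hs_ext by auto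
    then show "small (\<Union>y\<in>ext B x. ext B y)" using small_Union[of x] x by simp
    show "(\<Union>y\<in>ext B x. ext B y) = {u \<in> hs. \<exists>y\<in>ext B x. u \<in> ext B y}"
      using x hs_ext by auto
  qed (use x in auto)
  show "\<exists>p. is_set B p \<and> ext B p = {y. is_set B y \<and> ext B y \<subseteq> ext B x}" if x: "x \<in> Dom B" for x
  proof (rule definable_set_B[where P="\<lambda>y. y \<notin> ext B (AtomSet B) \<and> ext B y \<subseteq> ext B x" and ps="[x]"])
    show "dfn B [x] (\<lambda>e. e 0 \<notin> ext B (AtomSet B) \<and> ext B (e 0) \<subseteq> ext B x)"
      using x AtomSet_hs by (intro dfn_intro) auto
    \<comment> \<open>The power set in \<open>B\<close> is that of \<open>M\<close> cut down to
      \<open>hs\<close>.\<close>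
    have "small {y \<in> {y. is_set M y \<and> ext M y \<subseteq> ext M x}. y \<in> hs}"
      by (rule sep[where ps="[]", OF small_Pow[OF small_ext]]) (use x in \<open>auto intro!: dfn_intro\<close>)
    moreover have "{y \<in> {y. is_set M y \<and> ext M y \<subseteq> ext M x}. y \<in> hs} = {y. is_set B y
      \<and> ext B y \<subseteq> ext B x}"
      using x by (auto simp: is_set_B)
    ultimately show "small {y. is_set B y \<and> ext B y \<subseteq> ext B x}" by simp
    show "{y. is_set B y \<and> ext B y \<subseteq> ext B x} = {y \<in> hs. y \<notin> ext B (AtomSet B) \<and> ext B y \<subseteq> ext B x}"
      using AtomSet_hs by (auto simp: is_set_B is_set_def atoms_def)
  qed (use x in auto)
  show "\<exists>I. inductive_set_in B I" using inductive_omega_B by blast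
  show "\<exists>y\<in>ext B x. ext B y \<inter> ext B x = {}" if x: "x \<in> Dom B" "ext B x \<noteq> {}" for x
  proof -
    have "small (ext M x)" "ext M x \<noteq> {}" using x by (auto intro: small_ext)
    then obtain y where "y \<in> ext M x" "ext M y \<inter> ext M x = {}" by (rule foundation)
    then show ?thesis using x hs_ext by auto
  qed
qed (rule separation_B, rule replacement_B)

end

context zfa_model
begin

subsection \<open>The forcing conditions\<close>

lemma Q_set_Dom: "Q_set M \<subseteq> Dom M"
  unfolding Q_set_def using fun_on_Dom by blast

text \<open>\<open>zero_in M\<close> and \<open>one_in M\<close> are definite descriptions, not
  terms, so they are supplied as parameters; the premise records this.\<close>

lemma dcl_Q_set [dfn_intro]:
  assumes "{zero_in M, one_in M} \<subseteq> set ps"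
  shows "dcl M ps (\<lambda>e. Q_set M)"
proof -
  have "Q_set M = {h \<in> Dom M. \<exists>D\<in>Dom M. is_set M D \<and> ext M D \<subseteq> omega M \<and> finite_in M (ext M D) \<and>
     fun_on M h (ext M D) {zero_in M, one_in M}}"
    using Q_set_Dom unfolding Q_set_def is_set_def by blast
  then show ?thesis using assms by (simp only:) (intro dfn_intro, auto)
qed

lemma dcl_I_set [dfn_intro]:
  assumes "{zero_in M, one_in M} \<subseteq> set ps"
  shows "dcl M ps (\<lambda>e. I_set M)"
  unfolding I_set_def using assms by (intro dfn_intro) auto

lemma dcl_domain_of [dfn_intro]:
  assumes "trm M ps h"
  shows "dcl M ps (\<lambda>e. domain_of M (h e))"
  unfolding domain_of_def by (intro dfn_intro trm_shift[OF assms])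

lemma Q_setI:
  assumes "n \<in> omega M" "fun_on M h (ext M n) {zero_in M, one_in M}"
  shows "h \<in> Q_set M"
  unfolding Q_set_def
  using assms is_set_omega omega_ext_subset finite_ext_omega by blast

lemma domain_of_fun:
  assumes "fun_on M h K L"
  shows "domain_of M h = K"
proof (intro equalityI subsetI)
  fix k assume "k \<in> domain_of M h"
  then obtain v where "rel M h k v" unfolding domain_of_def by blast
  then show "k \<in> K" using fun_on_rel[OF assms] by blast
next
  fix k assume k: "k \<in> K"
  then have "rel M h k (app M h k)" using rel_iff_app[OF assms k] by simp
  then show "k \<in> domain_of M h" unfolding domain_of_def using rel_Dom[of h k "app M h k"] by blast
qed

lemma small_Q_set: "small (Q_set M)"
proof -
  let ?P = "{h. is_set M h \<and> ext M h \<subseteq> {p. \<exists>a\<in>omega M. \<exists>b\<in>{zero_in M, one_in M}. p = opr a b}}"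
  have "small ?P" by (intro small_Pow small_prod small_omega small_pair) auto
  then have "small {h \<in> ?P. h \<in> Q_set M}"
  proof (rule sep[where ps="[zero_in M, one_in M]"])
  qed (auto intro!: dfn_intro)
  moreover have "h \<in> ?P" if h: "h \<in> Q_set M" for h
  proof -
    obtain D where D: "ext M D \<subseteq> omega M" "fun_on M h (ext M D) {zero_in M, one_in M}"
      using h unfolding Q_set_def by blast
    have "ext M h \<subseteq> {p. \<exists>a\<in>omega M. \<exists>b\<in>{zero_in M, one_in M}. p = opr a b}"
      unfolding fun_on_ext[OF D(2)] using app_in[OF D(2)] D(1) by blast
    then show ?thesis using fun_on_set[OF D(2)] by blast
  qed
  then have "{h \<in> ?P. h \<in> Q_set M} = Q_set M" by blast
  ultimately show ?thesis by simp
qed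

lemma P_level_fun:
  assumes "f \<in> P_level M n"
  shows "fun_on M f (atoms M) (Q_set M)"
  using assms by (simp add: P_level_def)

lemma P_level_app:
  assumes "f \<in> P_level M n" "a \<in> atoms M"
  shows "fun_on M (app M f a) (ext M n) {zero_in M, one_in M}"
proof -
  have "app M f a \<in> Q_set M" by (rule app_in[OF P_level_fun[OF assms(1)] assms(2)])
  then obtain D where D: "fun_on M (app M f a) (ext M D) {zero_in M, one_in M}"
    unfolding Q_set_def by blast
  moreover have "domain_of M (app M f a) = ext M n" using assms by (simp add: P_level_def)
  ultimately show ?thesis using domain_of_fun by simp
qed

lemma dcl_P_level [dfn_intro]:
  assumes n: "trm M ps n" and ps: "{zero_in M, one_in M} \<subseteq> set ps"
  shows "dcl M ps (\<lambda>e. P_level M (n e))"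
proof -
  \<comment> \<open>\<open>P_level\<close> with every occurrence of \<open>app\<close> replaced by
    \<open>rel\<close>, hence definable as it stands.\<close>
  define S where "S k = {f \<in> Dom M. fun_on M f (atoms M) (Q_set M) \<and>
     (\<forall>a\<in>atoms M. \<forall>h\<in>Dom M. rel M f a h \<longrightarrow> domain_of M h = ext M k) \<and>
     countable_in M {a \<in> atoms M. \<exists>h\<in>I_set M. rel M f a h} \<and>
     (\<forall>t\<in>Dom M. fun_on M t (ext M k) {zero_in M, one_in M} \<longrightarrow> \<not> finite_in M {a \<in> atoms M. rel M f a t})}" for k
  have "dcl M ps (\<lambda>e. S (n e))"
    unfolding S_def using ps by (intro dfn_intro trm_shift[OF n]) auto
  moreover have "S k = P_level M k" for k
  proof -
    have "f \<in> S k \<longleftrightarrow> f \<in> P_level M k" if f: "fun_on M f (atoms M) (Q_set M)" for f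
    proof -
      have r: "rel M f a h \<longleftrightarrow> h = app M f a" if "a \<in> atoms M" for a h
        by (rule rel_iff_app[OF f that])
      have "{a \<in> atoms M. \<exists>h\<in>I_set M. rel M f a h} = {a \<in> atoms M. app M f a \<in> I_set M}"
        using r by auto
      moreover have "{a \<in> atoms M. rel M f a t} = {a \<in> atoms M. app M f a = t}" for t
        using r by auto
      moreover have "(\<forall>h\<in>Dom M. rel M f a h \<longrightarrow> domain_of M h = ext M k)
        \<longleftrightarrow> domain_of M (app M f a) = ext M k"
        if "a \<in> atoms M" for a using r[OF that] app_Dom[OF f that] by simp
      moreover have "f \<in> Dom M" using fun_on_Dom[OF f] by blast
      moreover have "t \<in> Dom M" if "fun_on M t K L" for t K L using fun_on_Dom[OF that] by blast
      ultimately show ?thesis unfolding S_def P_level_def using f by auto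
    qed
    moreover have "fun_on M f (atoms M) (Q_set M)" if "f \<in> S k" for f
      using that unfolding S_def by (elim CollectE conjE)
    ultimately show ?thesis using P_level_fun by blast
  qed
  ultimately show ?thesis by simp
qed

lemma P_set_Dom: "P_set M \<subseteq> Dom M"
  unfolding P_set_def using P_level_fun fun_on_Dom by blast

lemma dcl_P_set [dfn_intro]:
  assumes ps: "{zero_in M, one_in M} \<subseteq> set ps"
  shows "dcl M ps (\<lambda>e. P_set M)"
proof -
  have "P_set M = {f \<in> Dom M. \<exists>n\<in>omega M. f \<in> P_level M n}"
    using P_set_Dom unfolding P_set_def by blast
  then show ?thesis using ps by (simp only:) (intro dfn_intro)
qed

lemma small_P_set: "small (P_set M)"
proof -
  have "small {f \<in> {f. fun_on M f (atoms M) (Q_set M)}. f \<in> P_set M}"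
  proof (rule sep[where ps="[zero_in M, one_in M]", OF small_funs[OF small_atoms small_Q_set]])
  qed (auto intro!: dfn_intro)
  moreover have "{f \<in> {f. fun_on M f (atoms M) (Q_set M)}. f \<in> P_set M} = P_set M"
    unfolding P_set_def using P_level_fun by blast
  ultimately show ?thesis by simp
qed

lemma P_set_fun: "f \<in> P_set M \<Longrightarrow> fun_on M f (atoms M) (Q_set M)"
  unfolding P_set_def using P_level_fun by blast

lemma le_P_iff:
  assumes "f \<in> P_set M" "g \<in> P_set M"
  shows "le_P M f g \<longleftrightarrow> (\<forall>a\<in>atoms M. \<forall>x\<in>Dom M. \<forall>y\<in>Dom M. rel M f a x \<longrightarrow> rel M g a y
    \<longrightarrow> ext M y \<subseteq> ext M x)"
  unfolding le_P_def le_Q_def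
  using rel_iff_app[OF P_set_fun[OF assms(1)]] rel_iff_app[OF P_set_fun[OF assms(2)]]
    app_Dom[OF P_set_fun[OF assms(1)]] app_Dom[OF P_set_fun[OF assms(2)]] by auto

lemma fun_extend:
  assumes h: "fun_on M h K L" and m: "m \<notin> K" "m \<in> Dom M" and v: "v \<in> L"
  defines "h' \<equiv> mk (insert (opr m v) (ext M h))"
  shows "fun_on M h' (insert m K) L" "ext M h' = insert (opr m v) (ext M h)"
    "app M h' m = v" "\<And>k. k \<in> K \<Longrightarrow> app M h' k = app M h k"
proof -
  have D: "h \<in> Dom M" "K \<subseteq> Dom M" "L \<subseteq> Dom M" using fun_on_Dom[OF h] by auto
  have sm: "small (insert (opr m v) (ext M h))"
    using D m v by (intro small_insert small_ext opr_in) auto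
  show ext: "ext M h' = insert (opr m v) (ext M h)" unfolding h'_def by (rule ext_mk[OF sm])
  define G where "G k = (if k = m then v else app M h k)" for k
  have eq: "ext M h' = (\<lambda>k. opr k (G k)) ` insert m K"
    unfolding ext fun_on_ext[OF h] using m(1) by (auto simp: G_def)
  have s: "is_set M h'" unfolding h'_def by (rule is_set_mk[OF sm])
  have sub: "insert m K \<subseteq> Dom M" "G ` insert m K \<subseteq> L" using m D v app_in[OF h] by (auto simp: G_def)
  show "fun_on M h' (insert m K) L" by (rule fun_onI(1)[OF s eq sub D(3)])
  note app = fun_onI(2)[OF s eq sub D(3)]
  show "app M h' m = v" using app[of m] by (simp add: G_def)
  show "app M h' k = app M h k" if "k \<in> K" for k using app[of k] that m(1) by (auto simp: G_def)
qed

text \<open>The new bit at \<open>m\<close> is 0 on \<open>C\<close> and 1 off \<open>C\<close>. New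
  atoms enter the preimage of \<open>I_set M\<close> only from \<open>C\<close>, and the fibre of
  \<open>t\<close> is the fibre of its restriction to \<open>m\<close>, either met with
  \<open>C\<close> or freed of \<open>C\<close> according to the bit of \<open>t\<close> at
  \<open>m\<close>. Stated for ZFA with \<open>C\<close> given, so that it can be applied inside the
  permutation model.\<close>

lemma P_level_extend:
  assumes f: "f \<in> P_level M m" and m: "m \<in> omega M"
    and C: "small C" "C \<subseteq> atoms M" "countable_in M ({a \<in> atoms M. app M f a \<in> I_set M} \<union> C)"
    and inf: "\<And>s. fun_on M s (ext M m) {zero_in M, one_in M} \<Longrightarrow>
      \<not> finite_in M ({a \<in> atoms M. app M f a = s} \<inter> C) \<and> \<not> finite_in M ({a \<in> atoms M. app M f a = s} - C)"
  shows "\<exists>d\<in>P_level M (suc m). le_P M d f"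
proof -
  let ?T = "{zero_in M, one_in M}"
  have mD: "m \<in> Dom M" using m by blast
  have mm: "m \<notin> ext M m" using not_in_self mD by blast
  have fD: "f \<in> Dom M" using fun_on_Dom[OF P_level_fun[OF f]] by blast
  have ext_suc: "ext M (suc m) = insert m (ext M m)" using mD by simp
  define c where "c = mk C"
  have c: "c \<in> Dom M" "ext M c = C" using C(1) by (auto simp: c_def mk_props)
  define v where "v a = (if a \<in> C then zero_in M else one_in M)" for a
  define F where "F a = mk (insert (opr m (v a)) (ext M (app M f a)))" for a
  have vT: "v a \<in> ?T" for a by (simp add: v_def)
  note q = P_level_app[OF f]
  have F: "fun_on M (F a) (insert m (ext M m)) ?T"
    "ext M (F a) = insert (opr m (v a)) (ext M (app M f a))"
    "app M (F a) m = v a" "\<And>k. k \<in> ext M m \<Longrightarrow> app M (F a) k = app M (app M f a) k"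
    if "a \<in> atoms M" for a
    unfolding F_def by (rule fun_extend[OF q[OF that] mm mD vT]; assumption)+
  have FQ: "F a \<in> Q_set M" if "a \<in> atoms M" for a
    using Q_setI[OF omega_inductive(2)[OF m]] F(1)[OF that] unfolding ext_suc by blast
  obtain d where d: "fun_on M d (atoms M) (Q_set M)" "\<And>a. a \<in> atoms M \<Longrightarrow> app M d a = F a"
  proof (rule make_fun[where K="atoms M" and L="Q_set M" and F=F and ps="[f, c, m, zero_in M, one_in M]"
      and R="\<lambda>a h. is_set M h \<and> (\<exists>q\<in>Dom M. \<exists>z\<in>Dom M. rel M f a q \<and>
        (if a \<in> ext M c then opair M m (zero_in M) z else opair M m (one_in M) z) \<and> ext M h = insert z (ext M q))"])
    show "is_set M h \<and> (\<exists>q\<in>Dom M. \<exists>z\<in>Dom M. rel M f a q \<and>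
        (if a \<in> ext M c then opair M m (zero_in M) z else opair M m (one_in M) z) \<and> ext M h = insert z (ext M q))
        \<longleftrightarrow> h = F a" if a: "a \<in> atoms M" for a h
    proof -
      have 1: "rel M f a q \<longleftrightarrow> q = app M f a" for q by (rule rel_iff_app[OF P_level_fun[OF f] a])
      have 2: "(if a \<in> ext M c then opair M m (zero_in M) z else opair M m (one_in M) z)
        \<longleftrightarrow> z = opr m (v a)" for z
        unfolding c(2) v_def using mD by (simp add: opair_iff)
      have 3: "app M f a \<in> Dom M" "opr m (v a) \<in> Dom M"
        using app_Dom[OF P_level_fun[OF f] a] mD by (auto simp: v_def)
      have "is_set M h \<and> ext M h = insert (opr m (v a)) (ext M (app M f a)) \<longleftrightarrow> h = F a"
        using is_set_eqI[of h "F a"] F(2)[OF a] fun_on_set[OF F(1)[OF a]] by auto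
      then show ?thesis unfolding 1 2 using 3 by auto
    qed
  qed (use fD c mD small_atoms FQ Q_set_Dom in \<open>auto intro!: dfn_intro\<close>)
  have ap: "fun_on M (F a) (insert m (ext M m)) ?T" "app M (F a) m = v a"
    "\<And>k. k \<in> ext M m \<Longrightarrow> app M (F a) k = app M (app M f a) k" if "a \<in> atoms M" for a
    using F(1,3,4)[OF that] by auto
  have "d \<in> P_level M (suc m)"
    unfolding P_level_def mem_Collect_eq
  proof (intro conjI ballI allI impI)
    show "domain_of M (app M d a) = ext M (suc m)" if "a \<in> atoms M" for a
      using domain_of_fun[OF ap(1)[OF that]] d(2)[OF that] ext_suc by simp
    have "small {a \<in> atoms M. app M d a \<in> I_set M}"
    proof -
      have dD: "d \<in> Dom M" using fun_on_Dom[OF d(1)] by blast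
      have "small {a \<in> atoms M. \<exists>h\<in>I_set M. rel M d a h}"
      proof (rule sep[where ps="[d, zero_in M, one_in M]", OF small_atoms])
      qed (use dD in \<open>auto intro!: dfn_intro\<close>)
      moreover have "{a \<in> atoms M. \<exists>h\<in>I_set M. rel M d a h} = {a \<in> atoms M. app M d a \<in> I_set M}"
        using rel_iff_app[OF d(1)] by auto
      ultimately show ?thesis by simp
    qed
    moreover have "{a \<in> atoms M. app M d a \<in> I_set M} \<subseteq> {a \<in> atoms M. app M f a \<in> I_set M} \<union> C"
    proof
      fix a assume "a \<in> {a \<in> atoms M. app M d a \<in> I_set M}"
      then have a: "a \<in> atoms M" and "F a \<in> I_set M" using d(2) by auto
      then obtain k where k: "k \<in> omega M" "rel M (F a) k (zero_in M)" unfolding I_set_def by blast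
      have k': "k \<in> insert m (ext M m)" using fun_on_rel[OF ap(1)[OF a] k(2)] by blast
      have z: "app M (F a) k = zero_in M" using rel_iff_app[OF ap(1)[OF a] k'] k(2) by simp
      show "a \<in> {a \<in> atoms M. app M f a \<in> I_set M} \<union> C"
      proof (cases "k = m")
        case True
        then have "a \<in> C" using z ap(2)[OF a] by (simp add: v_def split: if_splits)
        then show ?thesis by blast
      next
        case False
        then have km: "k \<in> ext M m" using k' by blast
        then have "rel M (app M f a) k (zero_in M)"
          using ap(3)[OF a km] z rel_iff_app[OF q[OF a] km] by simp
        then have "app M f a \<in> I_set M" unfolding I_set_def using Q_setI[OF m q[OF a]] k(1) by blast
        then show ?thesis using a by blast
      qed
    qed
    ultimately show "countable_in M {a \<in> atoms M. app M d a \<in> I_set M}"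
      using countable_subset[OF C(3)] by blast
  next
    fix t assume t: "fun_on M t (ext M (suc m)) ?T"
    then have t: "fun_on M t (insert m (ext M m)) ?T" unfolding ext_suc .
    have tD: "t \<in> Dom M" using fun_on_Dom[OF t] by blast
    obtain s where s: "fun_on M s (ext M m) ?T" "\<And>k. k \<in> ext M m \<Longrightarrow> app M s k = app M t k"
    proof (rule make_fun[where K="ext M m" and L="?T" and F="app M t" and ps="[t]" and R="rel M t"])
      show "rel M t k y \<longleftrightarrow> y = app M t k" if "k \<in> ext M m" for k y
        using rel_iff_app[OF t] that by blast
      show "app M t ` ext M m \<subseteq> ?T" using app_in[OF t] by blast
    qed (use tD small_ext[OF mD] in \<open>auto intro!: dfn_intro\<close>)
    \<comment> \<open>Both sides are functions on \<open>suc m\<close>, so they are compared by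
      their restrictions to \<open>m\<close>, which are \<open>app M f a\<close> and
      \<open>s\<close>, and by their last bits.\<close>
    have eq: "F a = t \<longleftrightarrow> app M f a = s \<and> v a = app M t m" if a: "a \<in> atoms M" for a
    proof
      assume "F a = t"
      then show "app M f a = s \<and> v a = app M t m"
        using ap(2,3)[OF a] s(2) by (auto intro: fun_on_eqI[OF q[OF a] s(1)])
    next
      assume "app M f a = s \<and> v a = app M t m"
      then show "F a = t"
        using ap(2,3)[OF a] s(2) by (intro fun_on_eqI[OF ap(1)[OF a] t]) auto
    qed
    have "app M t m \<in> ?T" using app_in[OF t] by blast
    then consider "app M t m = zero_in M" | "app M t m = one_in M" by blast
    then have "{a \<in> atoms M. app M d a = t} = {a \<in> atoms M. app M f a = s} \<inter> C
      \<or> {a \<in> atoms M. app M d a = t} = {a \<in> atoms M. app M f a = s} - C"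
    proof cases
      case 1
      then have "app M d a = t \<longleftrightarrow> app M f a = s \<and> a \<in> C" if "a \<in> atoms M" for a
        unfolding d(2)[OF that] eq[OF that] by (simp add: v_def)
      then show ?thesis by blast
    next
      case 2
      then have "app M d a = t \<longleftrightarrow> app M f a = s \<and> a \<notin> C" if "a \<in> atoms M" for a
        unfolding d(2)[OF that] eq[OF that] by (simp add: v_def)
      then show ?thesis by blast
    qed
    then show "\<not> finite_in M {a \<in> atoms M. app M d a = t}" using inf[OF s(1)] by auto
  qed (rule d(1))
  moreover have "le_P M d f"
    unfolding le_P_def le_Q_def
  proof
    fix a assume a: "a \<in> atoms M"
    show "ext M (app M f a) \<subseteq> ext M (app M d a)" using F(2)[OF a] d(2)[OF a] by auto
  qed
  ultimately show ?thesis by blast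
qed

text \<open>The premise \<open>extend\<close> isolates the step that draws on choice; for the
  permutation model it is established with the help of \<open>V\<close>, and everything else is an
  argument in ZFA about conditions and a filter.\<close>

lemma generic_countable:
  assumes extend: "\<And>m f. m \<in> omega M \<Longrightarrow> f \<in> P_level M m \<Longrightarrow> \<exists>d\<in>P_level M (suc m). le_P M d f"
    and G: "generic_filter M (P_set M) (le_P M) G" and n: "n \<in> omega M"
  shows "\<exists>X. is_set M X \<and>
     ext M X = {a \<in> atoms M. \<exists>f\<in>G. \<exists>k\<in>ext M n. rel M (app M f a) k (zero_in M)} \<and>
     countable_in M (ext M X)"
proof -
  have nD: "n \<in> Dom M" using n by blast
  \<comment> \<open>Level at least \<open>k\<close>, with the order of the numbers expressed by
    inclusion of their extensions.\<close>
  define L where "L k d \<longleftrightarrow> (\<exists>m\<in>omega M. ext M k \<subseteq> ext M m \<and> d \<in> P_level M m)" for k d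
  have L_P: "d \<in> P_set M" if "L k d" for k d using that unfolding L_def P_set_def by blast
  have dense: "\<exists>d. L n d \<and> le_P M d f" if f: "f \<in> P_set M" for f
  proof -
    \<comment> \<open>A definable version of \<open>le_P\<close>, needed because density is proved
      by induction inside the structure; on conditions the two coincide.\<close>
    define le where "le f g \<longleftrightarrow> (\<forall>a\<in>atoms M. \<forall>x\<in>Dom M. \<forall>y\<in>Dom M.
        rel M f a x \<longrightarrow> rel M g a y \<longrightarrow> ext M y \<subseteq> ext M x)" for f g
    have le: "le f g \<longleftrightarrow> le_P M f g" if "f \<in> P_set M" "g \<in> P_set M" for f g
      unfolding le_def by (rule le_P_iff[OF that, symmetric])
    have "\<forall>f\<in>P_set M. \<exists>d\<in>P_set M. L n d \<and> le d f"
    proof (rule omega_induct[where ps="[zero_in M, one_in M]", OF n])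
      show "dfn M [zero_in M, one_in M] (\<lambda>e. \<forall>f\<in>P_set M. \<exists>d\<in>P_set M. L (e 0) d \<and> le d f)"
        unfolding L_def le_def by (intro dfn_intro) auto
      show "\<forall>f\<in>P_set M. \<exists>d\<in>P_set M. L (zero_in M) d \<and> le d f"
      proof
        fix f assume f: "f \<in> P_set M"
        then have "L (zero_in M) f" unfolding L_def P_set_def by auto
        moreover have "le_P M f f" unfolding le_P_def le_Q_def by blast
        ultimately show "\<exists>d\<in>P_set M. L (zero_in M) d \<and> le d f" using f le by blast
      qed
      fix k assume k: "k \<in> omega M" and IH: "\<forall>f\<in>P_set M. \<exists>d\<in>P_set M. L k d \<and> le d f"
      show "\<forall>f\<in>P_set M. \<exists>d\<in>P_set M. L (suc k) d \<and> le d f"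
      proof
        fix f assume f: "f \<in> P_set M"
        then obtain g where g: "g \<in> P_set M" "L k g" "le g f" using IH by blast
        then obtain m where m: "m \<in> omega M" "ext M k \<subseteq> ext M m" "g \<in> P_level M m" unfolding L_def
          by blast
        show "\<exists>d\<in>P_set M. L (suc k) d \<and> le d f"
        proof (cases "k \<in> ext M m")
          case True
          then have "L (suc k) g" unfolding L_def using m k by auto
          then show ?thesis using g by blast
        next
          case False
          \<comment> \<open>By linearity \<open>g\<close> has level exactly \<open>k\<close>, so
            that a single extension reaches \<open>suc k\<close>.\<close>
          then have "k = m" using omega_linear[OF k m(1)] m(2) not_in_self[of m] m(1) by blast
          then obtain d where d: "d \<in> P_level M (suc k)" "le_P M d g" using extend[OF m(1,3)]
            by blast
          then have "L (suc k) d" unfolding L_def using omega_inductive(2)[OF k] by blast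
          moreover have "d \<in> P_set M" using L_P[OF \<open>L (suc k) d\<close>] .
          moreover have "le_P M g f" using g f le by blast
          then have "le_P M d f" using d(2) unfolding le_P_def le_Q_def by blast
          ultimately show ?thesis using le f by blast
        qed
      qed
    qed auto
    then show ?thesis using f le by blast
  qed
  have "small {d \<in> P_set M. L n d}"
  proof (rule sep[where ps="[n, zero_in M, one_in M]", OF small_P_set])
    show "dfn M [n, zero_in M, one_in M] (\<lambda>e. L n (e 0))"
      unfolding L_def using nD by (intro dfn_intro) auto
  qed (use nD in auto)
  then obtain D where D: "is_set M D" "ext M D = {d \<in> P_set M. L n d}" unfolding small_def by blast
  have GP: "G \<subseteq> P_set M" and directed: "\<And>p q. p \<in> G \<Longrightarrow> q \<in> G \<Longrightarrow> \<exists>r\<in>G. le_P M r p \<and> le_P M r q"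
    and meets: "\<And>D. is_set M D \<Longrightarrow> ext M D \<subseteq> P_set M \<Longrightarrow> (\<forall>p\<in>P_set M. \<exists>d\<in>ext M D. le_P M d p)
      \<Longrightarrow> G \<inter> ext M D \<noteq> {}"
    using G unfolding generic_filter_def by blast+
  have "G \<inter> ext M D \<noteq> {}"
    by (rule meets[OF D(1)]) (use D(2) dense L_P in blast)+
  then obtain f m where f: "f \<in> G" "m \<in> omega M" "ext M n \<subseteq> ext M m" "f \<in> P_level M m"
    unfolding D(2) L_def by blast
  have fD: "f \<in> Dom M" using fun_on_Dom[OF P_level_fun[OF f(4)]] by blast
  note q = P_level_app[OF f(4)]
  let ?X = "{a \<in> atoms M. \<exists>k\<in>ext M n. rel M (app M f a) k (zero_in M)}"
  \<comment> \<open>A common extension \<open>r\<close> of \<open>g\<close> and \<open>f\<close>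
    contains both values at \<open>k\<close>. As \<open>k\<close> is below the level of
    \<open>f\<close>, the value of \<open>f\<close> exists, and it must be 0 like that of
    \<open>g\<close>.\<close>
  have "rel M (app M f a) k (zero_in M)"
    if a: "a \<in> atoms M" and g: "g \<in> G" and k: "k \<in> ext M n"
      and z: "rel M (app M g a) k (zero_in M)" for a g k
  proof -
    obtain r where r: "r \<in> G" "le_P M r g" "le_P M r f" using directed[OF g f(1)] by blast
    then obtain l where l: "r \<in> P_level M l" using GP unfolding P_set_def by blast
    have sub: "ext M (app M g a) \<subseteq> ext M (app M r a)" "ext M (app M f a) \<subseteq> ext M (app M r a)"
      using r a unfolding le_P_def le_Q_def by auto
    have km: "k \<in> ext M m" using k f(3) by blast
    have "rel M (app M r a) k (zero_in M)" using z sub(1) unfolding rel_def by blast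
    moreover have rk: "rel M (app M f a) k (app M (app M f a) k)" using rel_iff_app[OF q[OF a] km]
      by simp
    then have "rel M (app M r a) k (app M (app M f a) k)" using sub(2) unfolding rel_def by blast
    ultimately have "zero_in M = app M (app M f a) k"
      using fun_on_rel[OF P_level_app[OF l a]] rel_iff_app[OF P_level_app[OF l a]] by metis
    then show ?thesis using rk by simp
  qed
  then have X: "{a \<in> atoms M. \<exists>f\<in>G. \<exists>k\<in>ext M n. rel M (app M f a) k (zero_in M)} = ?X"
    using f(1) by blast
  have "small {a \<in> atoms M. \<exists>h\<in>Dom M. rel M f a h \<and> (\<exists>k\<in>ext M n. rel M h k (zero_in M))}"
  proof (rule sep[where ps="[f, n, zero_in M]", OF small_atoms])
  qed (use fD nD in \<open>auto intro!: dfn_intro\<close>)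
  moreover have "{a \<in> atoms M. \<exists>h\<in>Dom M. rel M f a h \<and> (\<exists>k\<in>ext M n. rel M h k (zero_in M))} = ?X"
    using rel_iff_app[OF P_level_fun[OF f(4)]] app_Dom[OF P_level_fun[OF f(4)]] by auto
  ultimately have sm: "small ?X" by simp
  have "countable_in M {a \<in> atoms M. app M f a \<in> I_set M}" using f(4) unfolding P_level_def by blast
  moreover have "?X \<subseteq> {a \<in> atoms M. app M f a \<in> I_set M}"
    unfolding I_set_def using Q_setI[OF f(2) q] omega_ext_subset[OF n] by blast
  ultimately have "countable_in M ?X" using sm by (rule countable_subset)
  then show ?thesis unfolding X using mk_props[OF sm] by (intro exI[of _ "mk ?X"]) simp
qed

end

context zfac_model
begin

subsection \<open>Absoluteness for the permutation model\<close>

interpretation B: zfa_model B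
  by unfold_locales (rule zfa_perm_model)

text \<open>The two sets that make up a Kuratowski pair are its elements, so they belong to
  \<open>B\<close> as soon as the pair does.\<close>

lemma opair_B:
  assumes p: "p \<in> hs"
  shows "opair B a b p \<longleftrightarrow> opair M a b p"
proof
  assume "opair B a b p"
  then obtain u v where "u \<in> hs" "v \<in> hs" "ext B u = {a}" "ext B v = {a, b}" "ext B p = {u, v}"
    unfolding opair_def by auto
  then show "opair M a b p" using p unfolding opair_def by auto
next
  assume "opair M a b p"
  then obtain u v where uv: "ext M u = {a}" "ext M v = {a, b}" "ext M p = {u, v}"
    unfolding opair_def by auto
  then have "u \<in> hs" "v \<in> hs" using hs_ext[OF p] by auto
  then show "opair B a b p" unfolding opair_def using uv p by auto
qed

lemma rel_B: "f \<in> hs \<Longrightarrow> rel B f a b \<longleftrightarrow> rel M f a b"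
  unfolding rel_def using opair_B hs_ext by auto

lemma rel_hs: "f \<in> hs \<Longrightarrow> rel M f a b \<Longrightarrow> a \<in> hs \<and> b \<in> hs"
  using B.rel_Dom[of f a b] rel_B by simp

lemma app_B: "f \<in> hs \<Longrightarrow> app B f a = app M f a"
proof -
  assume f: "f \<in> hs"
  have "b \<in> Dom B \<and> rel B f a b \<longleftrightarrow> b \<in> Dom M \<and> rel M f a b" for b
    using rel_B[OF f] rel_hs[OF f, of a b] by auto
  then show ?thesis unfolding app_def by simp
qed

lemma fun_on_B: "fun_on B f K L \<longleftrightarrow> f \<in> hs \<and> K \<subseteq> hs \<and> L \<subseteq> hs \<and> fun_on M f K L"
proof (cases "f \<in> hs \<and> K \<subseteq> hs \<and> L \<subseteq> hs")
  case True
  then have "opair B a b p \<longleftrightarrow> opair M a b p" if "p \<in> ext M f" for a b p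
    using opair_B hs_ext that by blast
  moreover have "K \<subseteq> Dom M" "L \<subseteq> Dom M" using True by auto
  ultimately show ?thesis unfolding fun_on_def using True by (simp add: is_set_B rel_B)
next
  case False
  then show ?thesis unfolding fun_on_def is_set_B by auto
qed

text \<open>An inductive set of \<open>B\<close> is inductive in \<open>M\<close>, and the set of
  numbers of \<open>M\<close> is inductive in \<open>B\<close>; each fact gives one
  inclusion.\<close>

lemma omega_B: "omega B = omega M"
proof (intro equalityI subsetI)
  have ind: "inductive_set_in M I" if "inductive_set_in B I" for I
  proof -
    have I: "I \<in> hs" "is_set M I" using that unfolding inductive_set_in_def is_set_B by auto
    then have "ext B I = ext M I" "ext M I \<subseteq> hs" using hs_ext by auto
    then show ?thesis
      using that I(2) unfolding inductive_set_in_def is_set_B by (auto simp: subset_iff)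
  qed
  fix n
  show "n \<in> omega B" if "n \<in> omega M"
    unfolding omega_def
  proof (intro CollectI conjI allI impI)
    show "n \<in> Dom B" using omega_hs[OF that] by simp
    fix I assume I: "inductive_set_in B I"
    then have "I \<in> hs" unfolding inductive_set_in_def is_set_B by blast
    then show "n \<in> ext B I" using ind[OF I] that unfolding omega_def by simp
  qed
next
  fix n assume "n \<in> omega B"
  then have "n \<in> ext B (mk (omega M))" using inductive_omega_B unfolding omega_def by blast
  then show "n \<in> omega M" using omega_set_hs by (simp add: ext_mk[OF small_omega])
qed

lemma act_pair:
  assumes \<pi>: "\<pi> \<in> perms M" and g: "a \<in> grounded" "b \<in> grounded"
  shows "act M \<pi> (mk {a, b}) = mk {act M \<pi> a, act M \<pi> b}" "mk {a, b} \<in> grounded"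
proof -
  have sm: "small {a, b}" using g by (intro small_pair) auto
  show p: "mk {a, b} \<in> grounded"
    by (rule grounded_setI) (use mk_props[OF sm] g in auto)
  have "mk {act M \<pi> a, act M \<pi> b} = act M \<pi> (mk {a, b})"
    by (rule mk_eq) (use is_set_act[OF \<pi> p] ext_act[OF \<pi> p] mk_props[OF sm] in auto)
  then show "act M \<pi> (mk {a, b}) = mk {act M \<pi> a, act M \<pi> b}" by simp
qed

lemma act_opr:
  assumes \<pi>: "\<pi> \<in> perms M" and g: "a \<in> grounded" "b \<in> grounded"
  shows "act M \<pi> (opr a b) = opr (act M \<pi> a) (act M \<pi> b)"
  using act_pair[OF \<pi> g(1) g(1)] act_pair[OF \<pi> g] act_pair(1)[OF \<pi>, of "mk {a}" "mk {a, b}"]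
  unfolding opr_def by simp

text \<open>Pairing in \<open>B\<close> produces an ordered pair there, and absoluteness identifies
  it with the pair formed in \<open>M\<close>; this avoids computing a support.\<close>

lemma opr_hs:
  assumes "a \<in> hs" "b \<in> hs"
  shows "opr a b \<in> hs"
proof -
  have p: "B.opr a b \<in> hs" using B.opr_in[of a b] assms by simp
  have "opair B a b (B.opr a b)" using B.opair_iff[of a b] assms by simp
  then have "opair M a b (B.opr a b)" using opair_B[OF p] by simp
  then show ?thesis using opair_iff[of a b] assms p by simp
qed

text \<open>A permutation fixing the arguments and the values of \<open>g\<close> fixes each of its
  pairs, so \<open>C\<close> supports \<open>g\<close>. For functions between a set of atoms and
  numbers, \<open>C\<close> is that set of atoms, since every permutation fixes the numbers.\<close>

lemma fixed_fun_hs: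
  assumes g: "fun_on M g K L" "K \<subseteq> hs" "L \<subseteq> hs"
    and C: "C \<subseteq> atoms M" "countable_in M C"
    and fixed: "\<And>\<pi> k. \<pi> \<in> perms M \<Longrightarrow> (\<And>a. a \<in> C \<Longrightarrow> app M \<pi> a = a) \<Longrightarrow> k \<in> K \<Longrightarrow>
      act M \<pi> k = k \<and> act M \<pi> (app M g k) = app M g k"
  shows "g \<in> hs"
proof -
  note c = mk_props[OF countable_small[OF C(2)]]
  have ext: "ext M g = (\<lambda>k. opr k (app M g k)) ` K" by (rule fun_on_ext[OF g(1)])
  have gk: "app M g k \<in> hs" if "k \<in> K" for k using app_in[OF g(1) that] g(3) by blast
  have sub: "ext M g \<subseteq> hs" unfolding ext using opr_hs gk g(2) by blast
  have s: "is_set M g" by (rule fun_on_set[OF g(1)])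
  have gr: "g \<in> grounded" by (rule grounded_setI[OF s]) (use sub hs_grounded in blast)
  have "act M \<pi> g = g" if \<pi>: "\<pi> \<in> perms M" "\<And>a. a \<in> C \<Longrightarrow> app M \<pi> a = a" for \<pi>
  proof (rule is_set_eqI)
    show "is_set M (act M \<pi> g)" using is_set_act[OF \<pi>(1) gr] s by simp
    have "act M \<pi> (opr k (app M g k)) = opr k (app M g k)" if "k \<in> K" for k
    proof -
      have "k \<in> grounded" "app M g k \<in> grounded" using that g(2) gk hs_grounded by auto
      then show ?thesis using act_opr[OF \<pi>(1)] fixed[OF \<pi> that] by simp
    qed
    then show "ext M (act M \<pi> g) = ext M g"
      unfolding ext_act[OF \<pi>(1) gr] ext image_image by (intro image_cong) auto
  qed (rule s)
  then have "supports (mk C) g" unfolding supports_iff[OF gr] c(2) using c(1) C by blast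
  then show ?thesis using s sub by (intro hsI) auto
qed

lemma act_fixed_atoms:
  assumes "\<pi> \<in> perms M" "K \<subseteq> atoms M" "\<And>a. a \<in> K \<Longrightarrow> app M \<pi> a = a" "a \<in> K"
  shows "act M \<pi> a = a"
  using act_atom[OF assms(1), of a] assms by auto

lemma omega_sub_hs: "omega M \<subseteq> hs"
  using omega_hs by blast

lemma atoms_sub_hs: "K \<subseteq> atoms M \<Longrightarrow> K \<subseteq> hs"
  using atoms_hs by blast

lemma countable_atoms_B:
  assumes K: "K \<subseteq> atoms M" "countable_in M K"
  shows "countable_in B K"
proof -
  obtain g where g: "fun_on M g K (omega M)" "inj_on (app M g) K"
    using K(2) unfolding countable_in_def by blast
  have "g \<in> hs"
  proof (rule fixed_fun_hs[OF g(1) atoms_sub_hs[OF K(1)] omega_sub_hs K])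
    fix \<pi> k assume "\<pi> \<in> perms M" "\<And>a. a \<in> K \<Longrightarrow> app M \<pi> a = a" "k \<in> K"
    then show "act M \<pi> k = k \<and> act M \<pi> (app M g k) = app M g k"
      using act_fixed_atoms[OF _ K(1)] act_omega app_in[OF g(1)] by blast
  qed
  then have "fun_on B g K (omega B)" "inj_on (app B g) K"
    unfolding fun_on_B omega_B using g atoms_sub_hs[OF K(1)] omega_sub_hs app_B by
      (auto simp: inj_on_def)
  then show ?thesis unfolding countable_in_def by blast
qed

lemma countable_B_M:
  assumes "countable_in B K"
  shows "countable_in M K"
proof -
  obtain g where g: "fun_on B g K (omega B)" "inj_on (app B g) K"
    using assms unfolding countable_in_def by blast
  then have "g \<in> hs" "fun_on M g K (omega M)" unfolding fun_on_B omega_B by auto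
  then show ?thesis unfolding countable_in_def using g(2) app_B by (auto simp: inj_on_def)
qed

lemma finite_B_M:
  assumes "finite_in B K"
  shows "finite_in M K"
proof -
  obtain n g where n: "n \<in> omega M" and g: "fun_on B g (ext M n) K" "bij_betw (app B g) (ext M n) K"
    using assms omega_hs unfolding finite_in_def omega_B by auto
  then have "fun_on M g (ext M n) K" "app B g = app M g" unfolding fun_on_B using app_B by auto
  then show ?thesis unfolding finite_in_def using n g(2) by auto
qed

text \<open>Used contrapositively, it makes the fibres infinite in \<open>M\<close>, where they can
  be split; \<open>finite_B_M\<close> then returns infinite pieces to \<open>B\<close>.\<close>

lemma finite_atoms_B:
  assumes K: "K \<subseteq> atoms M" "finite_in M K"
  shows "finite_in B K"
proof -
  obtain n g where n: "n \<in> omega M" and g: "fun_on M g (ext M n) K" "bij_betw (app M g) (ext M n) K"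
    using K(2) unfolding finite_in_def by blast
  have nh: "ext M n \<subseteq> hs" using omega_hs[OF n] hs_ext by blast
  have gh: "g \<in> hs"
  proof (rule fixed_fun_hs[OF g(1) nh atoms_sub_hs[OF K(1)] K(1) finite_countable[OF K(2)]])
    fix \<pi> k assume "\<pi> \<in> perms M" "\<And>a. a \<in> K \<Longrightarrow> app M \<pi> a = a" "k \<in> ext M n"
    then show "act M \<pi> k = k \<and> act M \<pi> (app M g k) = app M g k"
      using act_fixed_atoms[OF _ K(1)] act_omega omega_ext_subset[OF n] app_in[OF g(1)] by blast
  qed
  then have "fun_on B g (ext M n) K" "app B g = app M g"
    unfolding fun_on_B using g nh atoms_sub_hs[OF K(1)] app_B by auto
  then show ?thesis unfolding finite_in_def omega_B using n g(2) omega_hs[OF n]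
    by (intro bexI[of _ n] exI[of _ g]) auto
qed


subsection \<open>Splitting the fibres of a condition\<close>

text \<open>\<open>H\<close> is the range of one of two disjoint sequences in \<open>K\<close>; the
  other sequence keeps the complement infinite.\<close>

lemma halve:
  assumes K: "small K" "\<not> finite_in M K"
  obtains H where "is_set M H" "ext M H \<subseteq> K" "countable_in M (ext M H)"
    "\<not> finite_in M (ext M H)" "\<not> finite_in M (K - ext M H)"
proof -
  obtain x y where x: "fun_on M x (omega M) K" "inj_on (app M x) (omega M)"
    and y: "fun_on M y (omega M) K" "inj_on (app M y) (omega M)"
    and xy: "\<And>m n. m \<in> omega M \<Longrightarrow> n \<in> omega M \<Longrightarrow> app M x m \<noteq> app M y n"
    using infinite_split[OF K] by metis
  have D: "x \<in> Dom M" "K \<subseteq> Dom M" using fun_on_Dom[OF x(1)] by auto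
  let ?H = "app M x ` omega M"
  have count: "countable_in M ?H"
  proof (rule countable_image[OF countable_omega, where ps="[x]" and R="rel M x"])
    show "?H \<subseteq> Dom M" using app_in[OF x(1)] D(2) by blast
  qed (use D x(2) rel_iff_app[OF x(1)] in \<open>auto intro!: dfn_intro\<close>)
  note H = mk_props[OF countable_small[OF count]]
  show thesis
  proof (rule that[of "mk ?H"], unfold H(2))
    show "\<not> finite_in M ?H" by (rule not_finite_if_sequence[OF x]) simp
    show "\<not> finite_in M (K - ?H)"
      by (rule not_finite_if_sequence[OF y]) (use app_in[OF y(1)] xy in force)
    show "?H \<subseteq> K" using app_in[OF x(1)] by blast
  qed (rule H(1), rule count)
qed

text \<open>Halves are chosen simultaneously for all members, since in the application these are
  indexed by the binary sequences of length \<open>m\<close>, with \<open>m\<close> possibly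
  nonstandard. As the members are disjoint, the union of the halves meets each member in exactly its
  own half.\<close>

lemma halve_family:
  assumes small: "small \<K>" and inf: "\<And>K. K \<in> \<K> \<Longrightarrow> \<not> finite_in M (ext M K)"
    and disj: "\<And>K L. K \<in> \<K> \<Longrightarrow> L \<in> \<K> \<Longrightarrow> K \<noteq> L \<Longrightarrow> ext M K \<inter> ext M L = {}"
  obtains C where "small C" "C \<subseteq> (\<Union>K\<in>\<K>. ext M K)" "\<And>K. K \<in> \<K> \<Longrightarrow> countable_in M (C \<inter> ext M K)"
    "\<And>K. K \<in> \<K> \<Longrightarrow> \<not> finite_in M (ext M K \<inter> C) \<and> \<not> finite_in M (ext M K - C)"
proof -
  have KD: "K \<in> Dom M" if "K \<in> \<K>" for K using small_Dom[OF small] that by blast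
  define good where "good K H \<longleftrightarrow> is_set M H \<and> ext M H \<subseteq> ext M K \<and> countable_in M (ext M H) \<and>
    \<not> finite_in M (ext M H) \<and> \<not> finite_in M (ext M K - ext M H)" for K H
  have U: "small (\<Union>K\<in>\<K>. ext M K)" by (rule small_UN[OF small])
  have ex: "\<exists>H\<in>{H. is_set M H \<and> ext M H \<subseteq> (\<Union>K\<in>\<K>. ext M K)}. good K H" if K: "K \<in> \<K>" for K
  proof -
    obtain H where "good K H" unfolding good_def using halve[OF small_ext[OF KD[OF K]] inf[OF K]]
      by blast
    then show ?thesis using K unfolding good_def by blast
  qed
  obtain c where c: "fun_on M c \<K> {H. is_set M H \<and> ext M H \<subseteq> (\<Union>K\<in>\<K>. ext M K)}"
    "\<And>K. K \<in> \<K> \<Longrightarrow> good K (app M c K)"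
  proof (rule choice_rel[OF small small_Pow[OF U], where ps="[]" and R=good])
    show "dfn M [] (\<lambda>e. good (e 0) (e (Suc 0)))" unfolding good_def by (intro dfn_intro)
  qed (use ex in auto)
  note good = c(2)
  have cD: "c \<in> Dom M" using fun_on_Dom[OF c(1)] by blast
  have "small (app M c ` \<K>)"
    by (rule small_image[where ps="[c]" and R="rel M c", OF small])
      (use cD rel_iff_app[OF c(1)] app_Dom[OF c(1)] in \<open>auto intro!: dfn_intro\<close>)
  then have smC: "small (\<Union>H\<in>app M c ` \<K>. ext M H)" by (rule small_UN)
  let ?C = "\<Union>H\<in>app M c ` \<K>. ext M H"
  have int: "ext M K \<inter> ?C = ext M (app M c K)" if K: "K \<in> \<K>" for K
  proof -
    have "ext M K \<inter> ext M (app M c L) = {}" if "L \<in> \<K>" "L \<noteq> K" for L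
      using good[OF that(1)] disj[OF that(1) K that(2)] unfolding good_def by blast
    moreover have "ext M (app M c K) \<subseteq> ext M K" using good[OF K] unfolding good_def by blast
    ultimately show ?thesis using K by auto
  qed
  show thesis
  proof (rule that[OF smC])
    show "?C \<subseteq> (\<Union>K\<in>\<K>. ext M K)" using good unfolding good_def by blast
    fix K assume K: "K \<in> \<K>"
    have diff: "ext M K - ?C = ext M K - ext M (app M c K)" using int[OF K] by blast
    show "countable_in M (?C \<inter> ext M K)" using good[OF K] int[OF K] unfolding good_def by
      (simp add: Int_commute)
    show "\<not> finite_in M (ext M K \<inter> ?C) \<and> \<not> finite_in M (ext M K - ?C)"
      using good[OF K] unfolding int[OF K] diff good_def by blast
  qed
qed

lemma extend_in_B:
  assumes m: "m \<in> omega B" and f: "f \<in> P_level B m"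
  shows "\<exists>d\<in>P_level B (B.suc m). le_P B d f"
proof -
  let ?T = "{zero_in B, one_in B}"
  define A where "A s = {a \<in> atoms M. app B f a = s}" for s
  define Y where "Y = {a \<in> atoms M. app B f a \<in> I_set B}"
  have fB: "fun_on B f (atoms M) (Q_set B)" using B.P_level_fun[OF f] by simp
  then have fh: "f \<in> hs" "f \<in> Dom M" unfolding fun_on_B by auto
  have mh: "m \<in> hs" "m \<in> Dom M" using m omega_hs unfolding omega_B by auto
  have T: "zero_in B \<in> hs" "one_in B \<in> hs" using B.zero_props(3) B.one_props(1) by auto
  have q: "fun_on B (app B f a) (ext B m) ?T" if "a \<in> atoms M" for a
    using B.P_level_app[OF f, of a] that by simp
  have relA: "A s = {a \<in> atoms M. rel M f a s}" for s
    unfolding A_def using B.rel_iff_app[OF fB] rel_B[OF fh(1)] by auto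
  have smA: "small (A s)" if "s \<in> hs" for s
    unfolding relA
  proof (rule sep[where ps="[f, s]", OF small_atoms])
  qed (use fh that in \<open>auto intro!: dfn_intro\<close>)
  have infA: "\<not> finite_in M (A s)" if "fun_on B s (ext B m) ?T" for s
  proof -
    have "\<not> finite_in B (A s)" using f that unfolding P_level_def A_def by simp
    then show ?thesis using finite_atoms_B[of "A s"] unfolding A_def by blast
  qed
  define \<K> where "\<K> = {K. is_set M K \<and> (\<exists>s. fun_on B s (ext B m) ?T \<and> ext M K = A s)}"
  \<comment> \<open>Smallness is shown in \<open>M\<close>, so the fibres are described there by
    \<open>rel\<close>. Zero and one of \<open>B\<close> enter as parameters, which spares a
    comparison with those of \<open>M\<close>.\<close>
  have "small {K \<in> {K. is_set M K \<and> ext M K \<subseteq> atoms M}. \<exists>s\<in>hs. fun_on M s (ext M m) ?T \<and>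
      ext M K = {a \<in> atoms M. rel M f a s}}"
  proof (rule sep[where ps="[f, m, zero_in B, one_in B]", OF small_Pow[OF small_atoms]])
  qed (use fh mh T in \<open>auto intro!: dfn_intro\<close>)
  moreover have "{K \<in> {K. is_set M K \<and> ext M K \<subseteq> atoms M}. \<exists>s\<in>hs. fun_on M s (ext M m) ?T \<and>
      ext M K = {a \<in> atoms M. rel M f a s}} = \<K>"
  proof -
    have "fun_on B s (ext B m) ?T \<longleftrightarrow> s \<in> hs \<and> fun_on M s (ext M m) ?T" for s
      unfolding fun_on_B using mh(1) T hs_ext[OF mh(1)] by auto
    moreover have "A s \<subseteq> atoms M" for s unfolding A_def by blast
    ultimately show ?thesis unfolding \<K>_def relA[symmetric] by auto
  qed
  ultimately have sm: "small \<K>" by simp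
  obtain C where C: "small C" "C \<subseteq> (\<Union>K\<in>\<K>. ext M K)" "\<And>K. K \<in> \<K> \<Longrightarrow> countable_in M (C \<inter> ext M K)"
    "\<And>K. K \<in> \<K> \<Longrightarrow> \<not> finite_in M (ext M K \<inter> C) \<and> \<not> finite_in M (ext M K - C)"
  proof (rule halve_family[OF sm])
    show "\<not> finite_in M (ext M K)" if "K \<in> \<K>" for K using that infA unfolding \<K>_def by auto
    show "ext M K \<inter> ext M L = {}" if KL: "K \<in> \<K>" "L \<in> \<K>" "K \<noteq> L" for K L
    proof -
      obtain s t where "is_set M K" "ext M K = A s" "is_set M L" "ext M L = A t"
        using KL(1,2) unfolding \<K>_def by blast
      then show ?thesis using KL(3) is_set_eqI[of K L] unfolding A_def by auto
    qed
  qed blast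
  have CA: "C \<subseteq> atoms M" using C(2) unfolding \<K>_def A_def by blast
  have fib: "mk (A s) \<in> \<K>" "ext M (mk (A s)) = A s" if "fun_on B s (ext B m) ?T" for s
  proof -
    have "s \<in> hs" using that unfolding fun_on_B by blast
    from mk_props[OF smA[OF this]] show "mk (A s) \<in> \<K>" "ext M (mk (A s)) = A s"
      unfolding \<K>_def using that by auto
  qed
  have Y: "countable_in M Y" "Y \<subseteq> atoms M"
    using f countable_B_M unfolding Y_def P_level_def by auto
  have one: "app B (app B f a) k = one_in B" if a: "a \<in> atoms M" "a \<notin> Y" and k: "k \<in> ext B m"
    for a k
  proof (rule ccontr)
    assume "app B (app B f a) k \<noteq> one_in B"
    then have "app B (app B f a) k = zero_in B" using B.app_in[OF q[OF a(1)] k] by blast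
    then have "rel B (app B f a) k (zero_in B)" using B.rel_iff_app[OF q[OF a(1)] k] by simp
    then have "app B f a \<in> I_set B"
      unfolding I_set_def using B.Q_setI[OF m q[OF a(1)]] B.omega_ext_subset[OF m] k by blast
    then show False using a unfolding Y_def by blast
  qed
  have "countable_in M (Y \<union> C)"
  proof (cases "C \<subseteq> Y")
    case True
    then show ?thesis using Y(1) by (simp add: Un_absorb2)
  next
    case False
    \<comment> \<open>By \<open>one\<close>, all atoms outside \<open>Y\<close> lie in a single
      fibre, and \<open>b\<close> represents it in place of the constant sequence 1.
      \<open>C\<close> meets that fibre in a countable set, and the rest of \<open>C\<close> lies in
      \<open>Y\<close>.\<close>
    then obtain b where b: "b \<in> C" "b \<notin> Y" "b \<in> atoms M" using CA by blast
    have "app B f a = app B f b" if "a \<in> C" "a \<notin> Y" for a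
    proof -
      have "a \<in> atoms M" using that CA by blast
      then show ?thesis using one that b by (intro B.fun_on_eqI[OF q q]) auto
    qed
    then have "Y \<union> C = Y \<union> (C \<inter> A (app B f b))" unfolding A_def using CA by blast
    moreover have "countable_in M (C \<inter> A (app B f b))"
      using C(3)[OF fib(1)[OF q[OF b(3)]]] fib(2)[OF q[OF b(3)]] by simp
    ultimately show ?thesis using countable_Un Y(1) by simp
  qed
  then have YC: "countable_in B (Y \<union> C)" using countable_atoms_B[of "Y \<union> C"] Y(2) CA by blast
  have "countable_in M C" using countable_subset[OF \<open>countable_in M (Y \<union> C)\<close> _ C(1)] by blast
  \<comment> \<open>An injection of \<open>C\<close> into the numbers belongs to \<open>B\<close>,
    and the domain of a function in \<open>B\<close> is a set of \<open>B\<close>.\<close>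
  then have smC: "B.small C" using countable_atoms_B[OF CA] B.countable_small by blast
  have inf: "\<not> finite_in B (A s \<inter> C) \<and> \<not> finite_in B (A s - C)" if "fun_on B s (ext B m) ?T" for s
    using C(4)[OF fib(1)[OF that]] finite_B_M unfolding fib(2)[OF that] by blast
  show ?thesis
    by (rule B.P_level_extend[OF f m smC]) (use CA YC inf in \<open>simp_all add: A_def Y_def\<close>)
qed

lemma generic_countable_in_perm_model:
  assumes "generic_filter B (P_set B) (le_P B) G" "n \<in> omega B"
  shows "\<exists>X. is_set B X \<and>
     ext B X = {a \<in> atoms B. \<exists>f\<in>G. \<exists>k\<in>ext B n. rel B (app B f a) k (zero_in B)} \<and>
     countable_in B (ext B X)"
  by (rule B.generic_countable[OF extend_in_B assms])

end

theorem theorem5p28: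
  fixes V B :: "'v struct" and G :: "'v set" and n :: 'v
  assumes "zfa V" and "axiom_of_choice V"
    and "\<not> countable_in V (atoms V)"
    and "B = perm_model V"
    and "generic_filter B (P_set B) (le_P B) G"
    and "n \<in> omega B"
  shows "\<exists>X. is_set B X \<and>
     ext B X = {a \<in> atoms B. \<exists>f\<in>G. \<exists>k\<in>ext B n. rel B (app B f a) k (zero_in B)} \<and>
     countable_in B (ext B X)"
proof -
  interpret zfac_model V
    by unfold_locales (rule assms(1), rule assms(2))
  show ?thesis
    using generic_countable_in_perm_model assms(4,5,6) by blast
qed

end
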